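(* Let $L$ be a CM-field with maximal real subfield $K$, and let $w_L$ be the number of roots of unity in $L$. (i) Suppose $w_L \equiv 2 \pmod 4$. 1. If $L/K$ is essentially ramified, then $Q(L)=1$ and $\kappa_{L/K}=1$. 2. If $L/K$ is not essentially ramified, then $L=K(\sqrt{\alpha})$ for some $\alpha\in\mathcal O_K$ with $\alpha\mathcal O_K=\mathfrak a^2$ for an integral ideal $\mathfrak a$ of $\mathcal O_K$; for such $\alpha$ and $\mathfrak a$: (a) if $\mathfrak a$ is principal, then $Q(L)=2$; (b) if $\mathfrak a$ is not principal, then $Q(L)=1$ and $\kappa_{L/K}=\langle[\mathfrak a]\rangle$. (ii) Suppose $w_L\equiv 2^m \pmod{2^{m+1}}$ for some integer $m\ge 2$. Then $L/K$ is not essentially ramified, and: 1. if $\pi_m\mathcal O_K$ is not the square of an ideal, then $Q(L)=1$ and $\kappa_{L/K}=1$; 2. if $\pi_m\mathcal O_K=\mathfrak b^2$ for some integral ideal $\mathfrak b$ of $\mathcal O_K$, then (a) $Q(L)=2$ if $\mathfrak b$ is principal, and (b) $Q(L)=1$ and $\kappa_{L/K}=\langle[\mathfrak b]\rangle$ if $\mathfrak b$ is not principal.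
   Context: All number fields are subfields of $\mathbb C$. A CM-field is a totally complex quadratic extension of a totally real number field; its maximal real subfield is the fixed field of complex conjugation $\sigma$. For a number field $F$: $\mathcal O_F$ is its ring of integers, $E_F$ its unit group, $W_F$ its group of roots of unity, $\mathrm{Cl}(F)$ its ideal class group, and $[\mathfrak a]$ the class of an ideal $\mathfrak a$. Hasse's unit index is $Q(L)=(E_L:W_LE_K)\in\{1,2\}$. The capitulation kernel $\kappa_{L/K}$ is the kernel of the map $\mathrm{Cl}(K)\to\mathrm{Cl}(L)$ induced by $\mathfrak a\mapsto\mathfrak a\mathcal O_L$. $L/K$ is called essentially ramified if, writing $L=K(\sqrt\alpha)$ with $\alpha\in K$, there is a prime ideal $\mathfrak p$ of $\mathcal O_K$ whose exact power dividing $\alpha$ is odd (this does not depend on the choice of $\alpha$). For $n\ge 2$, $\pi_n=2+\zeta_{2^n}+\zeta_{2^n}^{-1}$ where $\zeta_{2^n}=e^{2\pi i/2^n}$ (so $\pi_2=2$, $\pi_3=2+\sqrt2$, $\pi_n=2+\sqrt{\pi_{n-1}}$). *)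

theory Defs
  imports Complex_Main "HOL-Computational_Algebra.Polynomial"
begin

definition subfield :: "complex set \<Rightarrow> bool" where
  "subfield F \<longleftrightarrow> 0 \<in> F \<and> 1 \<in> F \<and>
     (\<forall>x\<in>F. \<forall>y\<in>F. x + y \<in> F \<and> x * y \<in> F) \<and>
     (\<forall>x\<in>F. - x \<in> F) \<and> (\<forall>x\<in>F. x \<noteq> 0 \<longrightarrow> inverse x \<in> F)"

definition number_field :: "complex set \<Rightarrow> bool" where
  "number_field F \<longleftrightarrow> subfield F \<and>
     (\<exists>B. finite B \<and> B \<subseteq> F \<and>
        (\<forall>x\<in>F. \<exists>c. x = (\<Sum>b\<in>B. of_rat (c b) * b)))"

definition embedding :: "complex set \<Rightarrow> (complex \<Rightarrow> complex) \<Rightarrow> bool" where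
  "embedding F s \<longleftrightarrow> s 1 = 1 \<and>
     (\<forall>x\<in>F. \<forall>y\<in>F. s (x + y) = s x + s y \<and> s (x * y) = s x * s y)"

definition totally_real :: "complex set \<Rightarrow> bool" where
  "totally_real F \<longleftrightarrow> (\<forall>s. embedding F s \<longrightarrow> s ` F \<subseteq> \<real>)"

definition totally_complex :: "complex set \<Rightarrow> bool" where
  "totally_complex F \<longleftrightarrow> (\<forall>s. embedding F s \<longrightarrow> \<not> s ` F \<subseteq> \<real>)"

definition adjoin :: "complex set \<Rightarrow> complex \<Rightarrow> complex set" where
  "adjoin K b = {x + y * b | x y. x \<in> K \<and> y \<in> K}"

definition quadratic_ext :: "complex set \<Rightarrow> complex set \<Rightarrow> bool" where
  "quadratic_ext K L \<longleftrightarrow> K \<subseteq> L \<and> (\<exists>b\<in>L. b \<notin> K \<and> L = adjoin K b)"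

definition CM_field :: "complex set \<Rightarrow> bool" where
  "CM_field L \<longleftrightarrow> number_field L \<and> totally_complex L \<and>
     (\<exists>K. number_field K \<and> totally_real K \<and> quadratic_ext K L)"

definition max_real_subfield :: "complex set \<Rightarrow> complex set" where
  "max_real_subfield L = {x \<in> L. cnj x = x}"

definition alg_int :: "complex \<Rightarrow> bool" where
  "alg_int x \<longleftrightarrow> (\<exists>p :: int poly. lead_coeff p = 1 \<and> poly (map_poly of_int p) x = 0)"

definition OK :: "complex set \<Rightarrow> complex set" where
  "OK F = {x \<in> F. alg_int x}"

definition units :: "complex set \<Rightarrow> complex set" where
  "units F = {x \<in> OK F. x \<noteq> 0 \<and> inverse x \<in> OK F}"

definition roots_of_unity :: "complex set \<Rightarrow> complex set" where
  "roots_of_unity F = {x \<in> F. \<exists>n::nat. n > 0 \<and> x ^ n = 1}"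

definition hasse_Q :: "complex set \<Rightarrow> complex set \<Rightarrow> nat" where
  "hasse_Q K L = (let H = {w * e | w e. w \<in> roots_of_unity L \<and> e \<in> units K}
                  in card ((\<lambda>x. (\<lambda>h. x * h) ` H) ` units L))"

definition is_ideal :: "complex set \<Rightarrow> complex set \<Rightarrow> bool" where
  "is_ideal F I \<longleftrightarrow> I \<subseteq> OK F \<and> 0 \<in> I \<and>
     (\<forall>x\<in>I. \<forall>y\<in>I. x + y \<in> I) \<and> (\<forall>r\<in>OK F. \<forall>x\<in>I. r * x \<in> I)"

definition nz_ideal :: "complex set \<Rightarrow> complex set \<Rightarrow> bool" where
  "nz_ideal F I \<longleftrightarrow> is_ideal F I \<and> I \<noteq> {0}"

definition ideal_gen :: "complex set \<Rightarrow> complex set \<Rightarrow> complex set" where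
  "ideal_gen F S = \<Inter> {I. is_ideal F I \<and> S \<subseteq> I}"

definition ideal_mult :: "complex set \<Rightarrow> complex set \<Rightarrow> complex set \<Rightarrow> complex set" where
  "ideal_mult F I J = ideal_gen F {a * b | a b. a \<in> I \<and> b \<in> J}"

fun ideal_pow :: "complex set \<Rightarrow> complex set \<Rightarrow> nat \<Rightarrow> complex set" where
  "ideal_pow F I 0 = OK F"
| "ideal_pow F I (Suc n) = ideal_mult F I (ideal_pow F I n)"

definition pideal :: "complex set \<Rightarrow> complex \<Rightarrow> complex set" where
  "pideal F x = (\<lambda>y. x * y) ` OK F"

definition principal :: "complex set \<Rightarrow> complex set \<Rightarrow> bool" where
  "principal F I \<longleftrightarrow> (\<exists>x\<in>OK F. I = pideal F x)"

definition prime_ideal :: "complex set \<Rightarrow> complex set \<Rightarrow> bool" where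
  "prime_ideal F P \<longleftrightarrow> nz_ideal F P \<and> P \<noteq> OK F \<and>
     (\<forall>a\<in>OK F. \<forall>b\<in>OK F. a * b \<in> P \<longrightarrow> a \<in> P \<or> b \<in> P)"

definition vP_int :: "complex set \<Rightarrow> complex set \<Rightarrow> complex \<Rightarrow> nat" where
  "vP_int F P x = (GREATEST k. x \<in> ideal_pow F P k)"

definition vP :: "complex set \<Rightarrow> complex set \<Rightarrow> complex \<Rightarrow> int" where
  "vP F P a = (let (x, y) = (SOME (x, y). x \<in> OK F \<and> y \<in> OK F \<and> x \<noteq> 0 \<and> y \<noteq> 0 \<and> a = x / y)
               in int (vP_int F P x) - int (vP_int F P y))"

definition ess_ramified :: "complex set \<Rightarrow> complex set \<Rightarrow> bool" where
  "ess_ramified K L \<longleftrightarrow> (\<exists>a\<in>K. a \<noteq> 0 \<and> (\<exists>b\<in>L. b^2 = a \<and> L = adjoin K b) \<and>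
      (\<exists>P. prime_ideal K P \<and> odd (vP K P a)))"

definition ideal_equiv :: "complex set \<Rightarrow> complex set \<Rightarrow> complex set \<Rightarrow> bool" where
  "ideal_equiv F I J \<longleftrightarrow> (\<exists>x\<in>OK F. \<exists>y\<in>OK F. x \<noteq> 0 \<and> y \<noteq> 0 \<and>
       (\<lambda>i. x * i) ` I = (\<lambda>j. y * j) ` J)"

definition ideal_class :: "complex set \<Rightarrow> complex set \<Rightarrow> complex set set" where
  "ideal_class F I = {J. nz_ideal F J \<and> ideal_equiv F I J}"

definition cap_kernel :: "complex set \<Rightarrow> complex set \<Rightarrow> complex set set set" where
  "cap_kernel K L = {ideal_class K I | I. nz_ideal K I \<and> principal L (ideal_gen L I)}"

definition trivial_classes :: "complex set \<Rightarrow> complex set set set" where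
  "trivial_classes K = {ideal_class K (OK K)}"

(* subgroup <[A]> of the finite group Cl(K): the powers of [A] *)
definition cyclic_classes :: "complex set \<Rightarrow> complex set \<Rightarrow> complex set set set" where
  "cyclic_classes K A = {ideal_class K (ideal_pow K A n) | n. True}"

definition cm_pi :: "nat \<Rightarrow> complex" where
  "cm_pi n = 2 + cis (2 * pi / 2 ^ n) + cis (- (2 * pi / 2 ^ n))"

end

(* Every beta in L whose quotient beta / cnj beta is integral satisfies beta / cnj beta \<in> W_L: all conjugates of the quotient
   lie on the unit circle, so Kronecker's theorem applies. Choose eta generating W_L modulo squares and theta in O_L
   with theta = eta * cnj theta; then beta = s * c or beta = s * theta * c for a root of unity s and some c in K.
   Here theta = sqrt alpha, eta = -1 if w_L = 2 mod 4, and theta = 1 + zeta, eta = zeta = zeta_(2^m) otherwise;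
   in both cases theta^2 is a root of unity times some delta in O_K (delta = alpha, respectively delta = pi_m).
   Applied to units beta this computes Q(L), applied to generators of I O_L it computes the capitulation kernel:
   the case beta = s * theta * c occurs iff delta O_K is the square of an ideal B (then B O_L = theta O_L), with
   I = c B. Nontrivial units correspond to B principal.

   The ideal theory of O_K rests on the finiteness of O_K / N: pigeonhole arguments show that primes are maximal
   and that a multiplier of a nonzero ideal is integral, and only finitely many ideals contain a given one. *)
theory Submission
  imports Defs "HOL-Computational_Algebra.Fundamental_Theorem_Algebra" "HOL-Library.FuncSet"
begin

section \<open>Algebraic integers\<close>

text \<open>A root of unity s satisfies s / cnj s = s^2, so scaling \<beta> by s changes \<beta> /
  cnj \<beta> only by a square: this is why W_L enters modulo squares. It is cyclic of even order,
  so there are two classes, which bounds Q(L) by 2. The equation \<theta> = \<eta> * cnj \<theta> is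
  Hilbert 90 for \<eta>; for \<eta> = \<zeta> the solution 1 + \<zeta> has relative norm 2 + \<zeta>
  + 1/\<zeta>, which is the origin of the number called \<open>cm_pi m\<close>. Essential
  ramification enters through parity: an integral radicand generates the square of an ideal exactly
  when all its valuations are even. If 4 divides w_L, then L contains the imaginary unit, every
  radicand is -1 times a square of K, and all valuations are even. Conclusions descend from L to K
  because an ideal of O_K is recovered from its extension by intersecting with K; this rests on
  invertibility of ideals. Finiteness of W_L has no proof of its own: the congruences for
  \<open>card W\<close> exclude 0, the value of \<open>card\<close> on infinite sets.\<close>

lemma alg_int_iff_algebraic_int: "alg_int x \<longleftrightarrow> algebraic_int x"
  unfolding alg_int_def algebraic_int_altdef_ipoly by auto

section \<open>Finitely generated subgroups of the complex numbers, and integrality\<close>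

interpretation int_span: Modules.module "\<lambda>(c::int) (x::complex). of_int c * x"
  by (rule Modules.module.intro) (simp_all add: distrib_left distrib_right)

text \<open>The integers are Noetherian, shown by induction on the generators. The coefficients of
  \<open>s\<close> in elements of \<open>M\<close>, taken modulo the span of \<open>S\<close>, form
  an ideal of the integers; its least positive element \<open>g\<close> is attained by some
  \<open>t\<close> in \<open>M\<close>. By division with remainder, \<open>t\<close> together with
  generators of \<open>M \<inter> int_span.span S\<close> generates \<open>M\<close>.\<close>

lemma int_submodule_finitely_generated:
  assumes "finite S" "int_span.subspace M" "M \<subseteq> int_span.span S"
  shows "\<exists>T. finite T \<and> M = int_span.span T"
  using assms
proof (induction S arbitrary: M rule: finite_induct)
  case empty
  then have "M = int_span.span {}" using int_span.subspace_0 by auto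
  then show ?case by blast
next
  case (insert s S)
  let ?N = "M \<inter> int_span.span S"
  have N: "int_span.subspace ?N"
    using insert.prems(1) int_span.subspace_span int_span.subspace_inter by blast
  obtain T where T: "finite T" "?N = int_span.span T"
    using insert.IH[OF N] by blast
  define A where "A = {n::nat. n > 0 \<and> (\<exists>t\<in>M. t - of_int (int n) * s \<in> int_span.span S)}"
  have M_decomp: "\<exists>k. x - of_int k * s \<in> int_span.span S" if "x \<in> M" for x
    using insert.prems(2) that int_span.span_breakdown_eq by blast
  show ?case
  proof (cases "A = {}")
    case True
    have "M \<subseteq> int_span.span S"
    proof
      fix x assume x: "x \<in> M"
      then obtain k where k: "x - of_int k * s \<in> int_span.span S" using M_decomp by blast
      have nx: "- x \<in> M" using x insert.prems(1) int_span.subspace_neg by blast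
      have nk: "- x - of_int (- k) * s \<in> int_span.span S"
        using int_span.span_neg[OF k] by (simp add: algebra_simps)
      have "k = 0"
      proof (rule ccontr)
        assume "k \<noteq> 0"
        then consider "k > 0" | "- k > 0" by linarith
        then have "nat \<bar>k\<bar> \<in> A"
        proof cases
          case 1
          then show ?thesis using k x by (auto simp: A_def intro!: bexI[of _ x])
        next
          case 2
          then show ?thesis using nk nx by (auto simp: A_def intro!: bexI[of _ "- x"])
        qed
        then show False using True by simp
      qed
      then show "x \<in> int_span.span S" using k by simp
    qed
    then show ?thesis using T by (metis Int_absorb2)
  next
    case False
    define g where "g = (LEAST n. n \<in> A)"
    have "g \<in> A" using False unfolding g_def by (metis LeastI ex_in_conv)
    have g_least: "n \<notin> A" if "n < g" for n using that not_less_Least unfolding g_def by blast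
    obtain t where t: "g > 0" "t \<in> M" "t - of_int (int g) * s \<in> int_span.span S"
      using \<open>g \<in> A\<close> by (auto simp: A_def)
    have "M = int_span.span (insert t T)"
    proof (intro equalityI subsetI)
      fix x assume x: "x \<in> M"
      then obtain k where k: "x - of_int k * s \<in> int_span.span S" using M_decomp by blast
      define y where "y = x - of_int (k div int g) * t"
      have y: "y \<in> M"
        unfolding y_def using x t insert.prems(1)
        by (intro int_span.subspace_diff int_span.subspace_scale)
      have "(x - of_int k * s) - of_int (k div int g) * (t - of_int (int g) * s) \<in> int_span.span S"
        by (intro int_span.span_diff int_span.span_scale k t)
      also have "(x - of_int k * s) - of_int (k div int g) * (t - of_int (int g) * s)
          = y - of_int (k - k div int g * int g) * s"
        by (simp add: y_def algebra_simps)
      also have "k - k div int g * int g = k mod int g" by (simp add: minus_div_mult_eq_mod)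
      finally have *: "y - of_int (k mod int g) * s \<in> int_span.span S" .
      have "k mod int g = 0"
      proof (rule ccontr)
        assume "k mod int g \<noteq> 0"
        then have pos: "k mod int g > 0" using t(1) by (simp add: le_neq_trans)
        then have "nat (k mod int g) \<in> A" using * y by (auto simp: A_def intro!: bexI[of _ y])
        moreover have "nat (k mod int g) < g" using t(1) pos by (simp add: nat_less_iff)
        ultimately show False using g_least by blast
      qed
      then have "y \<in> int_span.span T" using * y T by auto
      then show "x \<in> int_span.span (insert t T)"
        unfolding int_span.span_breakdown_eq y_def by blast
    next
      fix x assume "x \<in> int_span.span (insert t T)"
      then obtain k where "x - of_int k * t \<in> ?N"
        unfolding int_span.span_breakdown_eq T by blast
      then have "(x - of_int k * t) + of_int k * t \<in> M"
        using t insert.prems(1) by (intro int_span.subspace_add int_span.subspace_scale) auto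
      then show "x \<in> M" by simp
    qed
    then show ?thesis using T by blast
  qed
qed

text \<open>For \<open>f i = x ^ i\<close>: finitely many elements of Z[x] involve only powers below
  a common \<open>d\<close>.\<close>

lemma int_span_powers_bounded:
  assumes "finite T" "T \<subseteq> int_span.span (range f)"
  shows "\<exists>d::nat. T \<subseteq> int_span.span (f ` {..<d})"
  using assms
proof (induction T rule: finite_induct)
  case (insert t T)
  then obtain d where d: "T \<subseteq> int_span.span (f ` {..<d})" by blast
  have "t \<in> int_span.span (range f)" using insert.prems by blast
  then have "\<exists>e. t \<in> int_span.span (f ` {..<e})"
  proof (induction rule: int_span.span_induct_alt)
    case (step c x y)
    then obtain e i where ei: "y \<in> int_span.span (f ` {..<e})" "x = f i" by blast
    let ?e = "max e (Suc i)"
    have "y \<in> int_span.span (f ` {..<?e})"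
      using ei(1) int_span.span_mono[of "f ` {..<e}" "f ` {..<?e}"] by (auto simp: image_mono)
    moreover have "x \<in> int_span.span (f ` {..<?e})"
      using ei(2) by (intro int_span.span_base) auto
    ultimately show ?case by (blast intro: int_span.span_add int_span.span_scale)
  qed (use int_span.span_zero in blast)
  then obtain e where e: "t \<in> int_span.span (f ` {..<e})" by blast
  have "int_span.span (f ` {..<d}) \<subseteq> int_span.span (f ` {..<max d e})"
    and "int_span.span (f ` {..<e}) \<subseteq> int_span.span (f ` {..<max d e})"
    by (auto intro!: int_span.span_mono image_mono)
  then show ?case using d e by blast
qed blast

text \<open>Z[x] is a subgroup of the finitely generated \<open>int_span.span S\<close>, so it is
  finitely generated itself and hence spanned by the powers below some \<open>d\<close>. Expressing
  \<open>x ^ d\<close> by these is a monic equation for \<open>x\<close>. No determinant is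
  involved.\<close>

lemma alg_int_if_stable_span:
  assumes fin: "finite S" and one: "1 \<in> int_span.span S"
    and stable: "\<And>s. s \<in> S \<Longrightarrow> x * s \<in> int_span.span S"
  shows "alg_int x"
proof -
  have stable': "x * s \<in> int_span.span S" if "s \<in> int_span.span S" for s
    using that
  proof (induction rule: int_span.span_induct_alt)
    case (step c s y)
    have "x * (of_int c * s + y) = of_int c * (x * s) + x * y" by (simp add: algebra_simps)
    then show ?case using step stable by (simp only: int_span.span_add int_span.span_scale)
  qed (use int_span.span_zero in simp)
  let ?M = "int_span.span (range (\<lambda>n. x ^ n))"
  have "x ^ n \<in> int_span.span S" for n
    using one stable' by (induction n) auto
  then have "?M \<subseteq> int_span.span S"
    by (intro int_span.span_minimal) auto
  then obtain T where T: "finite T" "?M = int_span.span T"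
    using int_submodule_finitely_generated[OF fin int_span.subspace_span] by blast
  then have "T \<subseteq> ?M" using int_span.span_superset by blast
  then obtain d where "T \<subseteq> int_span.span ((\<lambda>n. x ^ n) ` {..<d})"
    using int_span_powers_bounded[OF T(1)] by blast
  then have "?M \<subseteq> int_span.span ((\<lambda>n. x ^ n) ` {..<d})"
    using T(2) int_span.span_minimal by blast
  then have "x ^ d \<in> int_span.span ((\<lambda>n. x ^ n) ` {..<d})"
    using int_span.span_base by blast
  then have "\<exists>c. x ^ d = (\<Sum>i<d. of_int (c i) * x ^ i)"
  proof (induction rule: int_span.span_induct_alt)
    case base
    show ?case by (intro exI[of _ "\<lambda>_. 0"]) simp
  next
    case (step k s y)
    then obtain c j where c: "y = (\<Sum>i<d. of_int (c i) * x ^ i)" and j: "s = x ^ j" "j < d"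
      by blast
    have "of_int k * s + y = (\<Sum>i<d. of_int (c i + (if i = j then k else 0)) * x ^ i)"
      using j by (simp add: c distrib_right sum.distrib if_distrib[of "\<lambda>z. z * _"] if_distrib[of of_int] cong: if_cong)
    then show ?case by (intro exI[of _ "\<lambda>i. c i + (if i = j then k else 0)"])
  qed
  then obtain c where c: "x ^ d = (\<Sum>i<d. of_int (c i) * x ^ i)" by blast
  define p where "p = monom 1 d - (\<Sum>i<d. monom (c i) i)"
  have coeff_p: "coeff p k = (if k = d then 1 else if k < d then - c k else 0)" for k
    by (auto simp: p_def coeff_sum)
  then have deg: "degree p = d"
    by (intro antisym degree_le le_degree) auto
  have "poly (map_poly of_int p) x = (\<Sum>i\<le>d. of_int (coeff p i) * x ^ i)"
    by (simp add: poly_altdef deg degree_map_poly coeff_map_poly)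
  also have "\<dots> = x ^ d + (\<Sum>i<d. of_int (- c i) * x ^ i)"
    by (simp add: lessThan_Suc_atMost[symmetric] coeff_p)
  also have "\<dots> = 0" by (simp add: c sum_negf)
  finally show ?thesis using coeff_p deg unfolding alg_int_def by (intro exI[of _ p]) auto
qed

lemma alg_int_power_reduce:
  assumes "alg_int x"
  obtains d where "d > 0" "x ^ d \<in> int_span.span ((\<lambda>i. x ^ i) ` {..<d})"
proof -
  obtain p :: "int poly" where p: "lead_coeff p = 1" "poly (map_poly of_int p) x = 0"
    using assms alg_int_def by auto
  let ?d = "degree p"
  have pos: "?d > 0"
  proof (rule ccontr)
    assume "\<not> ?thesis"
    then have "p = 1" using p(1) by (auto elim!: degree_eq_zeroE simp: one_pCons)
    then show False using p by simp
  qed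
  have "0 = (\<Sum>i\<le>?d. of_int (coeff p i) * x ^ i)"
    using p(2) by (simp add: poly_altdef degree_map_poly coeff_map_poly)
  also have "\<dots> = (\<Sum>i<?d. of_int (coeff p i) * x ^ i) + x ^ ?d"
    using p(1) by (simp add: lessThan_Suc_atMost[symmetric])
  finally have "x ^ ?d = (\<Sum>i<?d. of_int (- coeff p i) * x ^ i)"
    by (simp add: sum_negf eq_neg_iff_add_eq_0 add.commute)
  then have "x ^ ?d \<in> int_span.span ((\<lambda>i. x ^ i) ` {..<?d})"
    by (simp only:) (intro int_span.span_sum int_span.span_scale int_span.span_base imageI)
  then show ?thesis using that pos by blast
qed

lemma int_span_mult_stable:
  assumes "\<And>s. s \<in> S \<Longrightarrow> x * s \<in> int_span.span T" "y \<in> int_span.span S"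
  shows "x * y \<in> int_span.span T"
  using assms(2)
proof (induction rule: int_span.span_induct_alt)
  case (step c s y)
  have "x * (of_int c * s + y) = of_int c * (x * s) + x * y" by (simp add: algebra_simps)
  then show ?case using step assms(1)[of s] by (simp only: int_span.span_add int_span.span_scale)
qed (use int_span.span_zero in simp)

text \<open>The products \<open>x ^ i * y ^ j\<close> with \<open>i < d\<close> and
  \<open>j < e\<close> span a group stable under multiplication by \<open>x\<close> and by
  \<open>y\<close>, hence by \<open>x + y\<close> and \<open>x * y\<close>.\<close>

lemma alg_int_add_mult:
  assumes "alg_int x" "alg_int y"
  shows alg_int_add: "alg_int (x + y)" and alg_int_mult: "alg_int (x * y)"
proof -
  obtain d where d: "d > 0" "x ^ d \<in> int_span.span ((\<lambda>i. x ^ i) ` {..<d})"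
    using alg_int_power_reduce[OF assms(1)] .
  obtain e where e: "e > 0" "y ^ e \<in> int_span.span ((\<lambda>i. y ^ i) ` {..<e})"
    using alg_int_power_reduce[OF assms(2)] .
  define S where "S = (\<lambda>(i, j). x ^ i * y ^ j) ` ({..<d} \<times> {..<e})"
  have S: "x ^ i * y ^ j \<in> S" if "i < d" "j < e" for i j
    using that by (auto simp: S_def)
  have fin: "finite S" by (simp add: S_def)
  have one: "1 \<in> int_span.span S" using S[of 0 0] d e by (simp add: int_span.span_base)
  have xs: "x * s \<in> int_span.span S" if "s \<in> S" for s
  proof -
    from that obtain i j where ij: "i < d" "j < e" "s = x ^ i * y ^ j"
      by (auto simp: S_def)
    show ?thesis
    proof (cases "Suc i < d")
      case True
      then show ?thesis using S[of "Suc i" j] ij by (simp add: int_span.span_base mult.assoc)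
    next
      case False
      then have "d = Suc i" using ij by simp
      then have "x * s = y ^ j * x ^ d" using ij by simp
      moreover have "y ^ j * x ^ d \<in> int_span.span S"
        by (rule int_span_mult_stable[OF _ d(2)])
           (use S ij in \<open>auto simp: mult.commute[of "_ ^ j"] intro!: int_span.span_base\<close>)
      ultimately show ?thesis by simp
    qed
  qed
  have ys: "y * s \<in> int_span.span S" if "s \<in> S" for s
  proof -
    from that obtain i j where ij: "i < d" "j < e" "s = x ^ i * y ^ j"
      by (auto simp: S_def)
    show ?thesis
    proof (cases "Suc j < e")
      case True
      then show ?thesis using S[of i "Suc j"] ij by (simp add: int_span.span_base mult.left_commute)
    next
      case False
      then have "e = Suc j" using ij by simp
      then have "y * s = x ^ i * y ^ e" using ij by simp
      moreover have "x ^ i * y ^ e \<in> int_span.span S"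
        by (rule int_span_mult_stable[OF _ e(2)])
           (use S ij in \<open>auto intro!: int_span.span_base\<close>)
      ultimately show ?thesis by simp
    qed
  qed
  show "alg_int (x + y)"
    by (rule alg_int_if_stable_span[OF fin one])
       (simp add: distrib_right int_span.span_add xs ys)
  show "alg_int (x * y)"
    by (rule alg_int_if_stable_span[OF fin one])
       (simp add: mult.assoc int_span_mult_stable[OF xs ys])
qed

lemma alg_int_of_int [simp]: "alg_int (of_int k)"
  by (simp add: alg_int_iff_algebraic_int int_imp_algebraic_int)

lemma alg_int_0 [simp]: "alg_int 0" and alg_int_1 [simp]: "alg_int 1"
  and alg_int_of_nat [simp]: "alg_int (of_nat n)"
  by (simp_all add: alg_int_iff_algebraic_int int_imp_algebraic_int)

lemma alg_int_minus: "alg_int x \<Longrightarrow> alg_int (- x)"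
  by (simp add: alg_int_iff_algebraic_int)

lemma alg_int_diff: "alg_int x \<Longrightarrow> alg_int y \<Longrightarrow> alg_int (x - y)"
  using alg_int_add[OF _ alg_int_minus] by fastforce

lemma alg_int_cnj: "alg_int x \<Longrightarrow> alg_int (cnj x)"
  by (simp add: alg_int_iff_algebraic_int)

lemma alg_int_power: "alg_int x \<Longrightarrow> alg_int (x ^ n)"
  by (induction n) (auto intro: alg_int_mult)

lemma alg_int_sum: "(\<And>i. i \<in> I \<Longrightarrow> alg_int (f i)) \<Longrightarrow> alg_int (sum f I)"
  by (induction I rule: infinite_finite_induct) (auto intro: alg_int_add)

lemma alg_int_Rats_imp_Ints: "alg_int x \<Longrightarrow> x \<in> \<rat> \<Longrightarrow> x \<in> \<int>"
  by (simp add: alg_int_iff_algebraic_int rational_algebraic_int_is_int)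

lemma alg_int_of_monic_poly:
  assumes "alg_int (poly p x)" "\<forall>i. coeff p i \<in> \<int>" "lead_coeff p = 1" "degree p > 0"
  shows "alg_int x"
  using algebraic_int_root[OF _ refl assms(2-4)] assms(1) by (simp add: alg_int_iff_algebraic_int)

lemma alg_int_of_power:
  assumes "alg_int (x ^ n)" "n > 0"
  shows "alg_int x"
  by (rule alg_int_of_monic_poly[of "monom 1 n"]) (use assms in \<open>auto simp: poly_monom degree_monom_eq\<close>)

text \<open>The form in which pigeonhole arguments yield integrality: it suffices that two powers of
  \<open>x\<close> agree up to an algebraic integer.\<close>

lemma alg_int_of_power_diff:
  assumes "alg_int (x ^ j - x ^ i)" "i < j"
  shows "alg_int x"
proof (rule alg_int_of_monic_poly[of "monom 1 j - monom 1 i"])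
  have deg: "degree (monom 1 j - monom 1 i :: complex poly) = j"
    using assms(2) by (intro antisym degree_le le_degree) auto
  show "lead_coeff (monom 1 j - monom 1 i :: complex poly) = 1"
    unfolding deg using assms(2) by simp
  show "degree (monom 1 j - monom 1 i :: complex poly) > 0"
    unfolding deg using assms(2) by simp
qed (use assms in \<open>auto simp: poly_monom\<close>)

section \<open>Number fields and their residue rings\<close>

interpretation rat_span: Vector_Spaces.vector_space "\<lambda>(r::rat) (x::complex). of_rat r * x"
  by (rule Vector_Spaces.vector_space.intro) (simp_all add: distrib_left distrib_right of_rat_add of_rat_mult)

lemma common_denominator:
  fixes u :: "'a \<Rightarrow> rat"
  assumes "finite I"
  shows "\<exists>D::int. D > 0 \<and> (\<forall>i\<in>I. \<exists>k::int. of_int D * u i = of_int k)"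
  using assms
proof (induction I rule: finite_induct)
  case empty
  show ?case by (intro exI[of _ 1]) simp
next
  case (insert j I)
  then obtain D where D: "D > 0" "\<forall>i\<in>I. \<exists>k::int. of_int D * u i = of_int k" by blast
  obtain a b where ab: "quotient_of (u j) = (a, b)" by fastforce
  then have b: "b > 0" "u j = of_int a / of_int b"
    using quotient_of_denom_pos quotient_of_div by blast+
  have "\<exists>k::int. of_int (D * b) * u i = of_int k" if i: "i \<in> insert j I" for i
  proof (cases "i = j")
    case True
    then show ?thesis using b by (intro exI[of _ "D * a"]) simp
  next
    case False
    then obtain k where "of_int D * u i = of_int k" using i D by blast
    then show ?thesis by (intro exI[of _ "k * b"]) (simp add: mult.assoc mult.left_commute)
  qed
  then show ?case using D b by (intro exI[of _ "D * b"]) simp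
qed

text \<open>Dividing by the gcd of the coefficients, which is nonzero because one of them is.
  Primitivity matters because a primitive relation stays nontrivial modulo every prime.\<close>

lemma primitive_int_coeffs:
  fixes c :: "nat \<Rightarrow> int" and f :: "nat \<Rightarrow> complex"
  assumes c: "i \<le> n" "c i \<noteq> 0" "(\<Sum>i\<le>n. of_int (c i) * f i) = 0"
  shows "\<exists>c'. (\<Sum>i\<le>n. of_int (c' i) * f i) = 0 \<and> (\<forall>q. (\<forall>i\<le>n. q dvd c' i) \<longrightarrow> is_unit q)"
proof -
  define g where "g = Gcd (c ` {..n})"
  have g: "g \<noteq> 0" using c by (auto simp: g_def)
  define c' where "c' = (\<lambda>i. c i div g)"
  have cc: "c i = g * c' i" if "i \<le> n" for i
  proof -
    have "g dvd c i" unfolding g_def using that by (intro Gcd_dvd) auto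
    then show ?thesis by (simp add: c'_def)
  qed
  have "0 = (\<Sum>i\<le>n. of_int (g * c' i) * f i)" using c(3) cc by simp
  also have "\<dots> = of_int g * (\<Sum>i\<le>n. of_int (c' i) * f i)"
    unfolding sum_distrib_left by (intro sum.cong) simp_all
  finally have "(\<Sum>i\<le>n. of_int (c' i) * f i) = 0" using g by simp
  moreover have "is_unit q" if "\<forall>i\<le>n. q dvd c' i" for q
  proof -
    have "g * q dvd Gcd (c ` {..n})"
      using that cc by (intro Gcd_greatest) auto
    then show ?thesis using g by (simp add: g_def[symmetric])
  qed
  ultimately show ?thesis by blast
qed

section \<open>Arithmetic in a number field and its ring of integers\<close>

locale subfield_ctx =
  fixes F :: "complex set"
  assumes subfield: "subfield F"
begin

lemma zero_in [simp]: "0 \<in> F" and one_in [simp]: "1 \<in> F"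
  and add_in: "x \<in> F \<Longrightarrow> y \<in> F \<Longrightarrow> x + y \<in> F"
  and mult_in: "x \<in> F \<Longrightarrow> y \<in> F \<Longrightarrow> x * y \<in> F"
  and minus_in: "x \<in> F \<Longrightarrow> - x \<in> F"
  and inverse_in: "x \<in> F \<Longrightarrow> inverse x \<in> F"
  \<comment> \<open>The case \<open>x = 0\<close> serves \<open>inverse_in\<close>, where
    \<open>inverse 0 = 0\<close>.\<close>
  using subfield by (cases "x = 0"; auto simp: subfield_def)+

lemma diff_in: "x \<in> F \<Longrightarrow> y \<in> F \<Longrightarrow> x - y \<in> F"
  using add_in[OF _ minus_in] by fastforce

lemma divide_in: "x \<in> F \<Longrightarrow> y \<in> F \<Longrightarrow> x / y \<in> F"
  by (simp add: divide_inverse mult_in inverse_in)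

lemma of_nat_in [simp]: "of_nat n \<in> F"
  by (induction n) (auto intro: add_in)

lemma of_int_in [simp]: "of_int n \<in> F"
  by (cases n) (auto intro: minus_in simp del: of_nat_Suc)

lemma of_rat_in [simp]: "of_rat r \<in> F"
  by (cases r) (simp add: of_rat_rat divide_in)

lemma power_in: "x \<in> F \<Longrightarrow> x ^ n \<in> F"
  by (induction n) (auto intro: mult_in)

lemma sum_in: "(\<And>i. i \<in> I \<Longrightarrow> f i \<in> F) \<Longrightarrow> sum f I \<in> F"
  by (induction I rule: infinite_finite_induct) (auto intro: add_in)

end

locale number_field_ctx = subfield_ctx +
  assumes finite_dimensional: "\<exists>B. finite B \<and> B \<subseteq> F \<and> (\<forall>x\<in>F. \<exists>c. x = (\<Sum>b\<in>B. of_rat (c b) * b))"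

lemma number_field_iff_ctx: "number_field F \<longleftrightarrow> number_field_ctx F"
  by (simp add: number_field_def number_field_ctx_def subfield_ctx_def number_field_ctx_axioms_def)

context number_field_ctx
begin

lemma OK_in: "x \<in> OK F \<Longrightarrow> x \<in> F" and OK_alg_int: "x \<in> OK F \<Longrightarrow> alg_int x"
  by (auto simp: OK_def)

lemma OK_0 [simp]: "0 \<in> OK F" and OK_1 [simp]: "1 \<in> OK F"
  and OK_of_nat [simp]: "of_nat n \<in> OK F" and OK_of_int [simp]: "of_int k \<in> OK F"
  and OK_add: "x \<in> OK F \<Longrightarrow> y \<in> OK F \<Longrightarrow> x + y \<in> OK F"
  and OK_mult: "x \<in> OK F \<Longrightarrow> y \<in> OK F \<Longrightarrow> x * y \<in> OK F"
  and OK_minus: "x \<in> OK F \<Longrightarrow> - x \<in> OK F"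
  and OK_diff: "x \<in> OK F \<Longrightarrow> y \<in> OK F \<Longrightarrow> x - y \<in> OK F"
  and OK_power: "x \<in> OK F \<Longrightarrow> x ^ m \<in> OK F"
  and OK_sum: "(\<And>i. i \<in> I \<Longrightarrow> f i \<in> OK F) \<Longrightarrow> sum f I \<in> OK F"
  by (auto simp: OK_def intro: alg_int_add alg_int_mult alg_int_minus alg_int_diff alg_int_power
      alg_int_sum add_in mult_in minus_in diff_in power_in sum_in)

text \<open>More elements than a rational spanning set has are dependent over the rationals; then
  denominators are cleared and the gcd is divided out. The uniform \<open>n\<close> later bounds
  both the degrees of elements of \<open>F\<close> and the dimension of O_F / p.\<close>

lemma int_dependence:
  "\<exists>n. \<forall>f :: nat \<Rightarrow> complex. (\<forall>i\<le>n. f i \<in> F) \<longrightarrow>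
    (\<exists>c :: nat \<Rightarrow> int. (\<Sum>i\<le>n. of_int (c i) * f i) = 0 \<and> (\<forall>q. (\<forall>i\<le>n. q dvd c i) \<longrightarrow> is_unit q))"
proof -
  obtain B where B: "finite B" "\<And>x. x \<in> F \<Longrightarrow> \<exists>c. x = (\<Sum>b\<in>B. of_rat (c b) * b)"
    using finite_dimensional by blast
  have span: "x \<in> rat_span.span B" if "x \<in> F" for x
    using B that unfolding rat_span.span_finite[OF B(1)] by blast
  let ?n = "card B"
  have "\<exists>c :: nat \<Rightarrow> int. (\<Sum>i\<le>?n. of_int (c i) * f i) = 0 \<and> (\<forall>q. (\<forall>i\<le>?n. q dvd c i) \<longrightarrow> is_unit q)"
    if f: "\<And>i. i \<le> ?n \<Longrightarrow> f i \<in> F" for f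
  proof -
    have "\<exists>c::nat \<Rightarrow> int. \<exists>i\<le>?n. c i \<noteq> 0 \<and> (\<Sum>i\<le>?n. of_int (c i) * f i) = 0"
    \<comment> \<open>Dependence is a property of sets, so a family with a repeated value needs the
      explicit relation \<open>f i - f j = 0\<close>.\<close>
    proof (cases "inj_on f {..?n}")
      case False
      then obtain i j where ij: "i \<le> ?n" "j \<le> ?n" "i \<noteq> j" "f i = f j"
        by (auto simp: inj_on_def)
      define c :: "nat \<Rightarrow> int" where "c = (\<lambda>k. (if k = i then 1 else 0) - (if k = j then 1 else 0))"
      have "(\<Sum>k\<le>?n. of_int (c k) * f k) =
          (\<Sum>k\<le>?n. (if k = i then f k else 0)) - (\<Sum>k\<le>?n. (if k = j then f k else 0))"
        unfolding sum_subtractf[symmetric] by (intro sum.cong) (auto simp: c_def)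
      also have "\<dots> = 0" using ij by simp
      finally show ?thesis using ij by (intro exI[of _ c] exI[of _ i]) (auto simp: c_def)
    next
      case True
      let ?S = "f ` {..?n}"
      have "card ?S = Suc ?n" using True by (simp add: card_image)
      moreover have "?S \<subseteq> rat_span.span B" using f span by auto
      ultimately have "rat_span.dependent ?S"
        using rat_span.independent_span_bound[OF B(1), of ?S] by auto
      then obtain u where u: "\<exists>v\<in>?S. u v \<noteq> 0" "(\<Sum>v\<in>?S. of_rat (u v) * v) = 0"
        unfolding rat_span.dependent_finite[OF finite_imageI[OF finite_atMost]] by blast
      have u_sum: "(\<Sum>i\<le>?n. of_rat (u (f i)) * f i) = 0"
        using u(2) sum.reindex[OF True, of "\<lambda>v. of_rat (u v) * v"] by simp
      obtain D where D: "D > 0" "\<And>i. i \<in> {..?n} \<Longrightarrow> \<exists>k::int. of_int D * u (f i) = of_int k"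
        using common_denominator[of "{..?n}" "\<lambda>i. u (f i)"] by auto
      then obtain c :: "nat \<Rightarrow> int" where c: "\<And>i. i \<in> {..?n} \<Longrightarrow> of_int D * u (f i) = of_int (c i)"
        by metis
      have "(of_int (c i) :: complex) = of_int D * of_rat (u (f i))" if "i \<in> {..?n}" for i
        using arg_cong[OF c[OF that], of "of_rat :: rat \<Rightarrow> complex"] by (simp add: of_rat_mult)
      then have "(\<Sum>i\<le>?n. of_int (c i) * f i) = of_int D * (\<Sum>i\<le>?n. of_rat (u (f i)) * f i)"
        unfolding sum_distrib_left by (intro sum.cong) simp_all
      then have sum: "(\<Sum>i\<le>?n. of_int (c i) * f i) = 0" using u_sum by simp
      obtain i where i: "i \<le> ?n" "u (f i) \<noteq> 0" using u(1) by auto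
      then have "c i \<noteq> 0" using c[of i] D(1) by auto
      then show ?thesis using sum i by blast
    qed
    then show ?thesis using primitive_int_coeffs by blast
  qed
  then show ?thesis by blast
qed

text \<open>If \<open>a\<close> is the leading coefficient of an integral equation of degree
  \<open>d\<close> for \<open>y\<close>, multiplying that equation by \<open>a ^ (d - 1)\<close>
  gives a monic one for \<open>a * y\<close>.\<close>

lemma int_multiple_in_OK:
  assumes y: "y \<in> F"
  shows "\<exists>N::nat. N > 0 \<and> of_nat N * y \<in> OK F"
proof -
  obtain n :: nat and c :: "nat \<Rightarrow> int"
    where c: "(\<Sum>i\<le>n. of_int (c i) * y ^ i) = 0" "\<forall>q. (\<forall>i\<le>n. q dvd c i) \<longrightarrow> is_unit q"
    using int_dependence power_in[OF y] by blast
  \<comment> \<open>Primitivity for the divisor 0 says that not all coefficients vanish.\<close>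
  have "\<exists>i. i \<le> n \<and> c i \<noteq> 0" using c(2)[rule_format, of 0] by auto
  define d where "d = Max {i. i \<le> n \<and> c i \<noteq> 0}"
  have fin: "finite {i. i \<le> n \<and> c i \<noteq> 0}" by simp
  have d: "d \<le> n" "c d \<noteq> 0"
    using Max_in[OF fin] \<open>\<exists>i. i \<le> n \<and> c i \<noteq> 0\<close> unfolding d_def by auto
  have c0: "c i = 0" if "i \<le> n" "i > d" for i
    using Max_ge[OF fin, of i] that unfolding d_def by fastforce
  have "0 = (\<Sum>i\<le>d. of_int (c i) * y ^ i)"
    unfolding c(1)[symmetric] by (intro sum.mono_neutral_right) (use d c0 in auto)
  also have "\<dots> = (\<Sum>i<d. of_int (c i) * y ^ i) + of_int (c d) * y ^ d"
    by (simp add: lessThan_Suc_atMost[symmetric])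
  finally have rel: "of_int (c d) * y ^ d = - (\<Sum>i<d. of_int (c i) * y ^ i)"
    by (simp add: eq_neg_iff_add_eq_0 add.commute)
  have "d > 0"
  proof (rule ccontr)
    assume "\<not> d > 0"
    then show False using rel d by simp
  qed
  define a where "a = c d"
  define z where "z = of_int a * y"
  have "z ^ d = of_int a ^ (d - 1) * (of_int a * y ^ d)"
    using \<open>d > 0\<close> by (cases d) (simp_all add: z_def power_mult_distrib)
  also have "\<dots> = (\<Sum>i<d. of_int (- c i * a ^ (d - 1 - i)) * z ^ i)"
  proof -
    have "of_int a ^ (d - 1) * (of_int (c i) * y ^ i) = of_int (c i * a ^ (d - 1 - i)) * z ^ i"
      if "i < d" for i
    proof -
      have "of_int a ^ (d - 1) = (of_int a ^ (d - 1 - i) * of_int a ^ i :: complex)"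
        using that by (simp flip: power_add)
      then show ?thesis by (simp add: z_def power_mult_distrib)
    qed
    then have "(\<Sum>i<d. of_int a ^ (d - 1) * (of_int (c i) * y ^ i))
        = (\<Sum>i<d. of_int (c i * a ^ (d - 1 - i)) * z ^ i)"
      by (intro sum.cong) auto
    then show ?thesis
      unfolding rel[folded a_def] by (simp only: sum_distrib_left[symmetric] sum_negf mult_minus_left mult_minus_right of_int_minus)
  qed
  finally have zd: "z ^ d = (\<Sum>i<d. of_int (- c i * a ^ (d - 1 - i)) * z ^ i)" .
  have "alg_int z"
  proof (rule alg_int_if_stable_span)
    let ?S = "(\<lambda>i. z ^ i) ` {..<d}"
    show "finite ?S" by simp
    show "1 \<in> int_span.span ?S" using \<open>d > 0\<close> by (intro int_span.span_base image_eqI[of _ _ 0]) auto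
    fix s assume "s \<in> ?S"
    then obtain i where i: "i < d" "s = z ^ i" by auto
    show "z * s \<in> int_span.span ?S"
    proof (cases "Suc i < d")
      case True
      then show ?thesis using i by (intro int_span.span_base image_eqI[of _ _ "Suc i"]) auto
    next
      case False
      then have "d = Suc i" using i by simp
      then have "z * s = z ^ d" using i by simp
      moreover have "z ^ d \<in> int_span.span ?S"
        unfolding zd by (intro int_span.span_sum int_span.span_scale int_span.span_base imageI)
      ultimately show ?thesis by simp
    qed
  qed
  then have "z \<in> OK F" using y by (simp add: OK_def z_def mult_in)
  moreover have "of_nat (nat \<bar>a\<bar>) * y = z \<or> of_nat (nat \<bar>a\<bar>) * y = - z"
    by (cases "a \<ge> 0") (simp_all add: z_def)
  ultimately have "of_nat (nat \<bar>a\<bar>) * y \<in> OK F" using OK_minus by metis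
  then show ?thesis using d by (intro exI[of _ "nat \<bar>a\<bar>"]) (simp add: a_def)
qed

text \<open>\<open>N\<close> is a denominator of \<open>inverse x\<close>; it takes the place of the
  norm of \<open>x\<close>.\<close>

lemma OK_dvd_nat:
  assumes "x \<in> OK F" "x \<noteq> 0"
  shows "\<exists>N::nat. N > 0 \<and> (\<exists>y\<in>OK F. x * y = of_nat N)"
proof -
  obtain N where "N > 0" "of_nat N * inverse x \<in> OK F"
    using int_multiple_in_OK[OF inverse_in[OF OK_in[OF assms(1)]]] by blast
  then show ?thesis using assms by (intro exI[of _ N]) (auto intro!: bexI[of _ "of_nat N * inverse x"])
qed

lemma fraction:
  assumes "x \<in> F"
  shows "\<exists>y\<in>OK F. \<exists>z\<in>OK F. z \<noteq> 0 \<and> x = y / z"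
proof -
  obtain N :: nat where N: "N > 0" "of_nat N * x \<in> OK F" using int_multiple_in_OK[OF assms] by blast
  then show ?thesis by (intro bexI[of _ "of_nat N * x"] bexI[of _ "of_nat N"]) auto
qed

text \<open>\<open>indep\<close> is linear independence over the field with p elements of classes in
  O_F / p. Independent families have bounded length, so one of maximal length exists; it is a basis
  of O_F / p, and its combinations with coefficients from 0 to p - 1 represent all residues.\<close>

lemma finite_residues_prime:
  assumes p: "prime (p::nat)"
  shows "\<exists>R. finite R \<and> R \<subseteq> OK F \<and> (\<forall>x\<in>OK F. \<exists>r\<in>R. \<exists>y\<in>OK F. x = r + of_nat p * y)"
proof -
  define indep where "indep m f \<longleftrightarrow> (\<forall>i<m. f i \<in> OK F) \<and>
    (\<forall>c::nat \<Rightarrow> int. (\<exists>y\<in>OK F. (\<Sum>i<m. of_int (c i) * f i) = of_nat p * y) \<longrightarrow> (\<forall>i<m. int p dvd c i))"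
    for m and f :: "nat \<Rightarrow> complex"
  obtain n where n: "\<forall>f :: nat \<Rightarrow> complex. (\<forall>i\<le>n. f i \<in> F) \<longrightarrow>
    (\<exists>c :: nat \<Rightarrow> int. (\<Sum>i\<le>n. of_int (c i) * f i) = 0 \<and> (\<forall>q. (\<forall>i\<le>n. q dvd c i) \<longrightarrow> is_unit q))"
    using int_dependence by blast
  \<comment> \<open>A longer family would contain n + 1 elements with a primitive relation, which is
    a nontrivial relation modulo p.\<close>
  have bound: "m \<le> n" if "indep m f" for m f
  proof (rule ccontr)
    assume "\<not> m \<le> n"
    then have "\<forall>i\<le>n. f i \<in> F" using that OK_in unfolding indep_def by auto
    then obtain c :: "nat \<Rightarrow> int" where c: "(\<Sum>i\<le>n. of_int (c i) * f i) = 0"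
        "\<forall>q. (\<forall>i\<le>n. q dvd c i) \<longrightarrow> is_unit q"
      using n by blast
    define c' where "c' = (\<lambda>i. if i \<le> n then c i else 0)"
    have "(\<Sum>i<m. of_int (c' i) * f i) = (\<Sum>i\<le>n. of_int (c i) * f i)"
      by (rule sum.mono_neutral_cong_right) (use \<open>\<not> m \<le> n\<close> in \<open>auto simp: c'_def\<close>)
    then have "\<exists>y\<in>OK F. (\<Sum>i<m. of_int (c' i) * f i) = of_nat p * y"
      using c by (intro bexI[of _ 0]) auto
    then have "\<forall>i<m. int p dvd c' i" using that unfolding indep_def by blast
    then have "\<forall>i\<le>n. int p dvd c i" using \<open>\<not> m \<le> n\<close> by (auto simp: c'_def split: if_splits)
    then have "is_unit (int p)" using c by blast
    then show False using p by (metis int_dvd_int_iff not_prime_unit of_nat_1)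
  qed
  define m where "m = (GREATEST m. \<exists>f. indep m f)"
  have "\<exists>f. indep 0 f" by (simp add: indep_def)
  then have "\<exists>f. indep m f"
    unfolding m_def by (rule GreatestI_nat) (use bound in blast)
  then obtain f where f: "indep m f" by blast
  have max: "\<not> indep (Suc m) g" for g
    using Greatest_le_nat[of "\<lambda>m. \<exists>f. indep m f" "Suc m" n] bound unfolding m_def[symmetric] by auto
  define R where "R = (\<lambda>e. \<Sum>i<m. of_int (e i) * f i) ` ({..<m} \<rightarrow>\<^sub>E {0..<int p})"
  have finR: "finite R" by (simp add: R_def finite_PiE)
  have f_OK: "f i \<in> OK F" if "i < m" for i using f that by (simp add: indep_def)
  have R_OK: "R \<subseteq> OK F" 
    unfolding R_def by (intro image_subsetI OK_sum OK_mult OK_of_int f_OK) simp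
  have "\<exists>r\<in>R. \<exists>y\<in>OK F. x = r + of_nat p * y" if x: "x \<in> OK F" for x
  proof -
    have "\<not> indep (Suc m) (f(m := x))" by (rule max)
    moreover have "\<forall>i<Suc m. (f(m := x)) i \<in> OK F" using x f_OK by auto
    ultimately have "\<exists>c::nat \<Rightarrow> int. \<exists>y. y \<in> OK F \<and>
        (\<Sum>i<Suc m. of_int (c i) * (f(m := x)) i) = of_nat p * y \<and> \<not> (\<forall>i<Suc m. int p dvd c i)"
      unfolding indep_def by blast
    then obtain c :: "nat \<Rightarrow> int" and y where c: "y \<in> OK F"
        "(\<Sum>i<Suc m. of_int (c i) * (f(m := x)) i) = of_nat p * y" "\<not> (\<forall>i<Suc m. int p dvd c i)"
      by auto
    have rel: "(\<Sum>i<m. of_int (c i) * f i) + of_int (c m) * x = of_nat p * y"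
      using c(2) by simp
    \<comment> \<open>Otherwise the term with \<open>x\<close> moves into p O_F, and independence of
      \<open>f\<close> makes every coefficient divisible by p.\<close>
    have "\<not> int p dvd c m"
    proof
      assume dv: "int p dvd c m"
      then obtain k where k: "c m = int p * k" by (auto elim: dvdE)
      have "(\<Sum>i<m. of_int (c i) * f i) = of_nat p * (y - of_int k * x)"
        using rel by (simp add: k algebra_simps)
      moreover have "y - of_int k * x \<in> OK F" using x c by (simp add: OK_diff OK_mult)
      ultimately have "\<forall>i<m. int p dvd c i" using f unfolding indep_def by blast
      then show False using dv c(3) less_Suc_eq by auto
    qed
    then have "coprime (c m) (int p)"
      using p by (metis coprime_commute prime_imp_coprime prime_nat_int_transfer)
    then obtain u v where uv: "u * c m + v * int p = 1"
      using bezout_int[of "c m" "int p"] by (auto simp: coprime_iff_gcd_eq_1)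
    \<comment> \<open>Inverting \<open>c m\<close> modulo p solves the relation for
      \<open>x\<close>. The remainders \<open>e\<close> give the representative and the quotients
      \<open>q\<close> go into the multiple of p.\<close>
    define e where "e = (\<lambda>i\<in>{..<m}. (- u * c i) mod int p)"
    define q where "q = (\<lambda>i. (- u * c i) div int p)"
    have e_q: "of_int (- u * c i) = (of_int (e i) + of_nat p * of_int (q i) :: complex)" if "i < m" for i
    proof -
      have "- u * c i = e i + int p * q i" using that by (simp add: e_def q_def)
      then show ?thesis by (metis of_int_add of_int_mult of_int_of_nat_eq)
    qed
    let ?r = "\<Sum>i<m. of_int (e i) * f i"
    have "?r \<in> R"
      unfolding R_def by (rule imageI) (use prime_gt_0_nat[OF p] in \<open>auto simp: e_def PiE_iff extensional_def\<close>)
    have "x = of_int (u * c m + v * int p) * x" using uv by simp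
    also have "\<dots> = of_int u * (of_int (c m) * x) + of_nat p * (of_int v * x)"
      by (simp add: algebra_simps)
    also have "of_int (c m) * x = of_nat p * y - (\<Sum>i<m. of_int (c i) * f i)"
      using rel by (simp add: algebra_simps)
    also have "of_int u * (of_nat p * y - (\<Sum>i<m. of_int (c i) * f i))
        = of_nat p * (of_int u * y) + (\<Sum>i<m. of_int (- u * c i) * f i)"
    proof -
      have "of_int u * (\<Sum>i<m. of_int (c i) * f i) = - (\<Sum>i<m. of_int (- u * c i) * f i)"
        unfolding sum_distrib_left sum_negf[symmetric] by (intro sum.cong) simp_all
      then show ?thesis by (simp add: right_diff_distrib)
    qed
    also have "(\<Sum>i<m. of_int (- u * c i) * f i) = (\<Sum>i<m. of_int (e i) * f i + of_nat p * (of_int (q i) * f i))"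
      by (rule sum.cong) (use e_q in \<open>auto simp: distrib_right mult.assoc\<close>)
    also have "\<dots> = ?r + of_nat p * (\<Sum>i<m. of_int (q i) * f i)"
      by (simp add: sum.distrib sum_distrib_left)
    finally have "x = ?r + of_nat p * (of_int u * y + (\<Sum>i<m. of_int (q i) * f i) + of_int v * x)"
      by (simp add: algebra_simps)
    moreover have "of_int u * y + (\<Sum>i<m. of_int (q i) * f i) + of_int v * x \<in> OK F"
      by (intro OK_add OK_mult OK_sum) (use x c f_OK in auto)
    ultimately show ?thesis using \<open>?r \<in> R\<close> by blast
  qed
  then show ?thesis using finR R_OK by blast
qed

text \<open>One prime factor at a time: for \<open>N = p * M\<close> the representatives are r + p s
  with r modulo p and s modulo M.\<close>

lemma finite_residues:
  assumes "N > 0"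
  shows "\<exists>R. finite R \<and> R \<subseteq> OK F \<and> (\<forall>x\<in>OK F. \<exists>r\<in>R. \<exists>y\<in>OK F. x = r + of_nat N * y)"
  using assms
proof (induction N rule: less_induct)
  case (less N)
  show ?case
  proof (cases "N = 1")
    case True
    then show ?thesis by (intro exI[of _ "{0}"]) auto
  next
    case False
    then obtain p M where p: "prime p" and N: "N = p * M"
      by (meson prime_factor_nat dvdE)
    then have "M > 0" "M < N" using less.prems prime_gt_1_nat[OF p] by auto
    obtain R where R: "finite R" "R \<subseteq> OK F"
      "\<And>x. x \<in> OK F \<Longrightarrow> \<exists>r\<in>R. \<exists>y\<in>OK F. x = r + of_nat p * y"
      using finite_residues_prime[OF p] by blast
    obtain S where S: "finite S" "S \<subseteq> OK F"
      "\<And>x. x \<in> OK F \<Longrightarrow> \<exists>r\<in>S. \<exists>y\<in>OK F. x = r + of_nat M * y"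
      using less.IH[OF \<open>M < N\<close> \<open>M > 0\<close>] by blast
    let ?T = "(\<lambda>(r, s). r + of_nat p * s) ` (R \<times> S)"
    have "\<exists>r\<in>?T. \<exists>y\<in>OK F. x = r + of_nat N * y" if x: "x \<in> OK F" for x
    proof -
      obtain r y where r: "r \<in> R" "y \<in> OK F" "x = r + of_nat p * y" using R(3)[OF x] by blast
      obtain s z where s: "s \<in> S" "z \<in> OK F" "y = s + of_nat M * z" using S(3)[OF r(2)] by blast
      have "x = (r + of_nat p * s) + of_nat N * z" by (simp add: r s N algebra_simps)
      moreover have "r + of_nat p * s \<in> ?T" using r s by auto
      ultimately show ?thesis using s by blast
    qed
    moreover have "?T \<subseteq> OK F" using R S by (auto intro!: OK_add OK_mult)
    ultimately show ?thesis using R S by (intro exI[of _ ?T]) auto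
  qed
qed

text \<open>Pigeonhole in O_F / N. The sequences fed to it are powers of an element, possibly times
  a constant.\<close>

lemma congruent_pair:
  assumes "N > 0" "\<And>k::nat. f k \<in> OK F"
  shows "\<exists>i j y. i < j \<and> y \<in> OK F \<and> f j - f i = of_nat N * y"
proof -
  obtain R where R: "finite R" "\<And>x. x \<in> OK F \<Longrightarrow> \<exists>r\<in>R. \<exists>y\<in>OK F. x = r + of_nat N * y"
    using finite_residues[OF assms(1)] by blast
  have "\<exists>r y. r \<in> R \<and> y \<in> OK F \<and> f k = r + of_nat N * y" for k
    using R(2)[OF assms(2)] by blast
  then obtain r y where ry: "\<And>k. r k \<in> R" "\<And>k. y k \<in> OK F" "\<And>k. f k = r k + of_nat N * y k"
    by metis
  have "\<not> inj r"
  proof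
    assume "inj r"
    moreover have "finite (range r)" using R(1) ry(1) by (metis finite_subset image_subset_iff)
    ultimately show False using finite_imageD infinite_UNIV_nat by blast
  qed
  then obtain i j where "r i = r j" "i < j" by (metis linorder_injI)
  then show ?thesis
    using ry OK_diff by (intro exI[of _ i] exI[of _ j] exI[of _ "y j - y i"]) (auto simp: algebra_simps)
qed

lemma nz_ideal_contains_nat:
  assumes "nz_ideal F I"
  shows "\<exists>N::nat. N > 0 \<and> of_nat N \<in> I"
proof -
  have I: "is_ideal F I" using assms by (simp add: nz_ideal_def)
  then obtain x where x: "x \<in> I" "x \<noteq> 0" "x \<in> OK F"
    using assms by (auto simp: nz_ideal_def is_ideal_def)
  then obtain N y where "N > 0" "y \<in> OK F" "y * x = of_nat N"
    using OK_dvd_nat by (metis mult.commute)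
  then show ?thesis using I x unfolding is_ideal_def by metis
qed

text \<open>An ideal containing the number \<open>N\<close> is a union of residue classes modulo
  \<open>N\<close>, so it is determined by the representatives it contains.\<close>

lemma finite_ideals_above:
  assumes "nz_ideal F I"
  shows "finite {J. is_ideal F J \<and> I \<subseteq> J}"
proof -
  obtain N :: nat where N: "N > 0" "of_nat N \<in> I" using nz_ideal_contains_nat[OF assms] by blast
  obtain R where R: "finite R" "R \<subseteq> OK F" "\<And>x. x \<in> OK F \<Longrightarrow> \<exists>r\<in>R. \<exists>y\<in>OK F. x = r + of_nat N * y"
    using finite_residues[OF N(1)] by blast
  have sub: "J \<subseteq> J'" if J: "is_ideal F J" "I \<subseteq> J" and J': "is_ideal F J'" "I \<subseteq> J'"
    and eq: "J \<inter> R = J' \<inter> R" for J J'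
  proof
    fix x assume x: "x \<in> J"
    then obtain r y where r: "r \<in> R" "y \<in> OK F" "x = r + of_nat N * y"
      using R(3) J unfolding is_ideal_def by blast
    have NJ: "of_nat N * y \<in> J" "of_nat N * y \<in> J'"
      using N r J J' unfolding is_ideal_def by (metis mult.commute subsetD)+
    \<comment> \<open>\<open>is_ideal\<close> asks only for sums and multiples; negatives come from
      the multiplier -1.\<close>
    have "(-1) * (of_nat N * y) \<in> J" using J NJ OK_minus[OF OK_1] unfolding is_ideal_def by blast
    then have "x + (-1) * (of_nat N * y) \<in> J" using J x unfolding is_ideal_def by blast
    then have "r \<in> J'" using r eq by auto
    then show "x \<in> J'" using r NJ J' unfolding is_ideal_def by blast
  qed
  show ?thesis
  proof (rule finite_imageD[of "\<lambda>J. J \<inter> R"])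
    show "finite ((\<lambda>J. J \<inter> R) ` {J. is_ideal F J \<and> I \<subseteq> J})"
      by (rule finite_subset[of _ "Pow R"]) (use R in auto)
    show "inj_on (\<lambda>J. J \<inter> R) {J. is_ideal F J \<and> I \<subseteq> J}"
      by (rule inj_onI) (use sub in blast)
  qed
qed

text \<open>If \<open>N\<close> lies in \<open>I\<close>, all \<open>c ^ k * of_nat N\<close> are
  integral, and two of them are congruent modulo \<open>N\<close>. Cancelling \<open>N\<close> makes
  a difference of two powers of \<open>c\<close> integral.\<close>

lemma multiplier_in_OK:
  assumes "nz_ideal F I" "c \<in> F" "\<And>x. x \<in> I \<Longrightarrow> c * x \<in> I"
  shows "c \<in> OK F"
proof -
  obtain N :: nat where N: "N > 0" "of_nat N \<in> I" using nz_ideal_contains_nat[OF assms(1)] by blast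
  have "c ^ k * of_nat N \<in> I" for k
    by (induction k) (use N assms(3) in \<open>auto simp: mult.assoc\<close>)
  then have "c ^ k * of_nat N \<in> OK F" for k
    using assms(1) by (auto simp: nz_ideal_def is_ideal_def)
  then obtain i j y where ij: "i < j" "y \<in> OK F" "c ^ j * of_nat N - c ^ i * of_nat N = of_nat N * y"
    using congruent_pair[OF N(1), of "\<lambda>k. c ^ k * of_nat N"] by auto
  have "of_nat N * (c ^ j - c ^ i) = of_nat N * y" using ij(3) by (simp add: algebra_simps)
  then have "c ^ j - c ^ i = y" using N by simp
  then show ?thesis using alg_int_of_power_diff[of c j i] ij assms(2) by (simp add: OK_def)
qed

end

section \<open>Factorization of ideals\<close>

context number_field_ctx
begin

section \<open>Ideals, generated ideals and products\<close>

lemma is_idealI: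
  assumes "I \<subseteq> OK F" "0 \<in> I" "\<And>x y. x \<in> I \<Longrightarrow> y \<in> I \<Longrightarrow> x + y \<in> I"
    "\<And>r x. r \<in> OK F \<Longrightarrow> x \<in> I \<Longrightarrow> r * x \<in> I"
  shows "is_ideal F I"
  using assms by (auto simp: is_ideal_def)

lemma ideal_OK: "is_ideal F I \<Longrightarrow> x \<in> I \<Longrightarrow> x \<in> OK F"
  and ideal_0: "is_ideal F I \<Longrightarrow> 0 \<in> I"
  and ideal_add: "is_ideal F I \<Longrightarrow> x \<in> I \<Longrightarrow> y \<in> I \<Longrightarrow> x + y \<in> I"
  and ideal_mult_left: "is_ideal F I \<Longrightarrow> r \<in> OK F \<Longrightarrow> x \<in> I \<Longrightarrow> r * x \<in> I"
  by (auto simp: is_ideal_def)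

lemma ideal_mult_right: "is_ideal F I \<Longrightarrow> x \<in> I \<Longrightarrow> r \<in> OK F \<Longrightarrow> x * r \<in> I"
  using ideal_mult_left by (simp add: mult.commute)

lemma ideal_minus: "is_ideal F I \<Longrightarrow> x \<in> I \<Longrightarrow> - x \<in> I"
  using ideal_mult_left[of I "-1" x] OK_minus[OF OK_1] by simp

lemma ideal_diff: "is_ideal F I \<Longrightarrow> x \<in> I \<Longrightarrow> y \<in> I \<Longrightarrow> x - y \<in> I"
  using ideal_add[OF _ _ ideal_minus] by fastforce

lemma ideal_subset_OK: "is_ideal F I \<Longrightarrow> I \<subseteq> OK F"
  by (auto simp: is_ideal_def)

lemma is_ideal_OK [simp]: "is_ideal F (OK F)"
  by (rule is_idealI) (auto intro: OK_add OK_mult)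

lemma nz_ideal_OK [simp]: "nz_ideal F (OK F)"
  unfolding nz_ideal_def using OK_1 by (metis is_ideal_OK singletonD zero_neq_one)

lemma nz_idealD: "nz_ideal F I \<Longrightarrow> is_ideal F I"
  by (simp add: nz_ideal_def)

lemma nz_idealI: "is_ideal F I \<Longrightarrow> x \<in> I \<Longrightarrow> x \<noteq> 0 \<Longrightarrow> nz_ideal F I"
  by (auto simp: nz_ideal_def)

lemma nz_ideal_nonzero: "nz_ideal F I \<Longrightarrow> \<exists>x\<in>I. x \<noteq> 0"
  unfolding nz_ideal_def is_ideal_def by blast

lemma ideal_eq_OK: "is_ideal F I \<Longrightarrow> 1 \<in> I \<Longrightarrow> I = OK F"
  using ideal_mult_right[of I 1] ideal_subset_OK by fastforce

lemma ideal_gen_superset: "S \<subseteq> ideal_gen F S"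
  by (auto simp: ideal_gen_def)

lemma ideal_gen_least: "is_ideal F I \<Longrightarrow> S \<subseteq> I \<Longrightarrow> ideal_gen F S \<subseteq> I"
  by (auto simp: ideal_gen_def)

lemma is_ideal_ideal_gen:
  assumes "S \<subseteq> OK F"
  shows "is_ideal F (ideal_gen F S)"
proof (rule is_idealI)
  show "ideal_gen F S \<subseteq> OK F" by (rule ideal_gen_least) (use assms in auto)
  show "0 \<in> ideal_gen F S" by (simp add: ideal_gen_def ideal_0)
  show "x + y \<in> ideal_gen F S" if "x \<in> ideal_gen F S" "y \<in> ideal_gen F S" for x y
    using that by (simp add: ideal_gen_def ideal_add)
  show "r * x \<in> ideal_gen F S" if "r \<in> OK F" "x \<in> ideal_gen F S" for r x
    using that by (simp add: ideal_gen_def ideal_mult_left)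
qed

lemma ideal_mult_mem: "a \<in> I \<Longrightarrow> b \<in> J \<Longrightarrow> a * b \<in> ideal_mult F I J"
  unfolding ideal_mult_def by (rule subsetD[OF ideal_gen_superset]) blast

lemma ideal_mult_least:
  assumes "is_ideal F X" "\<And>a b. a \<in> I \<Longrightarrow> b \<in> J \<Longrightarrow> a * b \<in> X"
  shows "ideal_mult F I J \<subseteq> X"
  unfolding ideal_mult_def by (rule ideal_gen_least) (use assms in auto)

lemma is_ideal_ideal_mult [simp]:
  assumes "is_ideal F I" "is_ideal F J"
  shows "is_ideal F (ideal_mult F I J)"
  unfolding ideal_mult_def
  by (rule is_ideal_ideal_gen) (use assms in \<open>auto intro: OK_mult ideal_OK\<close>)

lemma ideal_mult_mono: "is_ideal F I' \<Longrightarrow> is_ideal F J' \<Longrightarrow> I \<subseteq> I' \<Longrightarrow> J \<subseteq> J' \<Longrightarrow> ideal_mult F I J \<subseteq> ideal_mult F I' J'"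
  by (rule ideal_mult_least) (auto intro: ideal_mult_mem)

lemma ideal_mult_commute: "ideal_mult F I J = ideal_mult F J I"
  unfolding ideal_mult_def by (rule arg_cong[of _ _ "ideal_gen F"]) (use mult.commute in blast)

lemma ideal_mult_subset_left: "is_ideal F I \<Longrightarrow> is_ideal F J \<Longrightarrow> ideal_mult F I J \<subseteq> I"
  by (rule ideal_mult_least) (auto intro: ideal_mult_right ideal_OK)

lemma ideal_mult_OK [simp]:
  assumes "is_ideal F I"
  shows "ideal_mult F (OK F) I = I" and "ideal_mult F I (OK F) = I"
proof -
  show "ideal_mult F I (OK F) = I"
    using ideal_mult_subset_left[OF assms is_ideal_OK] ideal_mult_mem[OF _ OK_1, of _ I] by fastforce
  then show "ideal_mult F (OK F) I = I" by (simp add: ideal_mult_commute)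
qed

lemma nz_ideal_mult:
  assumes "nz_ideal F I" "nz_ideal F J"
  shows "nz_ideal F (ideal_mult F I J)"
proof -
  obtain x y where "x \<in> I" "x \<noteq> 0" "y \<in> J" "y \<noteq> 0" using assms nz_ideal_nonzero by metis
  then show ?thesis
    using nz_idealI[OF is_ideal_ideal_mult ideal_mult_mem] assms nz_idealD by (metis no_zero_divisors)
qed

text \<open>The ideal quotient (X : K) inside O_F. As it is an ideal whenever \<open>X\<close> is
  one, a containment checked on generators passes to the whole generated ideal; this replaces
  computing with finite sums of products.\<close>

definition colon :: "complex set \<Rightarrow> complex set \<Rightarrow> complex set" where
  "colon X K = {x \<in> OK F. \<forall>k\<in>K. x * k \<in> X}"

lemma is_ideal_colon:
  assumes "is_ideal F X"
  shows "is_ideal F (colon X K)"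
  by (rule is_idealI)
     (use assms in \<open>auto simp: colon_def ideal_0 OK_add OK_mult distrib_right mult.assoc ideal_add ideal_mult_left\<close>)

lemma ideal_mult_assoc_subset:
  assumes "is_ideal F I" "is_ideal F J" "is_ideal F K"
  shows "ideal_mult F (ideal_mult F I J) K \<subseteq> ideal_mult F I (ideal_mult F J K)"
proof -
  let ?X = "ideal_mult F I (ideal_mult F J K)"
  have X: "is_ideal F ?X" using assms by simp
  have "a * b \<in> colon ?X K" if "a \<in> I" "b \<in> J" for a b
    unfolding colon_def using that OK_mult[OF ideal_OK[OF assms(1)] ideal_OK[OF assms(2)]]
    by (auto simp: mult.assoc intro!: ideal_mult_mem)
  then have "ideal_mult F I J \<subseteq> colon ?X K"
    by (intro ideal_mult_least is_ideal_colon X) auto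
  then show ?thesis by (intro ideal_mult_least X) (auto simp: colon_def)
qed

lemma ideal_mult_assoc:
  assumes "is_ideal F I" "is_ideal F J" "is_ideal F K"
  shows "ideal_mult F (ideal_mult F I J) K = ideal_mult F I (ideal_mult F J K)"
proof (rule antisym)
  show "ideal_mult F I (ideal_mult F J K) \<subseteq> ideal_mult F (ideal_mult F I J) K"
    using ideal_mult_assoc_subset[OF assms(3,2,1)] by (simp add: ideal_mult_commute)
qed (rule ideal_mult_assoc_subset[OF assms])

lemma ideal_mult_4:
  assumes "is_ideal F A" "is_ideal F B" "is_ideal F C" "is_ideal F D"
  shows "ideal_mult F (ideal_mult F A B) (ideal_mult F C D) = ideal_mult F (ideal_mult F A C) (ideal_mult F B D)"
proof -
  have "ideal_mult F B (ideal_mult F C D) = ideal_mult F C (ideal_mult F B D)"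
    using assms by (metis ideal_mult_assoc ideal_mult_commute)
  then show ?thesis using assms by (simp add: ideal_mult_assoc)
qed

text \<open>The factor \<open>c\<close> may be non-integral. This is how fractional multiples of
  ideals enter.\<close>

lemma is_ideal_scale:
  assumes "is_ideal F I" "\<And>x. x \<in> I \<Longrightarrow> c * x \<in> OK F"
  shows "is_ideal F ((\<lambda>x. c * x) ` I)"
proof (rule is_idealI)
  fix r x assume r: "r \<in> OK F" and "x \<in> (\<lambda>x. c * x) ` I"
  then obtain y where "y \<in> I" "x = c * y" by auto
  then have "r * y \<in> I" "r * x = c * (r * y)" using assms(1) r by (auto intro: ideal_mult_left)
  then show "r * x \<in> (\<lambda>x. c * x) ` I" by blast
next
  fix x y assume "x \<in> (\<lambda>x. c * x) ` I" "y \<in> (\<lambda>x. c * x) ` I"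
  then obtain x' y' where "x' \<in> I" "x = c * x'" "y' \<in> I" "y = c * y'" by auto
  then have "x + y = c * (x' + y')" "x' + y' \<in> I" using assms(1) by (auto simp: distrib_left ideal_add)
  then show "x + y \<in> (\<lambda>x. c * x) ` I" by blast
next
  show "0 \<in> (\<lambda>x. c * x) ` I" using ideal_0[OF assms(1)] by force
qed (use assms in auto)

lemma is_ideal_pideal: "x \<in> OK F \<Longrightarrow> is_ideal F (pideal F x)"
  unfolding pideal_def by (rule is_ideal_scale) (auto intro: OK_mult)

lemma pideal_self: "x \<in> pideal F x"
  unfolding pideal_def by (rule image_eqI[of _ _ 1]) auto

lemma nz_ideal_pideal: "x \<in> OK F \<Longrightarrow> x \<noteq> 0 \<Longrightarrow> nz_ideal F (pideal F x)"
  using nz_idealI[OF is_ideal_pideal pideal_self] .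

lemma pideal_subset_iff: "is_ideal F I \<Longrightarrow> x \<in> OK F \<Longrightarrow> pideal F x \<subseteq> I \<longleftrightarrow> x \<in> I"
  using pideal_self by (auto simp: pideal_def intro: ideal_mult_right)

lemma pideal_1 [simp]: "pideal F 1 = OK F"
  by (simp add: pideal_def)

lemma ideal_mult_pideal:
  assumes "c \<in> OK F" "is_ideal F I"
  shows "ideal_mult F (pideal F c) I = (\<lambda>x. c * x) ` I"
proof (rule antisym)
  have "is_ideal F ((\<lambda>x. c * x) ` I)"
    by (rule is_ideal_scale) (use assms in \<open>auto intro: OK_mult ideal_OK\<close>)
  then show "ideal_mult F (pideal F c) I \<subseteq> (\<lambda>x. c * x) ` I"
    by (rule ideal_mult_least) (use assms in \<open>auto simp: pideal_def mult.assoc intro: ideal_mult_left\<close>)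
  show "(\<lambda>x. c * x) ` I \<subseteq> ideal_mult F (pideal F c) I"
    using pideal_self by (auto intro: ideal_mult_mem)
qed

lemma pideal_mult:
  assumes "x \<in> OK F" "y \<in> OK F"
  shows "pideal F (x * y) = ideal_mult F (pideal F x) (pideal F y)"
  using ideal_mult_pideal[OF assms(1) is_ideal_pideal[OF assms(2)]]
  by (simp add: pideal_def image_image mult.assoc)

definition ideal_plus :: "complex set \<Rightarrow> complex set \<Rightarrow> complex set" where
  "ideal_plus I J = {x + y | x y. x \<in> I \<and> y \<in> J}"

lemma is_ideal_plus:
  assumes "is_ideal F I" "is_ideal F J"
  shows "is_ideal F (ideal_plus I J)"
proof (rule is_idealI)
  show "ideal_plus I J \<subseteq> OK F"
    using ideal_OK[OF assms(1)] ideal_OK[OF assms(2)] by (auto simp: ideal_plus_def intro!: OK_add)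
  show "0 \<in> ideal_plus I J" using assms ideal_0 by (force simp: ideal_plus_def)
next
  fix x y assume "x \<in> ideal_plus I J" "y \<in> ideal_plus I J"
  then obtain a b c d where *: "a \<in> I" "b \<in> J" "x = a + b" "c \<in> I" "d \<in> J" "y = c + d"
    by (auto simp: ideal_plus_def)
  then have "x + y = (a + c) + (b + d)" "a + c \<in> I" "b + d \<in> J" using assms by (auto intro: ideal_add)
  then show "x + y \<in> ideal_plus I J" unfolding ideal_plus_def by blast
next
  fix r x assume r: "r \<in> OK F" and "x \<in> ideal_plus I J"
  then obtain a b where *: "a \<in> I" "b \<in> J" "x = a + b" by (auto simp: ideal_plus_def)
  then have "r * x = r * a + r * b" "r * a \<in> I" "r * b \<in> J"
    using assms r by (auto simp: distrib_left intro: ideal_mult_left)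
  then show "r * x \<in> ideal_plus I J" unfolding ideal_plus_def by blast
qed

lemma ideal_plus_superset:
  assumes "is_ideal F I" "is_ideal F J"
  shows "I \<subseteq> ideal_plus I J" "J \<subseteq> ideal_plus I J"
  using ideal_0 assms unfolding ideal_plus_def by force+

section \<open>Prime ideals: maximality and division\<close>

lemma prime_idealD:
  assumes "prime_ideal F P"
  shows "nz_ideal F P" "is_ideal F P" "1 \<notin> P"
    "\<And>a b. a \<in> OK F \<Longrightarrow> b \<in> OK F \<Longrightarrow> a * b \<in> P \<Longrightarrow> a \<in> P \<or> b \<in> P"
  using assms ideal_eq_OK by (auto simp: prime_ideal_def nz_ideal_def)

text \<open>A finite domain is a field: for \<open>x\<close> outside \<open>P\<close>, two powers of
  \<open>x\<close> agree modulo \<open>P\<close>, and cancelling the smaller one gives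
  \<open>x ^ (j - i)\<close> congruent to 1. For \<open>x\<close> in \<open>J\<close> this puts 1
  into \<open>J\<close>.\<close>

lemma prime_ideal_maximal:
  assumes P: "prime_ideal F P" and J: "is_ideal F J" "P \<subset> J"
  shows "J = OK F"
proof -
  obtain x where x: "x \<in> J" "x \<notin> P" "x \<in> OK F" using J ideal_OK by blast
  obtain N :: nat where N: "N > 0" "of_nat N \<in> P"
    using nz_ideal_contains_nat[OF prime_idealD(1)[OF P]] by blast
  obtain i j y where ij: "i < j" "y \<in> OK F" "x ^ j - x ^ i = of_nat N * y"
    using congruent_pair[OF N(1), of "\<lambda>k. x ^ k"] OK_power[OF x(3)] by blast
  have "x ^ i * (x ^ (j - i) - 1) = x ^ j - x ^ i"
    using ij(1) by (simp add: algebra_simps flip: power_add)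
  also have "\<dots> \<in> P" using ij N prime_idealD(2)[OF P] by (simp add: ideal_mult_right)
  finally have "x ^ i * (x ^ (j - i) - 1) \<in> P" .
  moreover have "x ^ k \<notin> P" for k
    using prime_idealD(3,4)[OF P] x OK_power by (induction k) auto
  ultimately have "x ^ (j - i) - 1 \<in> P"
    using prime_idealD(4)[OF P] x by (metis OK_power OK_diff OK_1)
  then have "x ^ (j - i) - 1 \<in> J" using J by blast
  moreover have "x ^ (j - i) \<in> J"
    using ij(1) x J(1) by (cases "j - i") (auto intro: ideal_mult_right OK_power)
  ultimately have "x ^ (j - i) - (x ^ (j - i) - 1) \<in> J" using J(1) ideal_diff by blast
  then show ?thesis using ideal_eq_OK[OF J(1)] by simp
qed

text \<open>Only finitely many ideals contain \<open>I\<close>, so a maximal proper one exists;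
  maximal ideals are prime because \<open>P + (a) = O_F\<close> for \<open>a\<close> outside
  \<open>P\<close>.\<close>

lemma exists_prime_ideal_above:
  assumes I: "nz_ideal F I" "I \<noteq> OK F"
  shows "\<exists>P. prime_ideal F P \<and> I \<subseteq> P"
proof -
  define \<J> where "\<J> = {J. is_ideal F J \<and> I \<subseteq> J \<and> J \<noteq> OK F}"
  have "finite \<J>" unfolding \<J>_def by (rule finite_subset[OF _ finite_ideals_above[OF I(1)]]) auto
  moreover have "I \<in> \<J>" using I by (auto simp: nz_ideal_def \<J>_def)
  ultimately obtain P where "P \<in> \<J>" and max': "\<forall>J\<in>\<J>. P \<subseteq> J \<longrightarrow> P = J"
    using finite_has_maximal[of \<J>] by auto
  then have P: "is_ideal F P" "I \<subseteq> P" "P \<noteq> OK F" by (auto simp: \<J>_def)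
  have max: "P = J" if "is_ideal F J" "J \<noteq> OK F" "P \<subseteq> J" for J
    using max' that P(2) by (auto simp: \<J>_def)
  have idP: "is_ideal F P" using P by simp
  obtain x where "x \<in> I" "x \<noteq> 0" using nz_ideal_nonzero[OF I(1)] by blast
  then have "nz_ideal F P" using P nz_idealI[OF idP] by blast
  moreover have "b \<in> P" if ab: "a \<in> OK F" "b \<in> OK F" "a * b \<in> P" "a \<notin> P" for a b
  proof -
    let ?J = "ideal_plus P (pideal F a)"
    have J: "is_ideal F ?J" using is_ideal_plus[OF idP is_ideal_pideal[OF ab(1)]] .
    have "P \<subset> ?J"
      using ideal_plus_superset[OF idP is_ideal_pideal[OF ab(1)]] pideal_self[of a] ab(4) by blast
    then have "?J = OK F" using max[of ?J] J by blast
    then have "1 \<in> ?J" by simp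
    then obtain p r where pr: "p \<in> P" "r \<in> OK F" "1 = p + a * r"
      unfolding ideal_plus_def pideal_def by auto
    have "b = b * (p + a * r)" using pr(3) by simp
    also have "\<dots> = b * p + r * (a * b)" by (simp add: algebra_simps)
    also have "\<dots> \<in> P" by (intro ideal_add[OF idP] ideal_mult_left[OF idP] pr ab)
    finally show ?thesis .
  qed
  ultimately show ?thesis using P unfolding prime_ideal_def by blast
qed

text \<open>An ideal of the form \<open>(a : b)\<close> that is maximal among those contained in \<open>P\<close> equals \<open>P\<close>; then \<open>c = b / a\<close>
  is a non-integral element multiplying \<open>P\<close> into the ring of integers.\<close>
lemma prime_ideal_inverse_element:
  assumes P: "prime_ideal F P"
  shows "\<exists>c\<in>F. c \<notin> OK F \<and> (\<forall>x\<in>P. c * x \<in> OK F)"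
proof -
  note idP = prime_idealD(2)[OF P]
  obtain a where a: "a \<in> P" "a \<noteq> 0" using nz_ideal_nonzero[OF prime_idealD(1)[OF P]] by blast
  have aOK: "a \<in> OK F" using a idP ideal_OK by blast
  let ?A = "pideal F a"
  have idA: "is_ideal F ?A" using is_ideal_pideal[OF aOK] .
  define q where "q b = colon ?A {b}" for b
  have q: "x \<in> q b \<longleftrightarrow> x \<in> OK F \<and> x * b \<in> ?A" for x b by (simp add: q_def colon_def)
  have idq: "is_ideal F (q b)" for b unfolding q_def by (rule is_ideal_colon[OF idA])
  \<comment> \<open>Every \<open>q b\<close> contains \<open>?A\<close>, so this family is finite,
    and \<open>q 1\<close> is \<open>?A\<close> itself.\<close>
  define \<J> where "\<J> = {I. I \<subseteq> P \<and> (\<exists>b\<in>OK F. I = q b)}"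
  have "?A \<subseteq> q b" if "b \<in> OK F" for b
    using idA that ideal_mult_right ideal_OK by (auto simp: q)
  then have "finite \<J>" unfolding \<J>_def
    by (intro finite_subset[OF _ finite_ideals_above[OF nz_ideal_pideal[OF aOK a(2)]]]) (use idq in auto)
  moreover have "q 1 \<in> \<J>"
    using pideal_subset_iff[OF idP aOK] a OK_1 unfolding \<J>_def by (auto simp: q)
  ultimately obtain I where I: "I \<in> \<J>" and max': "\<forall>J\<in>\<J>. I \<subseteq> J \<longrightarrow> I = J"
    using finite_has_maximal[of \<J>] by auto
  then obtain b where b: "b \<in> OK F" "I = q b" "I \<subseteq> P" by (auto simp: \<J>_def)
  have max: "I = q b'" if "q b' \<subseteq> P" "b' \<in> OK F" "I \<subseteq> q b'" for b'
    using max' that by (auto simp: \<J>_def)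
  have "I = P"
  proof (rule ccontr)
    assume "I \<noteq> P"
    then obtain x where x: "x \<in> P" "x \<notin> I" using b by blast
    have xOK: "x \<in> OK F" using x idP ideal_OK by blast
    \<comment> \<open>\<open>good k\<close> says that x^k b becomes zero in O_F / (a) localized at
      \<open>P\<close>. The pigeonhole supplies such an exponent, with multiplier
      \<open>x ^ (j - i) - 1\<close>, which avoids \<open>P\<close> because \<open>x\<close> lies in
      \<open>P\<close>. At the least one, maximality of \<open>I\<close> shows first that
      \<open>t * x\<close> lies in \<open>I\<close>, then that \<open>q (t * b) = I\<close>; but
      \<open>x\<close> lies in the former.\<close>
    define good where "good k \<longleftrightarrow> (\<exists>t\<in>OK F. t \<notin> P \<and> t * x ^ k * b \<in> ?A)" for k
    obtain N y where N: "N > 0" "y \<in> OK F" "a * y = of_nat N"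
      using OK_dvd_nat[OF aOK a(2)] by blast
    obtain i j z where ij: "i < j" "z \<in> OK F" "x ^ j - x ^ i = of_nat N * z"
      using congruent_pair[OF N(1), of "\<lambda>k. x ^ k"] OK_power[OF xOK] by blast
    let ?t = "x ^ (j - i) - 1"
    have "?t * x ^ i = x ^ j - x ^ i"
      using ij(1) by (simp add: algebra_simps flip: power_add)
    then have "?t * x ^ i * b = a * (y * z * b)" using ij(3) N(3)[symmetric] by simp
    then have "?t * x ^ i * b \<in> ?A" using N ij b by (auto simp: pideal_def intro!: OK_mult)
    moreover have "?t \<notin> P"
    proof
      assume t: "?t \<in> P"
      have "x ^ (j - i) \<in> P"
        using ij(1) x(1) xOK idP by (cases "j - i") (auto intro: ideal_mult_right OK_power)
      then have "x ^ (j - i) - ?t \<in> P" using t idP ideal_diff by blast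
      then show False using prime_idealD(3)[OF P] by simp
    qed
    moreover have "?t \<in> OK F" using xOK by (intro OK_diff OK_power OK_1)
    ultimately have "good i" unfolding good_def by blast
    define k where "k = (LEAST k. good k)"
    have "good k" using \<open>good i\<close> unfolding k_def by (rule LeastI)
    then obtain t where t: "t \<in> OK F" "t \<notin> P" "t * x ^ k * b \<in> ?A" by (auto simp: good_def)
    have "k \<noteq> 0"
    proof
      assume "k = 0"
      then have "t \<in> I" using t b by (simp add: q)
      then show False using t b by blast
    qed
    then obtain k' where k': "k = Suc k'" using not0_implies_Suc by blast
    have "\<not> good k'" using not_less_Least[of k' good] k' unfolding k_def by simp
    then have "q (x ^ k' * b) \<subseteq> P" by (auto simp: good_def q mult.assoc)
    moreover have "x ^ k' * b \<in> OK F" using xOK b by (intro OK_mult OK_power)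
    moreover have "I \<subseteq> q (x ^ k' * b)"
    proof
      fix u assume "u \<in> I"
      then have u: "u \<in> OK F" "u * b \<in> ?A" using b by (auto simp: q)
      have "x ^ k' * (u * b) \<in> ?A" by (rule ideal_mult_left[OF idA OK_power[OF xOK] u(2)])
      then show "u \<in> q (x ^ k' * b)" using u by (simp add: q mult.left_commute)
    qed
    ultimately have "I = q (x ^ k' * b)" using max by blast
    then have tx: "t * x \<in> I" using t xOK by (simp add: q k' OK_mult mult.assoc)
    have "x \<in> q (t * b)" using tx xOK b by (simp add: q mult_ac)
    moreover have "q (t * b) \<subseteq> P"
    proof
      fix u assume "u \<in> q (t * b)"
      then have "u \<in> OK F" "u * t \<in> I" using b t by (auto simp: q mult.assoc intro: OK_mult)
      then show "u \<in> P" using prime_idealD(4)[OF P] t b by blast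
    qed
    moreover have "I \<subseteq> q (t * b)"
    proof
      fix u assume "u \<in> I"
      then have u: "u \<in> OK F" "u * b \<in> ?A" using b by (auto simp: q)
      have "t * (u * b) \<in> ?A" by (rule ideal_mult_left[OF idA t(1) u(2)])
      then show "u \<in> q (t * b)" using u by (simp add: q mult.left_commute)
    qed
    ultimately have "I = q (t * b)" using max b t OK_mult by blast
    then show False using \<open>x \<in> q (t * b)\<close> x by blast
  qed
  have "b / a \<in> F" using aOK b OK_in divide_in by blast
  moreover have "b / a \<notin> OK F"
  proof
    assume "b / a \<in> OK F"
    then have "1 * b \<in> ?A" using a by (auto simp: pideal_def intro!: image_eqI[of _ _ "b / a"])
    then have "1 \<in> P" using \<open>I = P\<close> b by (auto simp: q)
    then show False using prime_idealD(3)[OF P] by blast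
  qed
  moreover have "b / a * x \<in> OK F" if "x \<in> P" for x
  proof -
    have "x * b \<in> ?A" using that \<open>I = P\<close> b by (auto simp: q)
    then obtain y where "y \<in> OK F" "x * b = a * y" by (auto simp: pideal_def)
    then have "b / a * x = y" using a by (simp add: field_simps)
    then show ?thesis using \<open>y \<in> OK F\<close> by simp
  qed
  ultimately show ?thesis by blast
qed

text \<open>With \<open>c\<close> from the preceding lemma, B = A + c A. By
  \<open>multiplier_in_OK\<close>, adding c I to an ideal \<open>I\<close> inside \<open>P\<close>
  enlarges it strictly; for \<open>I = P\<close> maximality gives 1 = p + c q with p, q in
  \<open>P\<close>. So P B contains (p + c q) A = A, and it lies in A because c P is
  integral.\<close>

lemma prime_ideal_divides:
  assumes P: "prime_ideal F P" and A: "nz_ideal F A" "A \<subseteq> P"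
  shows "\<exists>B. is_ideal F B \<and> A \<subset> B \<and> A = ideal_mult F P B"
proof -
  note idP = prime_idealD(2)[OF P]
  obtain c where c: "c \<in> F" "c \<notin> OK F" "\<And>x. x \<in> P \<Longrightarrow> c * x \<in> OK F"
    using prime_ideal_inverse_element[OF P] by blast
  have idA: "is_ideal F A" using A by (rule_tac nz_idealD)
  have ex: "is_ideal F (ideal_plus I ((\<lambda>x. c * x) ` I)) \<and> I \<subset> ideal_plus I ((\<lambda>x. c * x) ` I)"
    if I: "nz_ideal F I" "I \<subseteq> P" for I
  proof -
    have idI: "is_ideal F I" using I nz_idealD by blast
    have idc: "is_ideal F ((\<lambda>x. c * x) ` I)" by (rule is_ideal_scale[OF idI]) (use c I in auto)
    have "\<exists>x\<in>I. c * x \<notin> I" using multiplier_in_OK[OF I(1) c(1)] c(2) by blast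
    then show ?thesis
      using is_ideal_plus[OF idI idc] ideal_plus_superset[OF idI idc] by blast
  qed
  have "ideal_plus P ((\<lambda>x. c * x) ` P) = OK F"
    using ex[OF prime_idealD(1)[OF P]] prime_ideal_maximal[OF P] by blast
  then have "1 \<in> ideal_plus P ((\<lambda>x. c * x) ` P)" by simp
  then obtain p q where pq: "p \<in> P" "q \<in> P" "1 = p + c * q" unfolding ideal_plus_def by auto
  let ?B = "ideal_plus A ((\<lambda>x. c * x) ` A)"
  have B: "is_ideal F ?B" "A \<subset> ?B" using ex[OF A] by auto
  have "A = ideal_mult F P ?B"
  proof (rule antisym)
    show "ideal_mult F P ?B \<subseteq> A"
    proof (rule ideal_mult_least[OF idA])
      fix x b assume x: "x \<in> P" and "b \<in> ?B"
      then obtain a a' where a: "a \<in> A" "a' \<in> A" "b = a + c * a'" by (auto simp: ideal_plus_def)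
      have "x * b = x * a + c * x * a'" by (simp add: a algebra_simps)
      also have "\<dots> \<in> A"
        by (intro ideal_add[OF idA] ideal_mult_left[OF idA] ideal_OK[OF idP x] c(3)[OF x] a)
      finally show "x * b \<in> A" .
    qed
    show "A \<subseteq> ideal_mult F P ?B"
    proof
      fix a assume a: "a \<in> A"
      have "c * a = 0 + c * a" by simp
      then have "a \<in> ?B" "c * a \<in> ?B" using a B ideal_0[OF idA] unfolding ideal_plus_def by blast+
      then have "p * a + q * (c * a) \<in> ideal_mult F P ?B"
        using pq idP B by (intro ideal_add[OF is_ideal_ideal_mult] ideal_mult_mem) auto
      also have "p * a + q * (c * a) = (p + c * q) * a" by (simp add: algebra_simps)
      finally show "a \<in> ideal_mult F P ?B" using pq(3) by simp
    qed
  qed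
  then show ?thesis using B by blast
qed

section \<open>Invertibility and cancellation of ideals\<close>

lemma nz_ideal_superset: "nz_ideal F A \<Longrightarrow> is_ideal F B \<Longrightarrow> A \<subseteq> B \<Longrightarrow> nz_ideal F B"
  using nz_ideal_nonzero nz_idealI by blast

text \<open>Induction from larger ideals to smaller ones; the measure is the finite number of ideals
  containing \<open>A\<close>.\<close>

lemma nz_ideal_noetherian [consumes 1, case_names less]:
  assumes "nz_ideal F A" "\<And>A. nz_ideal F A \<Longrightarrow> (\<And>B. is_ideal F B \<Longrightarrow> A \<subset> B \<Longrightarrow> Q B) \<Longrightarrow> Q A"
  shows "Q A"
  using assms(1)
proof (induction "card {J. is_ideal F J \<and> A \<subseteq> J}" arbitrary: A rule: less_induct)
  case less
  show ?case
  proof (rule assms(2)[OF less.prems])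
    fix B assume B: "is_ideal F B" "A \<subset> B"
    show "Q B"
    proof (rule less.hyps)
      show "nz_ideal F B" using nz_ideal_superset[OF less.prems B(1)] B(2) by blast
      have "A \<in> {J. is_ideal F J \<and> A \<subseteq> J}" "A \<notin> {J. is_ideal F J \<and> B \<subseteq> J}"
        using B nz_idealD[OF less.prems] by auto
      moreover have "{J. is_ideal F J \<and> B \<subseteq> J} \<subseteq> {J. is_ideal F J \<and> A \<subseteq> J}" using B by auto
      ultimately show "card {J. is_ideal F J \<and> B \<subseteq> J} < card {J. is_ideal F J \<and> A \<subseteq> J}"
        using finite_ideals_above[OF less.prems] by (intro psubset_card_mono) blast+
    qed
  qed
qed

text \<open>Write A = P B. A nonzero \<open>a\<close> in \<open>P\<close> gives P J' = (a),
  induction gives B J = (c), and then A (J' J) = (a c).\<close>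

lemma nz_ideal_invertible:
  assumes "nz_ideal F A"
  shows "\<exists>J c. is_ideal F J \<and> c \<in> OK F \<and> c \<noteq> 0 \<and> ideal_mult F A J = pideal F c"
  using assms
proof (induction rule: nz_ideal_noetherian)
  case (less A)
  show ?case
  proof (cases "A = OK F")
    case True
    then show ?thesis by (intro exI[of _ "OK F"] exI[of _ 1]) auto
  next
    case False
    then obtain P where P: "prime_ideal F P" "A \<subseteq> P"
      using exists_prime_ideal_above[OF less.hyps] by blast
    obtain B where B: "is_ideal F B" "A \<subset> B" "A = ideal_mult F P B"
      using prime_ideal_divides[OF P(1) less.hyps P(2)] by blast
    obtain J c where J: "is_ideal F J" "c \<in> OK F" "c \<noteq> 0" "ideal_mult F B J = pideal F c"
      using less.IH[OF B(1,2)] by blast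
    note idP = prime_idealD(2)[OF P(1)]
    obtain a where a: "a \<in> P" "a \<noteq> 0" using nz_ideal_nonzero[OF prime_idealD(1)[OF P(1)]] by blast
    have aOK: "a \<in> OK F" using a idP ideal_OK by blast
    obtain J' where J': "is_ideal F J'" "pideal F a = ideal_mult F P J'"
      using prime_ideal_divides[OF P(1) nz_ideal_pideal[OF aOK a(2)]] pideal_subset_iff[OF idP aOK] a(1) by blast
    have "ideal_mult F A (ideal_mult F J' J) = ideal_mult F (ideal_mult F P J') (ideal_mult F B J)"
      unfolding B(3) by (rule ideal_mult_4) (use idP B J J' in auto)
    also have "\<dots> = pideal F (a * c)" using J J' aOK by (simp add: pideal_mult)
    finally show ?thesis
      using J J' a aOK by (intro exI[of _ "ideal_mult F J' J"] exI[of _ "a * c"]) (auto intro: OK_mult)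
  qed
qed

lemma scale_subset_iff: "c \<noteq> (0::complex) \<Longrightarrow> (\<lambda>x. c * x) ` X \<subseteq> (\<lambda>x. c * x) ` Y \<longleftrightarrow> X \<subseteq> Y"
  by (auto simp: subset_iff image_iff)

lemma ideal_mult_cancel_subset:
  assumes A: "nz_ideal F A" and X: "is_ideal F X" and Y: "is_ideal F Y"
    and sub: "ideal_mult F A X \<subseteq> ideal_mult F A Y"
  shows "X \<subseteq> Y"
proof -
  have idA: "is_ideal F A" using A nz_idealD by blast
  obtain J c where J: "is_ideal F J" "c \<in> OK F" "c \<noteq> 0" "ideal_mult F A J = pideal F c"
    using nz_ideal_invertible[OF A] by blast
  have *: "ideal_mult F J (ideal_mult F A Z) = (\<lambda>x. c * x) ` Z" if "is_ideal F Z" for Z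
    using ideal_mult_assoc[OF J(1) idA that] ideal_mult_pideal[OF J(2) that] J(4)
    by (simp add: ideal_mult_commute)
  have "ideal_mult F J (ideal_mult F A X) \<subseteq> ideal_mult F J (ideal_mult F A Y)"
    by (rule ideal_mult_mono) (use J idA Y sub in auto)
  then show ?thesis using *[OF X] *[OF Y] scale_subset_iff[OF J(3)] by simp
qed

section \<open>Prime exponents, and ideals that are squares\<close>

lemma is_ideal_pow [simp]: "is_ideal F P \<Longrightarrow> is_ideal F (ideal_pow F P n)"
  by (induction n) auto

lemma nz_ideal_pow: "nz_ideal F P \<Longrightarrow> nz_ideal F (ideal_pow F P n)"
  by (induction n) (auto intro: nz_ideal_mult)

lemma ideal_pow_add: "is_ideal F P \<Longrightarrow> ideal_pow F P (m + n) = ideal_mult F (ideal_pow F P m) (ideal_pow F P n)"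
  by (induction m) (auto simp: ideal_mult_assoc)

text \<open>The exponent of \<open>P\<close> in \<open>A\<close>, phrased with
  \<open>GREATEST\<close> so that for a principal ideal it is \<open>vP_int\<close>.\<close>

definition ideal_ord :: "complex set \<Rightarrow> complex set \<Rightarrow> nat" where
  "ideal_ord P A = (GREATEST k. A \<subseteq> ideal_pow F P k)"

text \<open>If P^n B were inside P^k with k > n, cancelling P^n would put \<open>B\<close> into
  \<open>P\<close>.\<close>

lemma ideal_ord_eq:
  assumes P: "prime_ideal F P" and B: "is_ideal F B" "\<not> B \<subseteq> P"
  shows "ideal_ord P (ideal_mult F (ideal_pow F P n) B) = n"
proof -
  note idP = prime_idealD(2)[OF P] and nzP = prime_idealD(1)[OF P]
  show ?thesis
    unfolding ideal_ord_def
  proof (rule Greatest_equality)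
    show "ideal_mult F (ideal_pow F P n) B \<subseteq> ideal_pow F P n"
      by (rule ideal_mult_subset_left) (use idP B in auto)
    fix k assume k: "ideal_mult F (ideal_pow F P n) B \<subseteq> ideal_pow F P k"
    show "k \<le> n"
    proof (rule ccontr)
      assume "\<not> k \<le> n"
      then have "k = n + Suc (k - Suc n)" by simp
      then have "ideal_mult F (ideal_pow F P n) B \<subseteq> ideal_mult F (ideal_pow F P n) (ideal_pow F P (Suc (k - Suc n)))"
        using k ideal_pow_add[OF idP] by metis
      then have "B \<subseteq> ideal_pow F P (Suc (k - Suc n))"
        using ideal_mult_cancel_subset[OF nz_ideal_pow[OF nzP] B(1)] is_ideal_pow[OF idP] by blast
      also have "\<dots> \<subseteq> P" using ideal_mult_subset_left[OF idP is_ideal_pow[OF idP]] by simp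
      finally show False using B by blast
    qed
  qed
qed

lemma prime_power_decomposition:
  assumes P: "prime_ideal F P" and A: "nz_ideal F A"
  shows "\<exists>B. is_ideal F B \<and> \<not> B \<subseteq> P \<and> A = ideal_mult F (ideal_pow F P (ideal_ord P A)) B"
proof -
  note idP = prime_idealD(2)[OF P]
  from A have "\<exists>n B. is_ideal F B \<and> \<not> B \<subseteq> P \<and> A = ideal_mult F (ideal_pow F P n) B"
  proof (induction rule: nz_ideal_noetherian)
    case (less A)
    note idA = nz_idealD[OF less.hyps]
    show ?case
    proof (cases "A \<subseteq> P")
      case False
      then show ?thesis using idA by (intro exI[of _ 0] exI[of _ A]) simp
    next
      case True
      then obtain C where C: "is_ideal F C" "A \<subset> C" "A = ideal_mult F P C"
        using prime_ideal_divides[OF P less.hyps] by blast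
      obtain n B where B: "is_ideal F B" "\<not> B \<subseteq> P" "C = ideal_mult F (ideal_pow F P n) B"
        using less.IH[OF C(1,2)] by blast
      have "A = ideal_mult F (ideal_pow F P (Suc n)) B"
        using ideal_mult_assoc[OF idP is_ideal_pow[OF idP] B(1)] C B by simp
      then show ?thesis using B by blast
    qed
  qed
  then show ?thesis using ideal_ord_eq[OF P] by metis
qed

lemma prime_ideal_mult_not_subset:
  assumes "prime_ideal F P" "is_ideal F A" "is_ideal F B" "\<not> A \<subseteq> P" "\<not> B \<subseteq> P"
  shows "\<not> ideal_mult F A B \<subseteq> P"
proof -
  obtain a b where ab: "a \<in> A" "a \<notin> P" "b \<in> B" "b \<notin> P" using assms by blast
  then have "a * b \<notin> P" using prime_idealD(4)[OF assms(1)] assms ideal_OK by blast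
  then show ?thesis using ab ideal_mult_mem by blast
qed

lemma ideal_ord_mult:
  assumes P: "prime_ideal F P" and A: "nz_ideal F A" and B: "nz_ideal F B"
  shows "ideal_ord P (ideal_mult F A B) = ideal_ord P A + ideal_ord P B"
proof -
  note idP = prime_idealD(2)[OF P]
  let ?m = "ideal_ord P A" and ?n = "ideal_ord P B"
  obtain A' where A': "is_ideal F A'" "\<not> A' \<subseteq> P" "A = ideal_mult F (ideal_pow F P ?m) A'"
    using prime_power_decomposition[OF P A] by blast
  obtain B' where B': "is_ideal F B'" "\<not> B' \<subseteq> P" "B = ideal_mult F (ideal_pow F P ?n) B'"
    using prime_power_decomposition[OF P B] by blast
  have "ideal_mult F A B = ideal_mult F (ideal_pow F P (?m + ?n)) (ideal_mult F A' B')"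
    by (subst A'(3), subst B'(3), subst ideal_mult_4) (use idP A' B' in \<open>auto simp: ideal_pow_add\<close>)
  then show ?thesis
    using ideal_ord_eq[OF P is_ideal_ideal_mult prime_ideal_mult_not_subset[OF P]] A' B' by metis
qed

lemma ideal_ord_not_subset:
  assumes P: "prime_ideal F P" and B: "is_ideal F B" "\<not> B \<subseteq> P"
  shows "ideal_ord P B = 0"
  using ideal_ord_eq[OF P B, of 0] B by simp

text \<open>Factors of a prime are removed in pairs: if \<open>A\<close> lies in \<open>P\<close>,
  its order there is even and positive, so A = P P C. This changes every order by an even number,
  and if C = D D then A is the square of P D.\<close>

lemma ideal_is_square:
  assumes "nz_ideal F A" "\<And>P. prime_ideal F P \<Longrightarrow> even (ideal_ord P A)"
  shows "\<exists>C. is_ideal F C \<and> A = ideal_mult F C C"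
  using assms
proof (induction rule: nz_ideal_noetherian)
  case (less A)
  show ?case
  proof (cases "A = OK F")
    case True
    then show ?thesis by (intro exI[of _ "OK F"]) simp
  next
    case False
    then obtain P where P: "prime_ideal F P" "A \<subseteq> P"
      using exists_prime_ideal_above[OF less.hyps] by blast
    note idP = prime_idealD(2)[OF P(1)] and nzP = prime_idealD(1)[OF P(1)]
    obtain B where B: "is_ideal F B" "A \<subset> B" "A = ideal_mult F P B"
      using prime_ideal_divides[OF P(1) less.hyps P(2)] by blast
    have nzB: "nz_ideal F B" using nz_ideal_superset[OF less.hyps B(1)] B(2) by blast
    have "\<not> OK F \<subseteq> P" using prime_idealD(3)[OF P(1)] OK_1 by blast
    then have "ideal_ord P P = 1"
      using ideal_ord_eq[OF P(1) is_ideal_OK, of 1] idP by simp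
    then have "ideal_ord P A = Suc (ideal_ord P B)"
      unfolding B(3) using ideal_ord_mult[OF P(1) nzP nzB] by simp
    then have "ideal_ord P B \<noteq> 0" using less.prems[OF P(1)] by (metis even_Suc even_zero)
    then have "B \<subseteq> P" using ideal_ord_not_subset[OF P(1) B(1)] by metis
    then obtain C where C: "is_ideal F C" "B \<subset> C" "B = ideal_mult F P C"
      using prime_ideal_divides[OF P(1) nzB] by blast
    have nzC: "nz_ideal F C" using nz_ideal_superset[OF nzB C(1)] C(2) by blast
    have "even (ideal_ord Q C)" if Q: "prime_ideal F Q" for Q
    proof -
      have "ideal_ord Q A = 2 * ideal_ord Q P + ideal_ord Q C"
        by (subst B(3), subst C(3)) (simp add: ideal_ord_mult[OF Q] nzP nzC nz_ideal_mult)
      then show ?thesis using less.prems[OF Q] by simp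
    qed
    then obtain D where D: "is_ideal F D" "C = ideal_mult F D D"
      using less.IH[OF C(1)] C(2) B(2) by blast
    have "A = ideal_mult F (ideal_mult F P P) (ideal_mult F D D)"
      using B C D idP by (simp add: ideal_mult_assoc)
    also have "\<dots> = ideal_mult F (ideal_mult F P D) (ideal_mult F P D)"
      by (rule ideal_mult_4) (use idP D in auto)
    finally show ?thesis using idP D by (intro exI[of _ "ideal_mult F P D"]) simp
  qed
qed

section \<open>Valuations of field elements\<close>

lemma vP_int_eq:
  assumes "prime_ideal F P" "x \<in> OK F"
  shows "vP_int F P x = ideal_ord P (pideal F x)"
  unfolding vP_int_def ideal_ord_def
  using pideal_subset_iff[OF is_ideal_pow assms(2)] prime_idealD(2)[OF assms(1)] by simp

lemma vP_int_mult:
  assumes "prime_ideal F P" "x \<in> OK F" "x \<noteq> 0" "y \<in> OK F" "y \<noteq> 0"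
  shows "vP_int F P (x * y) = vP_int F P x + vP_int F P y"
  using assms by (simp add: vP_int_eq OK_mult pideal_mult ideal_ord_mult nz_ideal_pideal)

text \<open>Frees \<open>vP\<close> from the fraction picked by \<open>SOME\<close>: for two
  fractions u / v = x / y, additivity is applied to u y = x v.\<close>

lemma vP_eq:
  assumes P: "prime_ideal F P" and xy: "x \<in> OK F" "y \<in> OK F" "x \<noteq> 0" "y \<noteq> 0" "a = x / y"
  shows "vP F P a = int (vP_int F P x) - int (vP_int F P y)"
proof -
  define X where "X = (SOME (x, y). x \<in> OK F \<and> y \<in> OK F \<and> x \<noteq> 0 \<and> y \<noteq> 0 \<and> a = x / y)"
  have "case X of (x, y) \<Rightarrow> x \<in> OK F \<and> y \<in> OK F \<and> x \<noteq> 0 \<and> y \<noteq> 0 \<and> a = x / y"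
    unfolding X_def by (rule someI[of _ "(x, y)"]) (use xy in auto)
  then obtain u v where X: "X = (u, v)" "u \<in> OK F" "v \<in> OK F" "u \<noteq> 0" "v \<noteq> 0" "a = u / v"
    by (cases X) auto
  have "u * y = x * v" using X xy by (simp add: field_simps)
  then have "vP_int F P u + vP_int F P y = vP_int F P x + vP_int F P v"
    using vP_int_mult[OF P] X xy by metis
  moreover have "vP F P a = int (vP_int F P u) - int (vP_int F P v)"
    unfolding vP_def X_def[symmetric] X(1) by simp
  ultimately show ?thesis by linarith
qed

lemma vP_OK:
  assumes "prime_ideal F P" "x \<in> OK F" "x \<noteq> 0"
  shows "vP F P x = int (ideal_ord P (pideal F x))"
proof -
  have "\<not> OK F \<subseteq> P" using prime_idealD(3)[OF assms(1)] OK_1 by blast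
  then have "vP_int F P 1 = 0"
    using vP_int_eq[OF assms(1) OK_1] ideal_ord_not_subset[OF assms(1) is_ideal_OK] by simp
  then show ?thesis using vP_eq[OF assms(1,2) OK_1 assms(3)] vP_int_eq[OF assms(1,2)] by simp
qed

text \<open>Radicands of the same quadratic extension differ by a square, so this is the
  independence of essential ramification from the radicand.\<close>

lemma vP_mult_square_even_iff:
  assumes P: "prime_ideal F P" and a: "a \<in> F" "a \<noteq> 0" and t: "t \<in> F" "t \<noteq> 0"
  shows "even (vP F P (a * t\<^sup>2)) \<longleftrightarrow> even (vP F P a)"
proof -
  obtain x y where xy: "x \<in> OK F" "y \<in> OK F" "y \<noteq> 0" "a = x / y" using fraction[OF a(1)] by blast
  obtain u v where uv: "u \<in> OK F" "v \<in> OK F" "v \<noteq> 0" "t = u / v" using fraction[OF t(1)] by blast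
  have nz: "x \<noteq> 0" "u \<noteq> 0" using xy uv a t by auto
  have "vP F P (a * t\<^sup>2) = int (vP_int F P (x * (u * u))) - int (vP_int F P (y * (v * v)))"
    by (rule vP_eq[OF P]) (use xy uv nz in \<open>auto simp: power2_eq_square OK_mult\<close>)
  also have "\<dots> = int (vP_int F P x) - int (vP_int F P y) + 2 * (int (vP_int F P u) - int (vP_int F P v))"
    using xy uv nz by (simp add: vP_int_mult[OF P] OK_mult)
  also have "int (vP_int F P x) - int (vP_int F P y) = vP F P a"
    using vP_eq[OF P xy(1,2) nz(1) xy(3,4)] by simp
  finally show ?thesis by simp
qed

lemma vP_even_if_square:
  assumes P: "prime_ideal F P" and a: "a \<in> OK F" "a \<noteq> 0"
    and A: "is_ideal F A" "pideal F a = ideal_mult F A A"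
  shows "even (vP F P a)"
proof -
  have "nz_ideal F (ideal_mult F A A)" using nz_ideal_pideal[OF a] A by simp
  then have "nz_ideal F A"
    using nz_ideal_superset[OF _ A(1) ideal_mult_subset_left[OF A(1) A(1)]] by blast
  then show ?thesis using vP_OK[OF P a] ideal_ord_mult[OF P, of A A] A by simp
qed

lemma square_if_vP_even:
  assumes a: "a \<in> OK F" "a \<noteq> 0" and even: "\<And>P. prime_ideal F P \<Longrightarrow> even (vP F P a)"
  shows "\<exists>A. is_ideal F A \<and> pideal F a = ideal_mult F A A"
  by (rule ideal_is_square[OF nz_ideal_pideal[OF a]]) (use vP_OK a even in auto)

end

section \<open>Embeddings and Kronecker's theorem\<close>

text \<open>Polynomials over \<open>F\<close> are complex polynomials with a condition on
  coefficients, since \<open>F\<close> is a set and not a type.\<close>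

definition pol :: "complex set \<Rightarrow> complex poly set" where
  "pol F = {p. \<forall>i. coeff p i \<in> F}"

lemma subfield_Rats: "subfield \<rat>"
  by (auto simp: subfield_def)

lemma polI: "(\<And>i. coeff p i \<in> F) \<Longrightarrow> p \<in> pol F" and polD: "p \<in> pol F \<Longrightarrow> coeff p i \<in> F"
  by (auto simp: pol_def)

section \<open>Polynomials over a subfield\<close>

context subfield_ctx
begin

lemma pol_0: "0 \<in> pol F" and pol_1: "1 \<in> pol F"
  by (auto intro!: polI simp: coeff_1)

lemma pol_add: "p \<in> pol F \<Longrightarrow> q \<in> pol F \<Longrightarrow> p + q \<in> pol F"
  and pol_diff: "p \<in> pol F \<Longrightarrow> q \<in> pol F \<Longrightarrow> p - q \<in> pol F"
  and pol_smult: "c \<in> F \<Longrightarrow> p \<in> pol F \<Longrightarrow> smult c p \<in> pol F"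
  and pol_monom: "c \<in> F \<Longrightarrow> monom c n \<in> pol F"
  by (auto intro!: polI add_in diff_in minus_in mult_in dest: polD)

lemma pol_mult: "p \<in> pol F \<Longrightarrow> q \<in> pol F \<Longrightarrow> p * q \<in> pol F"
  by (auto intro!: polI sum_in mult_in dest: polD simp: coeff_mult)

lemma poly_in: "p \<in> pol F \<Longrightarrow> y \<in> F \<Longrightarrow> poly p y \<in> F"
  unfolding poly_altdef by (intro sum_in mult_in power_in polD)

text \<open>Long division is carried out by hand because quotient and remainder must keep their
  coefficients in \<open>F\<close>.\<close>

lemma pol_division:
  assumes q: "q \<in> pol F" "lead_coeff q = 1" and f: "f \<in> pol F"
  shows "\<exists>g\<in>pol F. \<exists>r\<in>pol F. f = q * g + r \<and> (r = 0 \<or> degree r < degree q)"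
  using f
proof (induction "degree f" arbitrary: f rule: less_induct)
  case less
  show ?case
  proof (cases "degree f < degree q \<or> f = 0")
    case True
    then show ?thesis using less.prems pol_0 by (intro bexI[of _ 0] bexI[of _ f]) auto
  next
    case False
    define m where "m = monom (lead_coeff f) (degree f - degree q)"
    define h where "h = f - q * m"
    have m: "m \<in> pol F" unfolding m_def by (intro pol_monom polD less.prems)
    have h: "h \<in> pol F" unfolding h_def by (intro pol_diff pol_mult m q less.prems)
    have deg_m: "degree m = degree f - degree q" unfolding m_def by (rule degree_monom_eq) (use False in simp)
    have nz: "q \<noteq> 0" "m \<noteq> 0" using q False by (auto simp: m_def)
    have deg: "degree (q * m) = degree f" using nz False by (simp add: degree_mult_eq deg_m)
    have "coeff (q * m) (degree f) = lead_coeff (q * m)" by (simp add: deg)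
    also have "\<dots> = coeff m (degree f - degree q)" using q by (simp add: lead_coeff_mult deg_m)
    also have "\<dots> = lead_coeff f" by (simp add: m_def)
    finally have top: "coeff h (degree f) = 0" by (simp add: h_def)
    show ?thesis
    proof (cases "degree h < degree f")
      case True
      then obtain g r where gr: "g \<in> pol F" "r \<in> pol F" "h = q * g + r" "r = 0 \<or> degree r < degree q"
        using less.hyps[OF _ h] by blast
      have "f = q * (g + m) + r" using gr(3) by (simp add: h_def algebra_simps)
      then show ?thesis using gr m pol_add by blast
    next
      case False
      have "degree h \<le> degree f" unfolding h_def using deg by (metis degree_diff_le order_refl)
      then have "degree h = degree f" using False by simp
      then have "h = 0" using top by (metis leading_coeff_0_iff)
      then have "f = q * m + 0" by (simp add: h_def)
      then show ?thesis using m pol_0 by blast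
    qed
  qed
qed

end

section \<open>Embeddings and minimal polynomials\<close>

locale embedding_ctx = subfield_ctx F for F +
  fixes s :: "complex \<Rightarrow> complex"
  assumes embedding: "embedding F s"
begin

lemma emb_1 [simp]: "s 1 = 1"
  and emb_add: "x \<in> F \<Longrightarrow> y \<in> F \<Longrightarrow> s (x + y) = s x + s y"
  and emb_mult: "x \<in> F \<Longrightarrow> y \<in> F \<Longrightarrow> s (x * y) = s x * s y"
  using embedding by (auto simp: embedding_def)

lemma emb_0 [simp]: "s 0 = 0"
  using emb_add[of 0 0] by simp

lemma emb_minus: "x \<in> F \<Longrightarrow> s (- x) = - s x"
  using emb_add[of x "- x"] minus_in[of x] by (simp add: eq_neg_iff_add_eq_0 add.commute)

lemma emb_sum: "(\<And>i. i \<in> I \<Longrightarrow> f i \<in> F) \<Longrightarrow> s (sum f I) = (\<Sum>i\<in>I. s (f i))"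
  by (induction I rule: infinite_finite_induct) (auto simp: emb_add sum_in)

lemma emb_power: "x \<in> F \<Longrightarrow> s (x ^ n) = s x ^ n"
  by (induction n) (auto simp: emb_mult power_in)

lemma map_poly_emb_add: "p \<in> pol F \<Longrightarrow> q \<in> pol F \<Longrightarrow> map_poly s (p + q) = map_poly s p + map_poly s q"
  by (intro poly_eqI) (simp add: coeff_map_poly emb_add polD)

lemma map_poly_emb_mult: "p \<in> pol F \<Longrightarrow> q \<in> pol F \<Longrightarrow> map_poly s (p * q) = map_poly s p * map_poly s q"
  by (intro poly_eqI) (simp add: coeff_map_poly coeff_mult emb_sum emb_mult mult_in polD)

end

definition is_min_poly :: "complex set \<Rightarrow> complex \<Rightarrow> complex poly \<Rightarrow> bool" where
  "is_min_poly K y q \<longleftrightarrow> q \<in> pol K \<and> lead_coeff q = 1 \<and> poly q y = 0 \<and>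
     (\<forall>f\<in>pol K. f \<noteq> 0 \<and> poly f y = 0 \<longrightarrow> degree q \<le> degree f)"

lemma (in subfield_ctx) min_poly_dvd:
  assumes q: "is_min_poly F y q" and f: "f \<in> pol F" "poly f y = 0"
  shows "\<exists>g\<in>pol F. f = q * g"
proof -
  obtain g r where gr: "g \<in> pol F" "r \<in> pol F" "f = q * g + r" "r = 0 \<or> degree r < degree q"
    using pol_division[of q f] q f by (auto simp: is_min_poly_def)
  have "poly r y = 0" using gr(3) f(2) q by (simp add: is_min_poly_def)
  then have "r = 0" using gr q unfolding is_min_poly_def by (meson not_less)
  then show ?thesis using gr by auto
qed

lemma (in subfield_ctx) min_poly_exists:
  assumes f: "f \<in> pol F" "f \<noteq> 0" "poly f y = 0"
  shows "\<exists>q. is_min_poly F y q"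
proof -
  let ?P = "\<lambda>f. f \<in> pol F \<and> f \<noteq> 0 \<and> poly f y = 0"
  define q where "q = (ARG_MIN degree f. ?P f)"
  have q: "?P q" "\<And>g. ?P g \<Longrightarrow> degree q \<le> degree g"
    unfolding q_def using arg_min_natI[of ?P f degree] arg_min_nat_le[of ?P _ degree] f by blast+
  let ?q = "smult (inverse (lead_coeff q)) q"
  have "is_min_poly F y ?q"
    unfolding is_min_poly_def using q by (auto intro!: pol_smult inverse_in polD)
  then show ?thesis by blast
qed

section \<open>Extending embeddings to the whole field\<close>

context number_field_ctx
begin

text \<open>The bound \<open>n\<close> is uniform in \<open>y\<close>; Kronecker's theorem needs
  this for all powers of one element at once.\<close>

lemma int_poly_bounded_degree:
  "\<exists>n. \<forall>y\<in>F. \<exists>p :: int poly. p \<noteq> 0 \<and> degree p \<le> n \<and> poly (map_poly of_int p) y = 0"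
proof -
  obtain n where n: "\<forall>f :: nat \<Rightarrow> complex. (\<forall>i\<le>n. f i \<in> F) \<longrightarrow>
    (\<exists>c :: nat \<Rightarrow> int. (\<Sum>i\<le>n. of_int (c i) * f i) = 0 \<and> (\<forall>q. (\<forall>i\<le>n. q dvd c i) \<longrightarrow> is_unit q))"
    using int_dependence by blast
  have "\<exists>p :: int poly. p \<noteq> 0 \<and> degree p \<le> n \<and> poly (map_poly of_int p) y = 0" if y: "y \<in> F" for y
  proof -
    obtain c :: "nat \<Rightarrow> int" where c: "(\<Sum>i\<le>n. of_int (c i) * y ^ i) = 0" "\<forall>q. (\<forall>i\<le>n. q dvd c i) \<longrightarrow> is_unit q"
      using n power_in[OF y] by blast
    define p where "p = (\<Sum>i\<le>n. monom (c i) i)"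
    have coeff_p: "coeff p k = (if k \<le> n then c k else 0)" for k
      by (simp add: p_def coeff_sum)
    have "degree p \<le> n" by (rule degree_le) (simp add: coeff_p)
    moreover have "p \<noteq> 0"
    proof
      assume "p = 0"
      then have "c i = 0" if "i \<le> n" for i using coeff_p[of i] that by simp
      then show False using c(2)[rule_format, of 0] by auto
    qed
    moreover have "poly (map_poly of_int p) y = (\<Sum>i\<le>n. of_int (c i) * y ^ i)"
    proof -
      have "poly (map_poly of_int p) y = (\<Sum>i\<le>degree p. of_int (c i) * y ^ i)"
        unfolding poly_altdef
        by (intro sum.cong) (use \<open>degree p \<le> n\<close> in \<open>auto simp: degree_map_poly coeff_map_poly coeff_p\<close>)
      also have "\<dots> = (\<Sum>i\<le>n. of_int (c i) * y ^ i)"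
      proof (rule sum.mono_neutral_left)
        show "\<forall>i\<in>{..n} - {..degree p}. of_int (c i) * y ^ i = 0"
        proof
          fix i assume "i \<in> {..n} - {..degree p}"
          then have "coeff p i = 0" "i \<le> n" by (auto simp: coeff_eq_0)
          then show "of_int (c i) * y ^ i = 0" using coeff_p[of i] by simp
        qed
      qed (use \<open>degree p \<le> n\<close> in auto)
      finally show ?thesis .
    qed
    ultimately show ?thesis using c by auto
  qed
  then show ?thesis by blast
qed

lemma min_poly_over_subfield:
  assumes K: "subfield K" and y: "y \<in> F"
  shows "\<exists>q. is_min_poly K y q"
proof -
  interpret K: subfield_ctx K using K by unfold_locales
  obtain p :: "int poly" where p: "p \<noteq> 0" "poly (map_poly of_int p) y = 0"
    using int_poly_bounded_degree y by blast
  show ?thesis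
    by (rule K.min_poly_exists[OF _ _ p(2)])
       (use p(1) in \<open>auto simp: map_poly_eq_0_iff coeff_map_poly intro!: polI\<close>)
qed

lemma sum_in_additive:
  fixes f :: "'b \<Rightarrow> complex"
  assumes "0 \<in> S" "\<And>x y. x \<in> S \<Longrightarrow> y \<in> S \<Longrightarrow> x + y \<in> S" "\<And>i. f i \<in> S"
  shows "sum f I \<in> S"
  by (induction I rule: infinite_finite_induct) (use assms in simp_all)

text \<open>Write the minimal polynomial as a + X g. Here a is nonzero, as otherwise g would be an
  annihilating polynomial of smaller degree; so 1/x = - g(x) / a is a polynomial in \<open>x\<close>
  with rational coefficients.\<close>

lemma inverse_in_subring:
  assumes S: "\<And>x y. x \<in> S \<Longrightarrow> y \<in> S \<Longrightarrow> x + y \<in> S" "\<And>x y. x \<in> S \<Longrightarrow> y \<in> S \<Longrightarrow> x * y \<in> S"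
    "range of_rat \<subseteq> S" and x: "x \<in> F" "x \<in> S"
  shows "inverse x \<in> S"
proof (cases "x = 0")
  case True
  then show ?thesis using x by simp
next
  case False
  interpret Q: subfield_ctx "\<rat>"
    by unfold_locales (rule subfield_Rats)
  obtain q where q: "is_min_poly \<rat> x q"
    using min_poly_over_subfield[OF Q.subfield x(1)] by blast
  obtain a g where ag: "q = pCons a g" by (cases q)
  have a: "a \<in> \<rat>" using polD[of q "\<rat>" 0] q ag by (simp add: is_min_poly_def)
  have g: "g \<in> pol \<rat>"
  proof (rule polI)
    show "coeff g i \<in> \<rat>" for i using polD[of q "\<rat>" "Suc i"] q ag by (simp add: is_min_poly_def)
  qed
  have rel: "x * poly g x = - a" using q ag by (simp add: is_min_poly_def eq_neg_iff_add_eq_0 add.commute)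
  have "q \<noteq> 0" using q by (auto simp: is_min_poly_def)
  have "a \<noteq> 0"
  proof
    assume "a = 0"
    then have "g \<noteq> 0" "poly g x = 0" using \<open>q \<noteq> 0\<close> rel False ag by auto
    then have "degree q \<le> degree g" using q g unfolding is_min_poly_def by blast
    then show False using ag \<open>g \<noteq> 0\<close> by simp
  qed
  have "inverse x = (- inverse a) * poly g x" using rel \<open>a \<noteq> 0\<close> False
    by (simp add: field_simps)
  also have "\<dots> = (\<Sum>i\<le>degree g. (- inverse a * coeff g i) * x ^ i)"
    by (simp add: poly_altdef sum_distrib_left mult.assoc)
  also have "\<dots> \<in> S"
  proof -
    have rat: "r \<in> S" if "r \<in> \<rat>" for r using that S(3) by (auto simp: Rats_def)
    have pow: "x ^ i \<in> S" for i using x S(2) rat by (induction i) auto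
    have "- inverse a * coeff g i \<in> \<rat>" for i using a polD[OF g] by simp
    then have term_in: "(- inverse a * coeff g i) * x ^ i \<in> S" for i by (intro S(2) rat pow)
    show ?thesis
      by (rule sum_in_additive) (use S(1) rat[of 0] term_in in auto)
  qed
  finally show ?thesis .
qed

text \<open>The field K' = K[y] is K[X] modulo \<open>q\<close>, and the extension sends f(y) to the
  value at \<open>z\<close> of the transported polynomial. It is well defined because
  \<open>q\<close> divides f - g whenever f(y) = g(y), and \<open>z\<close> is a root of the
  transported \<open>q\<close>.\<close>

lemma extend_embedding_to_element:
  assumes K: "subfield K" "K \<subseteq> F" "embedding K s" and y: "y \<in> F"
    and q: "is_min_poly K y q" and z: "poly (map_poly s q) z = 0"
  shows "\<exists>K' s'. subfield K' \<and> K \<subseteq> K' \<and> K' \<subseteq> F \<and> y \<in> K' \<and> embedding K' s' \<and>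
    (\<forall>x\<in>K. s' x = s x) \<and> s' y = z"
proof -
  interpret K: embedding_ctx K s using K by unfold_locales
  define K' where "K' = (\<lambda>f. poly f y) ` pol K"
  \<comment> \<open>\<open>SOME\<close> picks one polynomial representing \<open>x\<close>; the next
    fact shows that any other gives the same value.\<close>
  define s' where "s' x = poly (map_poly s (SOME f. f \<in> pol K \<and> poly f y = x)) z" for x
  have s': "s' (poly f y) = poly (map_poly s f) z" if f: "f \<in> pol K" for f
  proof -
    define g where "g = (SOME g. g \<in> pol K \<and> poly g y = poly f y)"
    have g: "g \<in> pol K" "poly g y = poly f y"
      unfolding g_def using someI[of "\<lambda>g. g \<in> pol K \<and> poly g y = poly f y" f] f by auto
    then obtain h where h: "h \<in> pol K" "g - f = q * h"
      using K.min_poly_dvd[OF q K.pol_diff[OF g(1) f]] by auto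
    have "g = f + q * h" using h(2) by (simp add: algebra_simps)
    moreover have "q \<in> pol K" using q by (simp add: is_min_poly_def)
    ultimately have "map_poly s g = map_poly s f + map_poly s q * map_poly s h"
      using f h by (simp add: K.map_poly_emb_add K.map_poly_emb_mult K.pol_mult)
    then show ?thesis unfolding s'_def g_def[symmetric] using z by simp
  qed
  have pol_sub: "pol K \<subseteq> pol F" using K(2) by (auto simp: pol_def)
  have sub: "K' \<subseteq> F" using pol_sub poly_in y by (auto simp: K'_def)
  have KK': "K \<subseteq> K'"
  proof
    fix x assume "x \<in> K"
    then have "monom x 0 \<in> pol K" by (rule K.pol_monom)
    then show "x \<in> K'" unfolding K'_def by (rule rev_image_eqI) (simp add: poly_monom)
  qed
  have "monom 1 1 \<in> pol K" by (intro K.pol_monom) simp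
  then have yK': "y \<in> K'" and sy: "s' y = z"
    using s'[of "monom 1 1"] unfolding K'_def
    by (auto simp: poly_monom map_poly_monom intro!: image_eqI[of _ _ "monom 1 1"])
  have add: "a + b \<in> K' \<and> s' (a + b) = s' a + s' b" and mult: "a * b \<in> K' \<and> s' (a * b) = s' a * s' b"
    if ab: "a \<in> K'" "b \<in> K'" for a b
  proof -
    obtain f g where fg: "f \<in> pol K" "a = poly f y" "g \<in> pol K" "b = poly g y"
      using ab by (auto simp: K'_def)
    have ab_eq: "a + b = poly (f + g) y" "a * b = poly (f * g) y" using fg by auto
    have fg': "f + g \<in> pol K" "f * g \<in> pol K" using fg K.pol_add K.pol_mult by auto
    have "s' a = poly (map_poly s f) z" "s' b = poly (map_poly s g) z"
      using s' fg by simp_all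
    moreover have "s' (a + b) = poly (map_poly s (f + g)) z" "s' (a * b) = poly (map_poly s (f * g)) z"
      unfolding ab_eq using s' fg' by blast+
    ultimately have "s' (a + b) = s' a + s' b" "s' (a * b) = s' a * s' b"
      using fg(1,3) by (simp_all add: K.map_poly_emb_add K.map_poly_emb_mult)
    moreover have "a + b \<in> K'" "a * b \<in> K'" unfolding ab_eq K'_def using fg' by blast+
    ultimately show "a + b \<in> K' \<and> s' (a + b) = s' a + s' b" "a * b \<in> K' \<and> s' (a * b) = s' a * s' b"
      by blast+
  qed
  have rat: "range of_rat \<subseteq> K'" using KK' K.of_rat_in by blast
  have minus: "- a \<in> K'" if "a \<in> K'" for a
  proof -
    have "of_rat (-1) \<in> K'" using rat by blast
    then have "of_rat (-1) * a \<in> K'" using mult that by blast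
    then show ?thesis by (simp add: of_rat_minus)
  qed
  have inv: "inverse a \<in> K'" if "a \<in> K'" for a
    using inverse_in_subring[of K' a] add mult rat that sub by (simp add: subset_iff)
  have "subfield K'" unfolding subfield_def
    by (simp add: add mult minus inv subsetD[OF KK'])
  moreover have "s' 1 = 1" using s'[OF K.pol_1] by simp
  then have "embedding K' s'" unfolding embedding_def by (simp add: add mult)
  moreover have "s' x = s x" if "x \<in> K" for x
    using s'[OF K.pol_monom[OF that, of 0]] by (simp add: poly_monom map_poly_monom)
  ultimately show ?thesis using KK' sub yK' sy by blast
qed

text \<open>One element at a time. The fundamental theorem of algebra supplies the root to which the
  next element is sent.\<close>

lemma extend_embedding_to_finite_set:
  assumes "finite S" "S \<subseteq> F" "subfield K" "K \<subseteq> F" "embedding K s"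
  shows "\<exists>K' s'. subfield K' \<and> K \<subseteq> K' \<and> K' \<subseteq> F \<and> S \<subseteq> K' \<and> embedding K' s' \<and> (\<forall>x\<in>K. s' x = s x)"
  using assms(1,2)
proof (induction S rule: finite_induct)
  case empty
  then show ?case using assms by blast
next
  case (insert y S)
  then obtain K' s' where K': "subfield K'" "K \<subseteq> K'" "K' \<subseteq> F" "S \<subseteq> K'" "embedding K' s'"
    "\<forall>x\<in>K. s' x = s x" by auto
  have y: "y \<in> F" using insert.prems by simp
  interpret K': embedding_ctx K' s' using K' by unfold_locales
  obtain q where q: "is_min_poly K' y q" using min_poly_over_subfield[OF K'(1) y] by blast
  then have "lead_coeff q = 1" "poly q y = 0" by (auto simp: is_min_poly_def)
  then have "degree q \<noteq> 0" using degree_eq_zeroE[of q] by fastforce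
  moreover have "degree (map_poly s' q) = degree q"
    using \<open>lead_coeff q = 1\<close> by (intro map_poly_degree_eq) simp
  ultimately obtain z where z: "poly (map_poly s' q) z = 0"
    using fundamental_theorem_of_algebra constant_degree by metis
  obtain K'' s'' where "subfield K''" "K' \<subseteq> K''" "K'' \<subseteq> F" "y \<in> K''" "embedding K'' s''"
    "\<forall>x\<in>K'. s'' x = s' x"
    using extend_embedding_to_element[OF K'(1,3,5) y q z] by blast
  then show ?case using K' by (intro exI[of _ K''] exI[of _ s'']) auto
qed

text \<open>So a bound valid under all embeddings bounds all roots of the minimal polynomial. After
  \<open>y\<close> is sent to \<open>z\<close>, extending over a finite rational spanning set
  reaches all of \<open>F\<close>.\<close>

lemma embedding_with_value:
  assumes y: "y \<in> F" and q: "is_min_poly \<rat> y q" and z: "poly q z = 0"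
  shows "\<exists>s. embedding F s \<and> s y = z"
proof -
  have Q: "subfield \<rat>" "\<rat> \<subseteq> F" "embedding \<rat> id"
    using subfield_Rats by (auto simp: embedding_def Rats_def)
  have "poly (map_poly id q) z = 0" using z by simp
  then obtain K s where K: "subfield K" "\<rat> \<subseteq> K" "K \<subseteq> F" "y \<in> K" "embedding K s" "s y = z"
    using extend_embedding_to_element[OF Q y q] by blast
  obtain B where B: "finite B" "B \<subseteq> F" "\<forall>x\<in>F. \<exists>c. x = (\<Sum>b\<in>B. of_rat (c b) * b)"
    using finite_dimensional by blast
  obtain K' s' where K': "subfield K'" "K \<subseteq> K'" "K' \<subseteq> F" "B \<subseteq> K'" "embedding K' s'" "\<forall>x\<in>K. s' x = s x"
    using extend_embedding_to_finite_set[OF B(1,2) K(1,3,5)] by blast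
  interpret K': subfield_ctx K' using K' by unfold_locales
  have "F \<subseteq> K'"
  proof
    fix x assume "x \<in> F"
    then obtain c where "x = (\<Sum>b\<in>B. of_rat (c b) * b)" using B by blast
    also have "\<dots> \<in> K'" using K'(4) by (intro K'.sum_in K'.mult_in) auto
    finally show "x \<in> K'" .
  qed
  then have "K' = F" using K' by blast
  then show ?thesis using K K' by auto
qed

end

text \<open>Linear factors are split off one by one. A coefficient of (X - z) g is a coefficient of
  g minus z times the next one, so each factor at most doubles the bound; hence the power of
  2.\<close>

lemma monic_poly_coeffs_bounded:
  fixes p :: "complex poly"
  assumes "lead_coeff p = 1" "\<And>z. poly p z = 0 \<Longrightarrow> alg_int z \<and> norm z \<le> 1"
  shows "alg_int (coeff p i) \<and> norm (coeff p i) \<le> 2 ^ degree p"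
  using assms
proof (induction "degree p" arbitrary: p i)
  case 0
  then have "p = 1" by (auto elim!: degree_eq_zeroE simp: one_pCons)
  then show ?case by (auto simp: coeff_1)
next
  case (Suc d)
  then obtain z where z: "poly p z = 0"
    using fundamental_theorem_of_algebra constant_degree by (metis nat.distinct(1))
  then obtain g where g: "p = [:- z, 1:] * g" by (auto simp: poly_eq_0_iff_dvd elim: dvdE)
  have "p \<noteq> 0" using Suc.prems by auto
  then have "g \<noteq> 0" using g by auto
  have "lead_coeff p = lead_coeff [:- z, 1:] * lead_coeff g" unfolding g by (rule lead_coeff_mult)
  then have lg: "lead_coeff g = 1" using Suc.prems(1) by simp
  have "degree p = degree [:- z, 1:] + degree g"
    unfolding g by (rule degree_mult_eq) (use \<open>g \<noteq> 0\<close> in auto)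
  then have dg: "d = degree g" using Suc.hyps(2) by simp
  have "alg_int w \<and> norm w \<le> 1" if "poly g w = 0" for w
    using Suc.prems(2)[of w] that unfolding g by simp
  then have IH: "alg_int (coeff g i) \<and> norm (coeff g i) \<le> 2 ^ d" for i
    using Suc.hyps(1)[OF dg lg] dg by simp
  have z': "alg_int z" "norm z \<le> 1" using Suc.prems(2)[OF z] by auto
  have cp: "coeff p i = (if i = 0 then 0 else coeff g (i - 1)) - z * coeff g i"
    unfolding g by (simp add: coeff_pCons split: nat.split)
  have "norm (coeff p i) \<le> norm (if i = 0 then 0 else coeff g (i - 1)) + norm (z * coeff g i)"
    unfolding cp by (rule norm_triangle_ineq4)
  also have "\<dots> \<le> 2 ^ d + 1 * 2 ^ d"
    unfolding norm_mult using IH z' by (intro add_mono mult_mono) auto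
  also have "\<dots> = 2 ^ degree p" using Suc.hyps(2)[symmetric] by simp
  finally have "norm (coeff p i) \<le> 2 ^ degree p" .
  moreover have "alg_int (coeff p i)"
    unfolding cp using IH z' by (intro alg_int_diff alg_int_mult) auto
  ultimately show ?case by blast
qed

lemma finite_bounded_int_polys:
  "finite {p :: complex poly. degree p \<le> n \<and> (\<forall>i. coeff p i \<in> \<int> \<and> norm (coeff p i) \<le> M)}" (is "finite ?P")
proof -
  let ?A = "{z :: complex. z \<in> \<int> \<and> norm z \<le> M}"
  have "?A \<subseteq> of_int ` {- \<lceil>M\<rceil>..\<lceil>M\<rceil>}"
  proof
    fix z :: complex assume "z \<in> ?A"
    then obtain k where k: "z = of_int k" "norm z \<le> M" by (auto elim: Ints_cases)
    then have "of_int \<bar>k\<bar> \<le> M" by simp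
    then have "\<bar>k\<bar> \<le> \<lceil>M\<rceil>" by linarith
    then show "z \<in> of_int ` {- \<lceil>M\<rceil>..\<lceil>M\<rceil>}" unfolding k(1) by (intro imageI) (simp add: abs_le_iff)
  qed
  then have "finite ?A" by (rule finite_subset) simp
  then have "finite {xs. set xs \<subseteq> ?A \<and> length xs \<le> Suc n}" by (rule finite_lists_length_le)
  moreover have "?P \<subseteq> Poly ` {xs. set xs \<subseteq> ?A \<and> length xs \<le> Suc n}"
  proof
    fix p assume p: "p \<in> ?P"
    have "set (coeffs p) \<subseteq> ?A" using p by (auto simp: coeffs_def)
    moreover have "length (coeffs p) \<le> Suc n" using p by (cases "p = 0") (auto simp: length_coeffs_degree)
    ultimately show "p \<in> Poly ` {xs. set xs \<subseteq> ?A \<and> length xs \<le> Suc n}"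
      by (intro image_eqI[of _ _ "coeffs p"]) auto
  qed
  ultimately show ?thesis by (meson finite_imageI finite_subset)
qed

section \<open>Kronecker's theorem\<close>

context number_field_ctx
begin

text \<open>The minimal polynomials of all powers of \<open>u\<close> have degree at most
  \<open>n\<close> and integer coefficients bounded by 2^n, so they form a finite set with finitely
  many roots in total. Two powers of \<open>u\<close> therefore coincide.\<close>

theorem kronecker_root_of_unity:
  assumes u: "u \<in> OK F" and norm: "\<And>s. embedding F s \<Longrightarrow> norm (s u) = 1"
  shows "\<exists>n::nat. n > 0 \<and> u ^ n = 1"
proof -
  obtain n where n: "\<And>y. y \<in> F \<Longrightarrow> \<exists>p :: int poly. p \<noteq> 0 \<and> degree p \<le> n \<and> poly (map_poly of_int p) y = 0"
    using int_poly_bounded_degree by blast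
  define \<P> where "\<P> = {p :: complex poly. degree p \<le> n \<and> (\<forall>i. coeff p i \<in> \<int> \<and> norm (coeff p i) \<le> 2 ^ n)}"
  interpret Q: subfield_ctx "\<rat>"
    by unfold_locales (rule subfield_Rats)
  have uF: "u \<in> F" using u OK_in by blast
  have root: "\<exists>q\<in>\<P>. q \<noteq> 0 \<and> poly q (u ^ k) = 0" for k
  proof -
    have uk: "u ^ k \<in> F" "alg_int (u ^ k)" using OK_power[OF u] by (auto simp: OK_def)
    obtain q where q: "is_min_poly \<rat> (u ^ k) q"
      using min_poly_over_subfield[OF Q.subfield uk(1)] by blast
    have q': "q \<in> pol \<rat>" "lead_coeff q = 1" "poly q (u ^ k) = 0" using q by (auto simp: is_min_poly_def)
    obtain r :: "int poly" where r: "r \<noteq> 0" "degree r \<le> n" "poly (map_poly of_int r) (u ^ k) = 0"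
      using n[OF uk(1)] by blast
    have intpol: "map_poly of_int p \<in> pol \<rat>" for p :: "int poly"
      by (rule polI) (simp add: coeff_map_poly)
    have "degree q \<le> degree (map_poly of_int r :: complex poly)"
      using q intpol[of r] r(1,3) unfolding is_min_poly_def by (metis map_poly_eq_0_iff of_int_0 of_int_eq_0_iff)
    then have deg: "degree q \<le> n" using r(2) by (simp add: degree_map_poly)
    \<comment> \<open>The root \<open>z\<close> is the image of \<open>u ^ k\<close> under an
      embedding, hence of norm 1. It is integral because \<open>q\<close> divides a monic integer
      polynomial annihilating \<open>u ^ k\<close>.\<close>
    have roots: "alg_int z \<and> norm z \<le> 1" if z: "poly q z = 0" for z
    proof -
      obtain s where s: "embedding F s" "s (u ^ k) = z" using embedding_with_value[OF uk(1) q z] by blast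
      interpret embedding_ctx F s using s by unfold_locales
      have "norm z = 1" using s emb_power[OF uF] norm[OF s(1)] by (auto simp: norm_power)
      moreover have "alg_int z"
      proof -
        obtain p :: "int poly" where p: "lead_coeff p = 1" "poly (map_poly of_int p) (u ^ k) = 0"
          using uk(2) alg_int_def by blast
        obtain g where "map_poly of_int p = q * g" using Q.min_poly_dvd[OF q intpol p(2)] by blast
        then have "poly (map_poly of_int p) z = 0" using z by simp
        then show ?thesis using p(1) alg_int_def by blast
      qed
      ultimately show ?thesis by simp
    qed
    have "coeff q i \<in> \<int> \<and> norm (coeff q i) \<le> 2 ^ n" for i
    proof -
      have "alg_int (coeff q i)" "norm (coeff q i) \<le> 2 ^ degree q"
        using monic_poly_coeffs_bounded[OF q'(2) roots] by auto
      moreover have "(2::real) ^ degree q \<le> 2 ^ n" using deg by simp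
      \<comment> \<open>A rational algebraic integer is an integer.\<close>
      ultimately show ?thesis using polD[OF q'(1)] alg_int_Rats_imp_Ints by (meson order_trans)
    qed
    moreover have "q \<noteq> 0" using q'(2) by auto
    ultimately show ?thesis using deg q'(3) by (auto simp: \<P>_def)
  qed
  have "range (\<lambda>k. u ^ k) \<subseteq> (\<Union>q\<in>\<P> - {0}. {z. poly q z = 0})" using root by blast
  moreover have "finite (\<Union>q\<in>\<P> - {0}. {z. poly q z = 0})"
    using finite_bounded_int_polys[of n "2 ^ n"] by (auto simp: \<P>_def poly_roots_finite)
  ultimately have "finite (range (\<lambda>k. u ^ k))" by (rule finite_subset)
  then have "\<not> inj (\<lambda>k. u ^ k)" using finite_imageD infinite_UNIV_nat by blast
  then obtain i j where ij: "u ^ i = u ^ j" "i < j" by (metis linorder_injI)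
  have "embedding F id" by (simp add: embedding_def)
  then have "u \<noteq> 0" using norm[of id] by auto
  have "u ^ i * u ^ (j - i) = u ^ (i + (j - i))" by (simp only: power_add)
  also have "\<dots> = u ^ i * 1" using ij by simp
  finally have "u ^ i * u ^ (j - i) = u ^ i * 1" .
  then have "u ^ (j - i) = 1" using \<open>u \<noteq> 0\<close> by (simp del: mult_1_right)
  then show ?thesis using ij by (intro exI[of _ "j - i"]) simp
qed

end

section \<open>CM-fields\<close>

text \<open>What is kept of a CM-field. \<open>emb_cnj\<close> carries the content of the conditions
  on all embeddings, and \<open>ex_imaginary\<close> rules out \<open>L = K\<close>.\<close>

locale cm_ctx = L: number_field_ctx L + K: number_field_ctx K for L K :: "complex set" +
  assumes K_eq: "K = {x \<in> L. cnj x = x}"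
    and cnj_in: "x \<in> L \<Longrightarrow> cnj x \<in> L"
    and emb_cnj: "embedding L s \<Longrightarrow> x \<in> L \<Longrightarrow> s (cnj x) = cnj (s x)"
    and ex_imaginary: "\<exists>b\<in>L. b \<noteq> 0 \<and> cnj b = - b"

lemma real_imp_cnj_eq: "(x::complex) \<in> \<real> \<Longrightarrow> cnj x = x"
  by (simp add: Reals_cnj_iff)

lemma square_real_imp_imaginary:
  assumes "(x::complex)\<^sup>2 \<in> \<real>" "x \<notin> \<real>"
  shows "cnj x = - x"
proof -
  have "(cnj x)\<^sup>2 = x\<^sup>2" using assms(1) by (simp add: Reals_cnj_iff)
  then show ?thesis using assms(2) by (auto simp: power2_eq_iff Reals_cnj_iff)
qed

text \<open>Every element is u + v b with u, v in \<open>K\<close> and b^2 in \<open>K\<close>. Each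
  embedding makes u and v real and b purely imaginary, so conjugation is always u + v b to u - v b.
  This gives commutation with embeddings, and it identifies the given real subfield with the maximal
  one.\<close>

lemma CM_field_cm_ctx:
  assumes "CM_field L"
  shows "cm_ctx L (max_real_subfield L)"
proof -
  obtain K where L: "number_field L" "totally_complex L" and K: "number_field K" "totally_real K" "quadratic_ext K L"
    using assms by (auto simp: CM_field_def)
  interpret L: number_field_ctx L using L by (simp add: number_field_iff_ctx)
  interpret K: number_field_ctx K using K by (simp add: number_field_iff_ctx)
  obtain b0 where b0: "K \<subseteq> L" "b0 \<in> L" "b0 \<notin> K" "L = adjoin K b0"
    using K(3) by (auto simp: quadratic_ext_def)
  have emb_K: "embedding K s" if "embedding L s" for s
    using that b0(1) by (auto simp: embedding_def)
  have real: "s x \<in> \<real>" if "embedding L s" "x \<in> K" for s x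
    using K(2) emb_K[OF that(1)] that(2) unfolding totally_real_def by blast
  have id_emb: "embedding L (\<lambda>x. x)" by (simp add: embedding_def)
  have realK: "x \<in> \<real>" if "x \<in> K" for x using real[OF id_emb that] .
  have "b0\<^sup>2 \<in> L" using b0(2) L.power_in by blast
  then obtain x y where xy: "x \<in> K" "y \<in> K" "b0\<^sup>2 = x + y * b0" using b0(4) by (auto simp: adjoin_def)
  \<comment> \<open>Completing the square in b0^2 = x + y b0.\<close>
  define b where "b = b0 - y / 2"
  have y2: "y / 2 \<in> K" using K.divide_in[OF xy(2) K.of_nat_in[of 2]] by simp
  have "b\<^sup>2 = x + (y / 2)\<^sup>2" using xy(3) by (simp add: b_def power2_eq_square algebra_simps)
  then have b2: "b\<^sup>2 \<in> K" using xy y2 by (simp add: K.add_in K.power_in)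
  have bL: "b \<in> L" unfolding b_def using b0 y2 by (intro L.diff_in) auto
  have decomp: "\<exists>u\<in>K. \<exists>v\<in>K. z = u + v * b" if z: "z \<in> L" for z
  proof -
    obtain u v where uv: "u \<in> K" "v \<in> K" "z = u + v * b0" using z b0(4) by (auto simp: adjoin_def)
    then have "z = (u + v * (y / 2)) + v * b" by (simp add: b_def algebra_simps)
    moreover have "u + v * (y / 2) \<in> K" using uv y2 by (intro K.add_in K.mult_in)
    ultimately show ?thesis using uv by blast
  qed
  \<comment> \<open>The square of \<open>s b\<close> is real. If \<open>s b\<close> were real too,
    the image of \<open>L\<close> would be real, against total complexity.\<close>
  have imag: "cnj (s b) = - s b" if s: "embedding L s" for s
  proof (rule square_real_imp_imaginary)
    interpret embedding_ctx L s using s by unfold_locales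
    have "(s b)\<^sup>2 = s (b\<^sup>2)" using emb_power[OF bL] by simp
    then show "(s b)\<^sup>2 \<in> \<real>" using real[OF s b2] by simp
    show "s b \<notin> \<real>"
    proof
      assume sb: "s b \<in> \<real>"
      have "s z \<in> \<real>" if z: "z \<in> L" for z
      proof -
        obtain u v where uv: "u \<in> K" "v \<in> K" "z = u + v * b" using decomp[OF z] by blast
        then have "s z = s u + s v * s b" using b0(1) bL by (simp add: emb_add emb_mult L.mult_in subsetD)
        then show ?thesis using real[OF s] uv sb by simp
      qed
      then show False using L(2) s unfolding totally_complex_def by blast
    qed
  qed
  have cnjb: "cnj b = - b" using imag[OF id_emb] .
  have "b \<noteq> 0"
  proof
    assume "b = 0"
    then have "b0 = y / 2" by (simp add: b_def)
    then show False using y2 b0(3) by metis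
  qed
  have K_eq: "K = {x \<in> L. cnj x = x}"
  proof (intro equalityI subsetI)
    fix z assume "z \<in> {x \<in> L. cnj x = x}"
    then have z: "z \<in> L" "cnj z = z" by auto
    then obtain u v where uv: "u \<in> K" "v \<in> K" "z = u + v * b" using decomp by blast
    then have "cnj z = u - v * b" using realK cnjb by (simp add: real_imp_cnj_eq)
    then have "u - v * b = u + v * b" using z(2) uv(3) by metis
    then have "v * b = 0" by (auto simp: diff_eq_eq)
    then show "z \<in> K" using uv \<open>b \<noteq> 0\<close> by simp
  qed (use b0 realK real_imp_cnj_eq in auto)
  have "cm_ctx L K"
  proof
    show "K = {x \<in> L. cnj x = x}" by (rule K_eq)
    show "\<exists>b\<in>L. b \<noteq> 0 \<and> cnj b = - b" using bL \<open>b \<noteq> 0\<close> cnjb by blast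
    fix z assume z: "z \<in> L"
    then obtain u v where uv: "u \<in> K" "v \<in> K" "z = u + v * b" using decomp by blast
    then have uvL: "u \<in> L" "v \<in> L" using b0(1) by auto
    have cnjz: "cnj z = u - v * b" using uv realK cnjb by (simp add: real_imp_cnj_eq)
    then show "cnj z \<in> L" using uvL bL by (simp add: L.diff_in L.mult_in)
    fix s assume s: "embedding L s"
    interpret embedding_ctx L s using s by unfold_locales
    have sz: "s z = s u + s v * s b" using uv(3) uvL bL by (simp add: emb_add emb_mult L.mult_in)
    have "s (cnj z) = s (u + - (v * b))" by (simp add: cnjz)
    also have "\<dots> = s u - s v * s b"
      using uvL bL by (simp add: emb_add emb_mult emb_minus L.mult_in L.minus_in del: add_uminus_conv_diff)
    also have "\<dots> = cnj (s z)"
      using sz real[OF s uv(1)] real[OF s uv(2)] imag[OF s] by (simp add: real_imp_cnj_eq)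
    finally show "s (cnj z) = cnj (s z)" .
  qed
  moreover have "K = max_real_subfield L" using K_eq by (simp add: max_real_subfield_def)
  ultimately show ?thesis by simp
qed

context cm_ctx
begin

section \<open>Roots of unity in the CM-field\<close>

abbreviation "W \<equiv> roots_of_unity L"

lemma K_sub: "K \<subseteq> L" and K_cnj: "x \<in> K \<Longrightarrow> cnj x = x" and K_I: "x \<in> L \<Longrightarrow> cnj x = x \<Longrightarrow> x \<in> K"
  using K_eq by auto

lemma OK_K_sub: "x \<in> OK K \<Longrightarrow> x \<in> OK L"
  using K_sub by (auto simp: OK_def)

lemma OK_K_I: "x \<in> OK L \<Longrightarrow> x \<in> K \<Longrightarrow> x \<in> OK K"
  by (auto simp: OK_def)

lemma OK_cnj: "x \<in> OK L \<Longrightarrow> cnj x \<in> OK L"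
  by (auto simp: OK_def alg_int_cnj cnj_in)

lemma W_OK:
  assumes "w \<in> W"
  shows "w \<in> OK L"
proof -
  obtain n :: nat where "w \<in> L" "n > 0" "w ^ n = 1" using assms by (auto simp: roots_of_unity_def)
  then show ?thesis using alg_int_of_power[of w n] by (simp add: OK_def)
qed

lemma W_nonzero: "w \<in> W \<Longrightarrow> w \<noteq> 0"
  unfolding roots_of_unity_def by (auto simp: power_0_left)

lemma W_1: "1 \<in> W"
  unfolding roots_of_unity_def by auto

lemma W_mult: "v \<in> W \<Longrightarrow> w \<in> W \<Longrightarrow> v * w \<in> W"
proof -
  assume "v \<in> W" "w \<in> W"
  then obtain m n :: nat where "v \<in> L" "w \<in> L" "m > 0" "n > 0" "v ^ m = 1" "w ^ n = 1"
    by (auto simp: roots_of_unity_def)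
  moreover from this have "(v * w) ^ (m * n) = 1"
    by (metis power_mult power_mult_distrib power_one mult.commute mult_1_left)
  ultimately show "v * w \<in> W"
    unfolding roots_of_unity_def by (auto intro!: L.mult_in exI[of _ "m * n"])
qed

lemma W_inverse: "w \<in> W \<Longrightarrow> inverse w \<in> W"
  unfolding roots_of_unity_def by (auto simp: power_inverse L.inverse_in)

lemma W_cnj:
  assumes "w \<in> W"
  shows "cnj w = inverse w"
proof -
  obtain n :: nat where "n > 0" "w ^ n = 1" using assms by (auto simp: roots_of_unity_def)
  then have "norm w ^ n = 1 ^ n" by (metis norm_one norm_power power_one)
  then have "norm w = 1" using \<open>n > 0\<close> by (metis norm_ge_zero power_eq_imp_eq_base zero_le_one)
  then have "w * cnj w = 1" by (simp add: complex_norm_square[symmetric])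
  then show ?thesis by (metis inverse_unique)
qed

text \<open>By \<open>emb_cnj\<close> the equation \<open>x * cnj x = 1\<close> carries over to
  every \<open>s x\<close>.\<close>

lemma unimodular_in_W:
  assumes "x \<in> OK L" "x * cnj x = 1"
  shows "x \<in> W"
proof -
  have "norm (s x) = 1" if s: "embedding L s" for s
  proof -
    interpret embedding_ctx L s using s by unfold_locales
    have x: "x \<in> L" using assms L.OK_in by blast
    have "s x * cnj (s x) = s (x * cnj x)" using x by (simp add: emb_mult cnj_in emb_cnj[OF s])
    then have "(of_real ((norm (s x))\<^sup>2) :: complex) = 1" using assms(2) complex_norm_square by simp
    then have "(norm (s x))\<^sup>2 = 1" by (simp only: of_real_eq_1_iff)
    then show ?thesis using norm_ge_zero power2_eq_1_iff by (metis neg_0_le_iff_le not_one_le_zero)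
  qed
  then obtain n :: nat where "n > 0" "x ^ n = 1" using L.kronecker_root_of_unity[OF assms(1)] by blast
  then show ?thesis using assms L.OK_in by (auto simp: roots_of_unity_def)
qed

section \<open>Extension of ideals to the CM-field\<close>

lemma subset_OK_L: "is_ideal K I \<Longrightarrow> I \<subseteq> OK L"
  using K.ideal_subset_OK OK_K_sub by blast

lemma is_ideal_ext: "is_ideal K I \<Longrightarrow> is_ideal L (ideal_gen L I)"
  by (rule L.is_ideal_ideal_gen) (rule subset_OK_L)

lemma pideal_divide_iff: "c \<noteq> 0 \<Longrightarrow> x \<in> pideal F c \<longleftrightarrow> x / c \<in> OK F"
  unfolding pideal_def by (auto simp: image_iff intro!: bexI[of _ "x / c"])

text \<open>Choose I J = (c) in O_K. Every element x of the extended ideal has x J inside c O_L; for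
  x in \<open>K\<close>, integrality of the quotients over \<open>L\<close> is integrality over
  \<open>K\<close>, so x J lies in c O_K = I J, and \<open>J\<close> cancels.\<close>

lemma ext_contract:
  assumes I: "nz_ideal K I" and x: "x \<in> ideal_gen L I" "x \<in> K"
  shows "x \<in> I"
proof -
  note idI = K.nz_idealD[OF I]
  obtain J c where J: "is_ideal K J" "c \<in> OK K" "c \<noteq> 0" "ideal_mult K I J = pideal K c"
    using K.nz_ideal_invertible[OF I] by blast
  let ?T = "L.colon (pideal L c) J"
  have cL: "c \<in> OK L" using J OK_K_sub by blast
  have T: "is_ideal L ?T" using L.is_ideal_colon[OF L.is_ideal_pideal[OF cL]] .
  have "I \<subseteq> ?T"
  proof
    fix i assume i: "i \<in> I"
    have "i * j \<in> pideal L c" if "j \<in> J" for j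
    proof -
      have "i * j \<in> pideal K c" using K.ideal_mult_mem[OF i that] J by simp
      then show ?thesis using OK_K_sub by (auto simp: pideal_divide_iff[OF J(3)])
    qed
    then show "i \<in> ?T" using subset_OK_L[OF idI] i by (auto simp: L.colon_def)
  qed
  then have "x \<in> ?T" using L.ideal_gen_least[OF T] x by blast
  then have xT: "x \<in> OK L" "\<And>j. j \<in> J \<Longrightarrow> x * j \<in> pideal L c" by (auto simp: L.colon_def)
  have xK: "x \<in> OK K" using OK_K_I xT x by blast
  have "j * x \<in> pideal K c" if "j \<in> J" for j
  proof -
    have "j \<in> K" using that J K.ideal_OK K.OK_in by blast
    then have "x * j / c \<in> K" using x J K.OK_in by (simp add: K.divide_in K.mult_in)
    then have "x * j / c \<in> OK K" using xT(2)[OF that] OK_K_I by (simp add: pideal_divide_iff[OF J(3)])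
    then show ?thesis by (simp add: pideal_divide_iff[OF J(3)] mult.commute)
  qed
  then have "j * y \<in> pideal K c" if "j \<in> J" "y \<in> pideal K x" for j y
    using that K.ideal_mult_right[OF K.is_ideal_pideal[OF J(2)]] unfolding pideal_def[of K x]
    by (auto simp flip: mult.assoc)
  then have "ideal_mult K J (pideal K x) \<subseteq> ideal_mult K J I"
    unfolding K.ideal_mult_commute[of J I] J(4)
    by (intro K.ideal_mult_least K.is_ideal_pideal J)
  moreover have "nz_ideal K J"
    using K.nz_ideal_superset[OF K.nz_ideal_pideal[OF J(2,3)] J(1)] K.ideal_mult_subset_left[OF J(1) idI] J(4)
    by (simp add: K.ideal_mult_commute)
  ultimately have "pideal K x \<subseteq> I"
    using K.ideal_mult_cancel_subset K.is_ideal_pideal[OF xK] idI by blast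
  then show ?thesis using K.pideal_self by blast
qed

lemma ext_inj:
  assumes "nz_ideal K I" "nz_ideal K J" "ideal_gen L I = ideal_gen L J"
  shows "I = J"
proof -
  have "I \<subseteq> J" if "nz_ideal K I" "nz_ideal K J" "ideal_gen L I = ideal_gen L J" for I J
    using ext_contract[OF that(2)] L.ideal_gen_superset[of I] that K.nz_idealD K.ideal_OK K.OK_in by blast
  then show ?thesis using assms by blast
qed

lemma ext_scale:
  assumes y: "y \<in> OK L" "y \<noteq> 0" and I: "is_ideal K I" "\<And>i. i \<in> I \<Longrightarrow> y * i \<in> OK L"
  shows "ideal_gen L ((\<lambda>x. y * x) ` I) = (\<lambda>x. y * x) ` ideal_gen L I"
proof (rule antisym)
  have "is_ideal L ((\<lambda>x. y * x) ` ideal_gen L I)"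
    by (rule L.is_ideal_scale[OF is_ideal_ext[OF I(1)]])
       (use y L.ideal_OK[OF is_ideal_ext[OF I(1)]] L.OK_mult in auto)
  then show "ideal_gen L ((\<lambda>x. y * x) ` I) \<subseteq> (\<lambda>x. y * x) ` ideal_gen L I"
    by (rule L.ideal_gen_least) (use L.ideal_gen_superset[of I] in blast)
  let ?X = "ideal_gen L ((\<lambda>x. y * x) ` I)"
  have X: "is_ideal L ?X" by (rule L.is_ideal_ideal_gen) (use I in auto)
  have "I \<subseteq> L.colon ?X {y}"
    using L.ideal_gen_superset[of "(\<lambda>x. y * x) ` I"] subset_OK_L[OF I(1)]
    by (auto simp: L.colon_def mult.commute)
  then have "ideal_gen L I \<subseteq> L.colon ?X {y}" by (rule L.ideal_gen_least[OF L.is_ideal_colon[OF X]])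
  then show "(\<lambda>x. y * x) ` ideal_gen L I \<subseteq> ?X"
    by (auto simp: L.colon_def mult.commute)
qed

text \<open>Two passes through ideal quotients, one for each factor.\<close>

lemma ext_mult:
  assumes I: "is_ideal K I" and J: "is_ideal K J" and xy: "x \<in> ideal_gen L I" "y \<in> ideal_gen L J"
  shows "x * y \<in> ideal_gen L (ideal_mult K I J)"
proof -
  let ?X = "ideal_gen L (ideal_mult K I J)"
  have X: "is_ideal L ?X" using is_ideal_ext I J by simp
  have "I \<subseteq> L.colon ?X J"
    using K.ideal_mult_mem L.ideal_gen_superset subset_OK_L[OF I] by (fastforce simp: L.colon_def)
  then have "ideal_gen L I \<subseteq> L.colon ?X J" by (rule L.ideal_gen_least[OF L.is_ideal_colon[OF X]])
  then have "j * i \<in> ?X" if "j \<in> J" "i \<in> ideal_gen L I" for i j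
    using that by (auto simp: L.colon_def mult.commute[of j i])
  then have "J \<subseteq> L.colon ?X (ideal_gen L I)"
    using subset_OK_L[OF J] by (auto simp: L.colon_def)
  then have "ideal_gen L J \<subseteq> L.colon ?X (ideal_gen L I)"
    by (rule L.ideal_gen_least[OF L.is_ideal_colon[OF X]])
  then show ?thesis using xy by (auto simp: L.colon_def mult.commute)
qed

text \<open>Elements of \<open>I\<close> are fixed by conjugation, so the extended ideal is stable
  under it and contains \<open>cnj \<beta>\<close>. This supplies the integrality hypothesis of
  \<open>real_up_to_theta\<close>.\<close>

lemma ext_principal_cnj:
  assumes I: "nz_ideal K I" and \<beta>: "\<beta> \<in> OK L" "ideal_gen L I = pideal L \<beta>"
  shows "\<beta> \<noteq> 0" and "\<beta> / cnj \<beta> \<in> OK L"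
proof -
  note idI = K.nz_idealD[OF I]
  show nz: "\<beta> \<noteq> 0"
  proof
    assume "\<beta> = 0"
    then have "I \<subseteq> {0}" using L.ideal_gen_superset[of I] \<beta>(2) by (auto simp: pideal_def)
    then show False using K.nz_ideal_nonzero[OF I] by blast
  qed
  let ?T = "{x \<in> OK L. cnj x \<in> pideal L \<beta>}"
  have P: "is_ideal L (pideal L \<beta>)" using L.is_ideal_pideal[OF \<beta>(1)] .
  have "is_ideal L ?T"
    by (rule L.is_idealI)
       (use P in \<open>auto simp: L.ideal_0 L.OK_add L.OK_mult L.ideal_add L.ideal_mult_left OK_cnj\<close>)
  moreover have "I \<subseteq> ?T"
  proof
    fix i assume i: "i \<in> I"
    then have "i \<in> K" using idI K.ideal_OK K.OK_in by blast
    then show "i \<in> ?T" using i subset_OK_L[OF idI] L.ideal_gen_superset[of I] \<beta>(2) by (auto simp: K_cnj)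
  qed
  ultimately have "pideal L \<beta> \<subseteq> ?T" using L.ideal_gen_least \<beta>(2) by metis
  then have "cnj \<beta> \<in> pideal L \<beta>" using L.pideal_self by blast
  then have "cnj \<beta> / \<beta> \<in> OK L" using pideal_divide_iff[OF nz] by blast
  then have "cnj (cnj \<beta> / \<beta>) \<in> OK L" by (rule OK_cnj)
  then show "\<beta> / cnj \<beta> \<in> OK L" by simp
qed

lemma pideal_unit_mult:
  assumes "s \<in> W"
  shows "pideal L (s * c) = pideal L c"
proof -
  have s: "s \<noteq> 0" "s \<in> OK L" "inverse s \<in> OK L"
    using assms W_nonzero W_OK W_inverse by auto
  show ?thesis
  proof (cases "c = 0")
    case False
    have "x / (s * c) \<in> OK L \<longleftrightarrow> x / c \<in> OK L" for x
    proof
      assume "x / (s * c) \<in> OK L"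
      then have "s * (x / (s * c)) \<in> OK L" using s L.OK_mult by blast
      then show "x / c \<in> OK L" using s by simp
    next
      assume "x / c \<in> OK L"
      then have "inverse s * (x / c) \<in> OK L" using s L.OK_mult by blast
      then show "x / (s * c) \<in> OK L" by (simp add: field_simps)
    qed
    then show ?thesis using s False by (intro set_eqI) (simp add: pideal_divide_iff)
  qed simp
qed

lemma ext_principal_real:
  assumes I: "nz_ideal K I" and c: "c \<in> K" "c \<noteq> 0" and ext: "ideal_gen L I = pideal L c"
  shows "c \<in> OK K" "I = pideal K c"
proof -
  note idI = K.nz_idealD[OF I]
  have "c \<in> I" using ext_contract[OF I _ c(1)] ext L.pideal_self by blast
  then show cO: "c \<in> OK K" using idI K.ideal_OK by blast
  show "I = pideal K c"
  proof
    show "pideal K c \<subseteq> I" using K.pideal_subset_iff[OF idI cO] \<open>c \<in> I\<close> by blast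
    show "I \<subseteq> pideal K c"
    proof
      fix i assume i: "i \<in> I"
      then have "i \<in> K" using idI K.ideal_OK K.OK_in by blast
      moreover have "i \<in> pideal L c" using i L.ideal_gen_superset[of I] ext by blast
      ultimately show "i \<in> pideal K c"
        using c OK_K_I K.divide_in by (simp add: pideal_divide_iff)
    qed
  qed
qed

lemma ext_OK: "ideal_gen L (OK K) = OK L"
  by (rule L.ideal_eq_OK[OF is_ideal_ext]) (use L.ideal_gen_superset[of "OK K"] K.OK_1 in auto)

lemma ext_pideal:
  assumes "c \<in> OK K" "c \<noteq> 0"
  shows "ideal_gen L (pideal K c) = pideal L c"
  unfolding pideal_def
  by (subst ext_scale) (use assms OK_K_sub ext_OK L.OK_mult in auto)

lemma ext_mult_principal:
  assumes I: "is_ideal K I" "ideal_gen L I = pideal L x" and J: "is_ideal K J" "ideal_gen L J = pideal L y"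
    and xy: "x \<in> OK L" "y \<in> OK L"
  shows "ideal_gen L (ideal_mult K I J) = pideal L (x * y)"
proof (rule antisym)
  have P: "is_ideal L (pideal L (x * y))" using L.is_ideal_pideal xy L.OK_mult by blast
  let ?X = "ideal_gen L (ideal_mult K I J)"
  have "x * y \<in> ?X" using ext_mult[OF I(1) J(1)] I J L.pideal_self by blast
  then show "pideal L (x * y) \<subseteq> ?X"
    using L.pideal_subset_iff[OF is_ideal_ext] I J xy by (simp add: L.OK_mult)
  have "ideal_mult K I J \<subseteq> pideal L (x * y) \<inter> OK K"
  proof (rule K.ideal_mult_least)
    show "is_ideal K (pideal L (x * y) \<inter> OK K)"
      by (rule K.is_idealI)
        (use P in \<open>auto simp: L.ideal_0 L.ideal_add K.OK_add K.OK_mult L.ideal_mult_left OK_K_sub\<close>)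
    fix a b assume ab: "a \<in> I" "b \<in> J"
    then have "a \<in> pideal L x" "b \<in> pideal L y" using I J L.ideal_gen_superset by blast+
    then obtain u v where "u \<in> OK L" "v \<in> OK L" "a = x * u" "b = y * v" by (auto simp: pideal_def)
    then have "a * b \<in> pideal L (x * y)"
      unfolding pideal_def by (intro image_eqI[of _ _ "u * v"]) (auto simp: L.OK_mult)
    then show "a * b \<in> pideal L (x * y) \<inter> OK K"
      using ab I J K.ideal_OK K.OK_mult by blast
  qed
  then show "?X \<subseteq> pideal L (x * y)" by (intro L.ideal_gen_least[OF P]) auto
qed

lemma imaginary_quadratic:
  assumes b: "b \<in> L" "b \<noteq> 0" "cnj b = - b"
  shows "b\<^sup>2 \<in> K" "L = adjoin K b"
proof -
  show "b\<^sup>2 \<in> K" using b by (intro K_I L.power_in) auto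
  show "L = adjoin K b"
  proof (intro equalityI subsetI)
    fix x assume x: "x \<in> L"
    have two: "2 \<in> L" using L.of_nat_in[of 2] by simp
    have "(x + cnj x) / 2 \<in> K" "(x - cnj x) / (2 * b) \<in> K"
      using x b two by (auto intro!: K_I L.divide_in L.add_in L.diff_in L.mult_in cnj_in simp: field_simps)
    moreover have "x = (x + cnj x) / 2 + (x - cnj x) / (2 * b) * b" using b(2) by (simp add: field_simps)
    ultimately show "x \<in> adjoin K b" unfolding adjoin_def by blast
  next
    fix x assume "x \<in> adjoin K b"
    then show "x \<in> L" using b K_sub by (auto simp: adjoin_def intro!: L.add_in L.mult_in)
  qed
qed

text \<open>Together with the preceding lemma: the square roots that generate \<open>L\<close> over
  \<open>K\<close> are exactly the nonzero elements of \<open>L\<close> negated by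
  conjugation.\<close>

lemma generator_imaginary:
  assumes "b \<in> L" "b\<^sup>2 \<in> K" "L = adjoin K b"
  shows "cnj b = - b" "b \<noteq> 0"
proof -
  have "b \<notin> K"
  proof
    assume "b \<in> K"
    then have "L \<subseteq> K" using assms(3) by (auto simp: adjoin_def intro: K.add_in K.mult_in)
    moreover obtain d where d: "d \<in> L" "d \<noteq> 0" "cnj d = - d" using ex_imaginary by blast
    ultimately have "- d = d" using K_cnj[of d] by auto
    then show False using d(2) by simp
  qed
  then have "cnj b \<noteq> b" using K_I assms by blast
  moreover have "(cnj b)\<^sup>2 = b\<^sup>2" using K_cnj[OF assms(2)] by simp
  ultimately show "cnj b = - b" by (auto simp: power2_eq_iff)
  show "b \<noteq> 0" using \<open>b \<notin> K\<close> K.zero_in by blast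
qed

section \<open>The unit index as a number of cosets\<close>

lemma units_iff: "x \<in> units F \<longleftrightarrow> x \<in> OK F \<and> x \<noteq> 0 \<and> inverse x \<in> OK F"
  by (auto simp: units_def)

definition "unit_products = {w * e | w e. w \<in> W \<and> e \<in> units K}"

lemma unit_products_I: "w \<in> W \<Longrightarrow> e \<in> units K \<Longrightarrow> w * e \<in> unit_products"
  by (auto simp: unit_products_def)

lemma unit_products_mult_closed: "x \<in> unit_products \<Longrightarrow> y \<in> unit_products \<Longrightarrow> x * y \<in> unit_products"
proof -
  assume "x \<in> unit_products" "y \<in> unit_products"
  then obtain w e w' e' where *: "w \<in> W" "e \<in> units K" "w' \<in> W" "e' \<in> units K" "x = w * e" "y = w' * e'"
    by (auto simp: unit_products_def)
  then have "e * e' \<in> units K" by (auto simp: units_iff K.OK_mult)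
  moreover have "x * y = (w * w') * (e * e')" using * by simp
  ultimately show "x * y \<in> unit_products" using * unit_products_I[OF W_mult] by metis
qed

lemma unit_products_inverse: "x \<in> unit_products \<Longrightarrow> inverse x \<in> unit_products"
proof -
  assume "x \<in> unit_products"
  then obtain w e where *: "w \<in> W" "e \<in> units K" "x = w * e" by (auto simp: unit_products_def)
  then have "inverse e \<in> units K" by (auto simp: units_iff)
  then show "inverse x \<in> unit_products" using * unit_products_I[OF W_inverse] by simp
qed

lemma unit_products_nonzero: "x \<in> unit_products \<Longrightarrow> x \<noteq> 0"
  by (auto simp: unit_products_def units_iff W_nonzero)

lemma unit_products_1: "1 \<in> unit_products"
  using unit_products_I[OF W_1, of 1] by (simp add: units_iff)

lemma unit_products_coset: "x \<in> unit_products \<Longrightarrow> (\<lambda>h. x * h) ` unit_products = unit_products"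
proof
  assume x: "x \<in> unit_products"
  show "(\<lambda>h. x * h) ` unit_products \<subseteq> unit_products" using x unit_products_mult_closed by blast
  show "unit_products \<subseteq> (\<lambda>h. x * h) ` unit_products"
  proof
    fix h assume "h \<in> unit_products"
    then have "inverse x * h \<in> unit_products" using x unit_products_inverse unit_products_mult_closed by blast
    moreover have "h = x * (inverse x * h)" using unit_products_nonzero[OF x] by simp
    ultimately show "h \<in> (\<lambda>h. x * h) ` unit_products" by blast
  qed
qed

lemma hasse_Q_eq: "hasse_Q K L = card ((\<lambda>x. (\<lambda>h. x * h) ` unit_products) ` units L)"
  by (simp add: hasse_Q_def unit_products_def Let_def)

lemma one_unit: "1 \<in> units L"
  by (simp add: units_iff)

lemma hasse_Q_eq_1:
  assumes "units L \<subseteq> unit_products"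
  shows "hasse_Q K L = 1"
proof -
  have "(\<lambda>x. (\<lambda>h. x * h) ` unit_products) ` units L = (\<lambda>x. unit_products) ` units L"
    by (rule image_cong) (use assms unit_products_coset in blast)+
  also have "\<dots> = {unit_products}" using one_unit by blast
  finally have "(\<lambda>x. (\<lambda>h. x * h) ` unit_products) ` units L = {unit_products}" .
  then show ?thesis by (simp add: hasse_Q_eq)
qed

lemma hasse_Q_eq_2:
  assumes e: "e \<in> units L" "e \<notin> unit_products" and "\<And>u. u \<in> units L \<Longrightarrow> u \<notin> unit_products \<Longrightarrow> \<exists>h\<in>unit_products. u = e * h"
  shows "hasse_Q K L = 2"
proof -
  let ?c = "\<lambda>x. (\<lambda>h. x * h) ` unit_products"
  have "?c u = unit_products \<or> ?c u = ?c e" if u: "u \<in> units L" for u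
  proof (cases "u \<in> unit_products")
    case False
    then obtain h where h: "h \<in> unit_products" "u = e * h" using assms(3) u by blast
    have "?c u = (\<lambda>x. e * x) ` ?c h" unfolding h(2) image_image by (simp add: mult.assoc)
    then show ?thesis using unit_products_coset[OF h(1)] by simp
  qed (use unit_products_coset in blast)
  moreover have "?c 1 = unit_products" by simp
  ultimately have "?c ` units L = {unit_products, ?c e}" using e(1) one_unit by blast
  moreover have "e \<in> ?c e" using unit_products_1 by force
  then have "unit_products \<noteq> ?c e" using e(2) by blast
  ultimately show ?thesis by (simp add: hasse_Q_eq)
qed

section \<open>Ideal classes\<close>

lemma ideal_equiv_sym: "ideal_equiv K I J \<Longrightarrow> ideal_equiv K J I"
  unfolding ideal_equiv_def by metis

lemma ideal_equiv_trans:
  assumes "ideal_equiv K I J" "ideal_equiv K J M"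
  shows "ideal_equiv K I M"
proof -
  obtain x y where xy: "x \<in> OK K" "y \<in> OK K" "x \<noteq> 0" "y \<noteq> 0" "(\<lambda>i. x * i) ` I = (\<lambda>j. y * j) ` J"
    using assms(1) unfolding ideal_equiv_def by blast
  obtain u v where uv: "u \<in> OK K" "v \<in> OK K" "u \<noteq> 0" "v \<noteq> 0" "(\<lambda>i. u * i) ` J = (\<lambda>j. v * j) ` M"
    using assms(2) unfolding ideal_equiv_def by blast
  have "(\<lambda>i. (u * x) * i) ` I = (\<lambda>i. u * i) ` (\<lambda>i. x * i) ` I" by (simp add: image_image mult.assoc)
  also have "\<dots> = (\<lambda>i. y * i) ` (\<lambda>i. u * i) ` J" unfolding xy(5) by (simp add: image_image mult.left_commute)
  also have "\<dots> = (\<lambda>j. (y * v) * j) ` M" unfolding uv(5) by (simp add: image_image mult.assoc)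
  finally show ?thesis unfolding ideal_equiv_def
    using xy uv by (intro bexI[of _ "u * x"] bexI[of _ "y * v"]) (auto simp: K.OK_mult)
qed

lemma ideal_class_eqI: "ideal_equiv K I J \<Longrightarrow> ideal_class K I = ideal_class K J"
  unfolding ideal_class_def using ideal_equiv_sym ideal_equiv_trans by blast

lemma ideal_class_scale:
  assumes "c \<in> K" "c \<noteq> 0"
  shows "ideal_class K ((\<lambda>x. c * x) ` I) = ideal_class K I"
proof -
  obtain x y where xy: "x \<in> OK K" "y \<in> OK K" "y \<noteq> 0" "c = x / y" using K.fraction[OF assms(1)] by blast
  have "x \<noteq> 0" using xy assms by auto
  have "(\<lambda>i. y * i) ` (\<lambda>x. c * x) ` I = (\<lambda>j. x * j) ` I" using xy by (simp add: image_image)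
  then have "ideal_equiv K ((\<lambda>x. c * x) ` I) I" unfolding ideal_equiv_def using xy \<open>x \<noteq> 0\<close> by blast
  then show ?thesis by (rule ideal_class_eqI)
qed

lemma trivial_classes_subset: "trivial_classes K \<subseteq> cap_kernel K L"
  unfolding trivial_classes_def cap_kernel_def principal_def
  using ext_OK K.nz_ideal_OK L.OK_1 L.pideal_1 by blast

end

section \<open>Units and capitulation\<close>

text \<open>Both parts of the theorem become instances. Since \<open>\<epsilon>\<close> is a root of
  unity, \<open>\<theta>\<^sup>2\<close> and \<open>\<delta>\<close> generate the same ideal of O_L.
  \<open>W_squares\<close> limits the possible quotients to two classes, and
  \<open>\<eta>_nonsquare\<close> makes the unit built in \<open>sqrt_ideal_principal\<close>
  nontrivial.\<close>

locale cm_theta_ctx = cm_ctx +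
  fixes \<theta> \<eta> \<delta> \<epsilon> :: complex
  assumes \<theta>: "\<theta> \<in> OK L" "\<theta> \<noteq> 0" and \<eta>: "\<eta> \<in> W" "\<theta> = \<eta> * cnj \<theta>"
    and \<delta>: "\<delta> \<in> OK K" and \<epsilon>: "\<epsilon> \<in> W" "\<theta>\<^sup>2 = \<epsilon> * \<delta>"
    and W_squares: "\<And>\<rho>. \<rho> \<in> W \<Longrightarrow> \<exists>s\<in>W. \<rho> = s\<^sup>2 \<or> \<rho> = \<eta> * s\<^sup>2"
    and \<eta>_nonsquare: "\<And>s. s \<in> W \<Longrightarrow> \<eta> \<noteq> s\<^sup>2"
begin

lemma \<delta>_nonzero: "\<delta> \<noteq> 0"
  using \<theta>(2) \<epsilon>(2) by auto

text \<open>As \<open>cnj s = inverse s\<close>, an element with \<beta> = s^2 cnj \<beta> becomes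
  fixed by conjugation after division by s; an extra factor \<eta> is absorbed by dividing by
  \<theta> as well.\<close>

lemma real_up_to_theta:
  assumes \<beta>: "\<beta> \<in> L" "\<beta> \<noteq> 0" "\<beta> / cnj \<beta> \<in> OK L"
  shows "\<exists>s\<in>W. \<exists>c\<in>K. c \<noteq> 0 \<and> (\<beta> = s * c \<or> \<beta> = s * (\<theta> * c))"
proof -
  define \<rho> where "\<rho> = \<beta> / cnj \<beta>"
  have "\<rho> * cnj \<rho> = 1" using \<beta>(2) by (simp add: \<rho>_def)
  then have "\<rho> \<in> W" using unimodular_in_W \<beta>(3) by (simp add: \<rho>_def)
  then obtain s where s: "s \<in> W" "\<rho> = s\<^sup>2 \<or> \<rho> = \<eta> * s\<^sup>2" using W_squares by blast
  have s0: "s \<noteq> 0" "s \<in> L" using s W_nonzero W_OK L.OK_in by auto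
  have \<beta>_eq: "\<beta> = \<rho> * cnj \<beta>" using \<beta>(2) by (simp add: \<rho>_def)
  from s(2) show ?thesis
  proof
    assume \<rho>: "\<rho> = s\<^sup>2"
    have "cnj (\<beta> / s) = cnj \<beta> * s" using W_cnj[OF s(1)] by (simp add: divide_inverse)
    also have "\<dots> = \<beta> / s" by (subst (2) \<beta>_eq) (use s0 in \<open>simp add: \<rho> power2_eq_square\<close>)
    finally have "\<beta> / s \<in> K" using K_I L.divide_in[OF \<beta>(1) s0(2)] by blast
    then show ?thesis using s s0 \<beta> by (intro bexI[of _ s] bexI[of _ "\<beta> / s"]) auto
  next
    assume \<rho>: "\<rho> = \<eta> * s\<^sup>2"
    have ct: "cnj \<theta> \<noteq> 0" using \<theta>(2) by simp
    have \<eta>0: "\<eta> \<noteq> 0" using W_nonzero \<eta>(1) by blast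
    have "cnj (\<beta> / (s * \<theta>)) = cnj \<beta> * s / cnj \<theta>" using W_cnj[OF s(1)] by (simp add: divide_inverse)
    also have "\<dots> = \<beta> / (s * \<theta>)"
      by (subst (2) \<beta>_eq, subst (2) \<eta>(2)) (use s0 ct \<eta>0 in \<open>simp add: \<rho> power2_eq_square field_simps\<close>)
    finally have "\<beta> / (s * \<theta>) \<in> K"
      using K_I L.divide_in[OF \<beta>(1) L.mult_in[OF s0(2) L.OK_in[OF \<theta>(1)]]] by blast
    then show ?thesis using s s0 \<beta> \<theta> by (intro bexI[of _ s] bexI[of _ "\<beta> / (s * \<theta>)"]) auto
  qed
qed

text \<open>B = I / c extends to \<theta> O_L, so B^2 and \<delta> O_K have the same extension. In
  detail, \<theta> in B O_L puts \<delta> = \<theta>^2 / \<epsilon> into the extension of B^2, and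
  contraction puts it into B^2; conversely a b / \<delta> = \<epsilon> (a/\<theta>) (b/\<theta>) is
  integral for a, b in B.\<close>

lemma sqrt_ideal_of_ext:
  assumes I: "nz_ideal K I" and c: "c \<in> K" "c \<noteq> 0" and ext: "ideal_gen L I = pideal L (\<theta> * c)"
  shows "\<exists>B. is_ideal K B \<and> pideal K \<delta> = ideal_mult K B B \<and> I = (\<lambda>x. c * x) ` B"
proof -
  note idI = K.nz_idealD[OF I]
  define B where "B = (\<lambda>x. inverse c * x) ` I"
  have quot: "i / (\<theta> * c) \<in> OK L" if "i \<in> I" for i
    using that L.ideal_gen_superset[of I] ext c \<theta> by (auto simp flip: pideal_divide_iff)
  have IK: "i \<in> K" if "i \<in> I" for i using that idI K.ideal_OK K.OK_in by blast
  have B_quot: "b / \<theta> \<in> OK L" "b \<in> OK K" if b: "b \<in> B" for b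
  proof -
    obtain i where i: "i \<in> I" "b = inverse c * i" using b by (auto simp: B_def)
    have "b / \<theta> = i / (\<theta> * c)" using i by (simp add: field_simps)
    then show "b / \<theta> \<in> OK L" using quot[OF i(1)] by simp
    then have "b / \<theta> * \<theta> \<in> OK L" using \<theta> L.OK_mult by blast
    then have "b \<in> OK L" using \<theta>(2) by simp
    moreover have "b \<in> K" using i IK c by (simp add: K.mult_in K.inverse_in)
    ultimately show "b \<in> OK K" using OK_K_I by blast
  qed
  have idB: "is_ideal K B" unfolding B_def
    by (rule K.is_ideal_scale[OF idI]) (use B_quot(2) in \<open>auto simp: B_def\<close>)
  have IcB: "I = (\<lambda>x. c * x) ` B" using c by (simp add: B_def image_image mult.assoc[symmetric])
  obtain i0 where i0: "i0 \<in> I" "i0 \<noteq> 0" using K.nz_ideal_nonzero[OF I] by blast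
  have nzB: "nz_ideal K B"
    by (rule K.nz_idealI[OF idB, of "inverse c * i0"]) (use i0 c in \<open>auto simp: B_def\<close>)
  \<comment> \<open>\<open>c\<close> may be fractional; clearing its denominator turns I = c B into
    y I = x B, where \<open>ext_scale\<close> applies to both sides.\<close>
  obtain x y where xy: "x \<in> OK K" "y \<in> OK K" "y \<noteq> 0" "c = x / y" using K.fraction[OF c(1)] by blast
  have x0: "x \<noteq> 0" using xy c by auto
  have "(\<lambda>z. y * z) ` I = (\<lambda>z. x * z) ` B" unfolding IcB image_image using xy by simp
  then have "(\<lambda>z. y * z) ` ideal_gen L I = (\<lambda>z. x * z) ` ideal_gen L B"
    using ext_scale[of y I] ext_scale[of x B] xy x0 idI idB OK_K_sub K.OK_mult K.ideal_OK by metis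
  moreover have "\<theta> * c \<in> ideal_gen L I" using ext L.pideal_self by simp
  ultimately have "y * (\<theta> * c) \<in> (\<lambda>z. x * z) ` ideal_gen L B" by blast
  moreover have "y * (\<theta> * c) = x * \<theta>" using xy by simp
  ultimately have "\<theta> \<in> ideal_gen L B" using x0 by auto
  then have "\<theta> * \<theta> \<in> ideal_gen L (ideal_mult K B B)" using ext_mult[OF idB idB] by blast
  moreover have "is_ideal L (ideal_gen L (ideal_mult K B B))" using is_ideal_ext idB by simp
  ultimately have "inverse \<epsilon> * (\<theta> * \<theta>) \<in> ideal_gen L (ideal_mult K B B)"
    using L.ideal_mult_left W_OK[OF W_inverse[OF \<epsilon>(1)]] by blast
  moreover have "inverse \<epsilon> * (\<theta> * \<theta>) = \<delta>"
    using \<epsilon>(2) W_nonzero[OF \<epsilon>(1)] by (simp add: power2_eq_square)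
  ultimately have "\<delta> \<in> ideal_mult K B B"
    using ext_contract[OF K.nz_ideal_mult[OF nzB nzB]] \<delta> K.OK_in by simp
  then have "pideal K \<delta> \<subseteq> ideal_mult K B B"
    using K.pideal_subset_iff[OF K.is_ideal_ideal_mult[OF idB idB] \<delta>] by blast
  moreover have "ideal_mult K B B \<subseteq> pideal K \<delta>"
  proof (rule K.ideal_mult_least[OF K.is_ideal_pideal[OF \<delta>]])
    fix a b assume ab: "a \<in> B" "b \<in> B"
    have "\<epsilon> * (a / \<theta> * (b / \<theta>)) \<in> OK L" using B_quot ab W_OK[OF \<epsilon>(1)] L.OK_mult by blast
    moreover have "\<epsilon> * (a / \<theta> * (b / \<theta>)) = a * b * (\<epsilon> / \<theta>\<^sup>2)" by (simp add: power2_eq_square)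
    moreover have "\<epsilon> / \<theta>\<^sup>2 = 1 / \<delta>" using \<epsilon>(2) W_nonzero[OF \<epsilon>(1)] by simp
    ultimately have "a * b / \<delta> \<in> OK L" by simp
    moreover have "a * b / \<delta> \<in> K"
      using B_quot(2) ab \<delta> K.OK_in by (intro K.divide_in K.mult_in) auto
    ultimately show "a * b \<in> pideal K \<delta>" using OK_K_I pideal_divide_iff[OF \<delta>_nonzero] by blast
  qed
  ultimately show ?thesis using idB IcB by blast
qed

text \<open>For a in A, the square of a / \<theta> is a^2 / (\<epsilon> \<delta>), hence integral,
  so A lies in \<theta> O_L. Conversely a b / \<theta> is a times the integer b / \<theta>, so A^2
  lies in \<theta> times the extension of A; its element \<delta> yields \<theta> = \<epsilon>
  \<delta> / \<theta>.\<close>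

lemma ext_sqrt_ideal:
  assumes A: "is_ideal K A" "pideal K \<delta> = ideal_mult K A A"
  shows "nz_ideal K A" "ideal_gen L A = pideal L \<theta>"
proof -
  have nzAA: "nz_ideal K (ideal_mult K A A)" using K.nz_ideal_pideal[OF \<delta> \<delta>_nonzero] A by simp
  show "nz_ideal K A"
    using K.nz_ideal_superset[OF nzAA A(1) K.ideal_mult_subset_left[OF A(1) A(1)]] .
  have quot: "a / \<theta> \<in> OK L" if a: "a \<in> A" for a
  proof -
    have aL: "a \<in> OK L" using a A subset_OK_L by blast
    have "a * a \<in> pideal K \<delta>" using K.ideal_mult_mem[OF a a] A by simp
    then have "a * a / \<delta> \<in> OK L" using OK_K_sub pideal_divide_iff[OF \<delta>_nonzero] by blast
    then have "inverse \<epsilon> * (a * a / \<delta>) \<in> OK L"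
      using L.OK_mult W_OK[OF W_inverse[OF \<epsilon>(1)]] by blast
    moreover have "inverse \<epsilon> * (a * a / \<delta>) = (a / \<theta>)\<^sup>2"
      using \<epsilon>(2) by (simp add: power_divide) (simp add: power2_eq_square divide_inverse)
    ultimately have "alg_int ((a / \<theta>)\<^sup>2)" using L.OK_alg_int by simp
    then have "alg_int (a / \<theta>)" using alg_int_of_power[of "a / \<theta>" 2] by simp
    then show ?thesis using aL \<theta> by (simp add: OK_def L.divide_in)
  qed
  have P: "is_ideal L (pideal L \<theta>)" using L.is_ideal_pideal[OF \<theta>(1)] .
  have X: "is_ideal L (ideal_gen L A)" using is_ideal_ext[OF A(1)] .
  have "ideal_mult K A A \<subseteq> {x \<in> OK K. x / \<theta> \<in> ideal_gen L A}"
  proof (rule K.ideal_mult_least)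
    have "r * x / \<theta> \<in> ideal_gen L A" if "r \<in> OK K" "x / \<theta> \<in> ideal_gen L A" for r x
      using L.ideal_mult_left[OF X OK_K_sub[OF that(1)] that(2)] by simp
    then show "is_ideal K {x \<in> OK K. x / \<theta> \<in> ideal_gen L A}"
      by (intro K.is_idealI)
        (use X in \<open>auto simp: L.ideal_0 L.ideal_add K.OK_add K.OK_mult add_divide_distrib\<close>)
    fix a b assume ab: "a \<in> A" "b \<in> A"
    have "b / \<theta> * a \<in> ideal_gen L A"
      using L.ideal_mult_left[OF X quot[OF ab(2)]] L.ideal_gen_superset ab(1) by blast
    then have "a * b / \<theta> \<in> ideal_gen L A" by (simp add: mult.commute)
    then show "a * b \<in> {x \<in> OK K. x / \<theta> \<in> ideal_gen L A}"
      using ab K.ideal_OK[OF A(1)] K.OK_mult by blast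
  qed
  moreover have "\<delta> \<in> ideal_mult K A A" using K.pideal_self A by metis
  ultimately have "\<delta> / \<theta> \<in> ideal_gen L A" by blast
  then have "\<epsilon> * (\<delta> / \<theta>) \<in> ideal_gen L A" using L.ideal_mult_left[OF X W_OK[OF \<epsilon>(1)]] by blast
  moreover have "\<epsilon> * (\<delta> / \<theta>) = \<theta>" using \<epsilon>(2) \<theta>(2) by (simp add: power2_eq_square field_simps)
  ultimately have "pideal L \<theta> \<subseteq> ideal_gen L A" using L.pideal_subset_iff[OF X \<theta>(1)] by simp
  moreover have "ideal_gen L A \<subseteq> pideal L \<theta>"
    by (rule L.ideal_gen_least[OF P]) (use quot pideal_divide_iff[OF \<theta>(2)] in blast)
  ultimately show "ideal_gen L A = pideal L \<theta>" by blast
qed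

text \<open>Both square roots extend to \<theta> O_L, and extension is injective.\<close>

lemma sqrt_ideal_unique:
  assumes "is_ideal K A" "pideal K \<delta> = ideal_mult K A A" "is_ideal K B" "pideal K \<delta> = ideal_mult K B B"
  shows "A = B"
  using ext_inj ext_sqrt_ideal[OF assms(1,2)] ext_sqrt_ideal[OF assms(3,4)] by simp

lemma capitulation_cases:
  assumes I: "nz_ideal K I" "principal L (ideal_gen L I)"
  shows "ideal_class K I = ideal_class K (OK K) \<or>
    (\<exists>B. is_ideal K B \<and> pideal K \<delta> = ideal_mult K B B \<and> ideal_class K I = ideal_class K B)"
proof -
  obtain \<beta> where \<beta>: "\<beta> \<in> OK L" "ideal_gen L I = pideal L \<beta>" using I(2) by (auto simp: principal_def)
  obtain s c where sc: "s \<in> W" "c \<in> K" "c \<noteq> 0" "\<beta> = s * c \<or> \<beta> = s * (\<theta> * c)"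
    using real_up_to_theta[OF L.OK_in[OF \<beta>(1)]] ext_principal_cnj[OF I(1) \<beta>] by blast
  from sc(4) show ?thesis
  proof
    assume "\<beta> = s * c"
    then have "ideal_gen L I = pideal L c" using \<beta>(2) pideal_unit_mult[OF sc(1)] by simp
    then have "I = (\<lambda>x. c * x) ` OK K" using ext_principal_real[OF I(1) sc(2,3)] by (simp add: pideal_def)
    then show ?thesis using ideal_class_scale[OF sc(2,3)] by simp
  next
    assume "\<beta> = s * (\<theta> * c)"
    then have "ideal_gen L I = pideal L (\<theta> * c)" using \<beta>(2) pideal_unit_mult[OF sc(1)] by simp
    then obtain B where "is_ideal K B" "pideal K \<delta> = ideal_mult K B B" "I = (\<lambda>x. c * x) ` B"
      using sqrt_ideal_of_ext[OF I(1) sc(2,3)] by blast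
    then show ?thesis using ideal_class_scale[OF sc(2,3)] by blast
  qed
qed

lemma unit_cases:
  assumes u: "u \<in> units L" "u \<notin> unit_products"
  shows "\<exists>s\<in>W. \<exists>c\<in>K. c \<noteq> 0 \<and> u = s * (\<theta> * c)"
proof -
  have u': "u \<in> OK L" "u \<noteq> 0" "inverse u \<in> OK L" using u by (auto simp: units_iff)
  have "u * cnj (inverse u) \<in> OK L" using u' L.OK_mult OK_cnj by blast
  then have "u / cnj u \<in> OK L" by (simp add: divide_inverse)
  then obtain s c where sc: "s \<in> W" "c \<in> K" "c \<noteq> 0" "u = s * c \<or> u = s * (\<theta> * c)"
    using real_up_to_theta[OF L.OK_in[OF u'(1)] u'(2)] by blast
  have "u \<noteq> s * c"
  proof
    assume us: "u = s * c"
    have s: "s \<noteq> 0" "s \<in> OK L" "inverse s \<in> OK L" using sc W_nonzero W_OK W_inverse by auto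
    have "inverse s * u \<in> OK L" "s * inverse u \<in> OK L" using s u' L.OK_mult by auto
    moreover have "inverse s * u = c" "s * inverse u = inverse c" using us s by auto
    ultimately have "c \<in> OK L" "inverse c \<in> OK L" by simp_all
    then have "c \<in> units K" using sc OK_K_I K.inverse_in by (simp add: units_iff)
    then show False using us u(2) unit_products_I sc(1) by blast
  qed
  then show ?thesis using sc by blast
qed

text \<open>A unit generates the extension of O_K itself, so \<open>sqrt_ideal_of_ext\<close> with I
  = O_K gives c B = O_K, and 1 / c generates B.\<close>

lemma nontrivial_unit_imp_principal:
  assumes u: "u \<in> units L" "u \<notin> unit_products"
  shows "\<exists>B. is_ideal K B \<and> pideal K \<delta> = ideal_mult K B B \<and> principal K B"
proof -
  obtain s c where sc: "s \<in> W" "c \<in> K" "c \<noteq> 0" "u = s * (\<theta> * c)" using unit_cases[OF u] by blast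
  have u': "u \<in> OK L" "u \<noteq> 0" "inverse u \<in> OK L" using u by (auto simp: units_iff)
  have "pideal L (\<theta> * c) = pideal L u" using pideal_unit_mult[OF sc(1)] sc(4) by simp
  also have "\<dots> = OK L"
  proof (rule L.ideal_eq_OK[OF L.is_ideal_pideal[OF u'(1)]])
    show "1 \<in> pideal L u" using u' by (simp add: pideal_divide_iff divide_inverse)
  qed
  finally have "ideal_gen L (OK K) = pideal L (\<theta> * c)" using ext_OK by simp
  then obtain B where B: "is_ideal K B" "pideal K \<delta> = ideal_mult K B B" "OK K = (\<lambda>x. c * x) ` B"
    using sqrt_ideal_of_ext[OF K.nz_ideal_OK sc(2,3)] by blast
  have "B = (\<lambda>x. inverse c * x) ` (\<lambda>x. c * x) ` B" using sc(3) by (simp add: image_image flip: mult.assoc)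
  then have Beq: "B = pideal K (inverse c)" using B(3) by (simp add: pideal_def)
  then have "inverse c \<in> B" using K.pideal_self by simp
  then have "inverse c \<in> OK K" using B(1) K.ideal_OK by blast
  then show ?thesis using B Beq principal_def by blast
qed

lemma no_sqrt_ideal:
  assumes "\<nexists>B. is_ideal K B \<and> pideal K \<delta> = ideal_mult K B B"
  shows "hasse_Q K L = 1" "cap_kernel K L = trivial_classes K"
proof -
  show "hasse_Q K L = 1"
    by (rule hasse_Q_eq_1) (use nontrivial_unit_imp_principal assms in blast)
  have "cap_kernel K L \<subseteq> trivial_classes K"
    using capitulation_cases assms by (auto simp: cap_kernel_def trivial_classes_def)
  then show "cap_kernel K L = trivial_classes K" using trivial_classes_subset by blast
qed

text \<open>If A = a O_K, then a and \<theta> generate the same ideal of O_L, so e = \<theta> / a is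
  a unit with e / cnj e = \<eta>. For e = w c with w in \<open>W\<close> and c real the quotient
  would be w^2. Any other nontrivial unit s \<theta> c equals e times s (a c).\<close>

lemma sqrt_ideal_principal:
  assumes A: "is_ideal K A" "pideal K \<delta> = ideal_mult K A A" and pr: "principal K A"
  shows "hasse_Q K L = 2"
proof -
  obtain a where a: "a \<in> OK K" "A = pideal K a" using pr by (auto simp: principal_def)
  have a0: "a \<noteq> 0"
  proof
    assume "a = 0"
    then have "A \<subseteq> {0}" using a by (auto simp: pideal_def)
    then show False using K.nz_ideal_nonzero[OF ext_sqrt_ideal(1)[OF A]] by blast
  qed
  have aK: "a \<in> K" "a \<in> L" using a K.OK_in OK_K_sub L.OK_in by auto
  have eq: "pideal L a = pideal L \<theta>" using ext_sqrt_ideal(2)[OF A] ext_pideal[OF a(1) a0] a(2) by simp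
  define e where "e = \<theta> / a"
  have "\<theta> \<in> pideal L a" "a \<in> pideal L \<theta>" using eq L.pideal_self by blast+
  then have e: "e \<in> units L"
    using a0 \<theta>(2) by (simp add: units_iff e_def pideal_divide_iff)
  have e_cnj: "e = \<eta> * cnj e"
    using \<eta>(2) K_cnj[OF aK(1)] by (simp add: e_def)
  have eH: "e \<notin> unit_products"
  proof
    assume "e \<in> unit_products"
    then obtain w c where wc: "w \<in> W" "c \<in> units K" "e = w * c" by (auto simp: unit_products_def)
    then have "cnj c = c" "c \<noteq> 0" using K_cnj K.OK_in by (auto simp: units_iff)
    then have "w * c = \<eta> * inverse w * c" using e_cnj wc W_cnj by simp
    then have "w = \<eta> * inverse w" using \<open>c \<noteq> 0\<close> by simp
    then have "\<eta> = w\<^sup>2" using W_nonzero[OF wc(1)] by (simp add: field_simps power2_eq_square)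
    then show False using \<eta>_nonsquare wc(1) by blast
  qed
  show ?thesis
  proof (rule hasse_Q_eq_2[OF e eH])
    fix u assume u: "u \<in> units L" "u \<notin> unit_products"
    obtain s c where sc: "s \<in> W" "c \<in> K" "c \<noteq> 0" "u = s * (\<theta> * c)" using unit_cases[OF u] by blast
    have s: "s \<noteq> 0" "s \<in> OK L" "inverse s \<in> OK L" using sc W_nonzero W_OK W_inverse by auto
    have "inverse s * u * inverse e \<in> OK L" "s * inverse u * e \<in> OK L"
      using s u e by (auto simp: units_iff intro!: L.OK_mult)
    moreover have "inverse s * u * inverse e = a * c" "s * inverse u * e = inverse (a * c)"
      using sc s a0 \<theta>(2) by (auto simp: e_def field_simps)
    ultimately have "a * c \<in> OK L" "inverse (a * c) \<in> OK L" by metis+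
    moreover have acK: "a * c \<in> K" using aK sc K.mult_in by blast
    ultimately have "a * c \<in> units K"
      using a0 sc(3) OK_K_I K.inverse_in[OF acK] unfolding units_iff by simp
    then have "s * (a * c) \<in> unit_products" using unit_products_I sc(1) by blast
    moreover have "u = e * (s * (a * c))" using sc a0 by (simp add: e_def)
    ultimately show "\<exists>h\<in>unit_products. u = e * h" by blast
  qed
qed

text \<open>A nontrivial unit would give a principal square root of \<delta> O_K, which uniqueness
  identifies with A. In the class group, A^n extends to the ideal generated by \<theta>^n, so all
  powers capitulate, while \<open>capitulation_cases\<close> leaves only the exponents 0 and
  1.\<close>

lemma sqrt_ideal_nonprincipal:
  assumes A: "is_ideal K A" "pideal K \<delta> = ideal_mult K A A" and pr: "\<not> principal K A"
  shows "hasse_Q K L = 1" "cap_kernel K L = cyclic_classes K A"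
proof -
  note nzA = ext_sqrt_ideal(1)[OF A] and extA = ext_sqrt_ideal(2)[OF A]
  show "hasse_Q K L = 1"
    by (rule hasse_Q_eq_1) (use nontrivial_unit_imp_principal sqrt_ideal_unique[OF A] pr in blast)
  show "cap_kernel K L = cyclic_classes K A"
  proof (rule antisym)
    have "ideal_class K (OK K) = ideal_class K (ideal_pow K A 0)" by simp
    moreover have "ideal_class K A = ideal_class K (ideal_pow K A 1)" using A(1) by simp
    ultimately have "ideal_class K (OK K) \<in> cyclic_classes K A" "ideal_class K A \<in> cyclic_classes K A"
      unfolding cyclic_classes_def by blast+
    moreover have "ideal_class K I = ideal_class K (OK K) \<or> ideal_class K I = ideal_class K A"
      if "nz_ideal K I" "principal L (ideal_gen L I)" for I
      using capitulation_cases[OF that] sqrt_ideal_unique[OF A] by metis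
    ultimately have "ideal_class K I \<in> cyclic_classes K A"
      if "nz_ideal K I" "principal L (ideal_gen L I)" for I
      using that by metis
    then show "cap_kernel K L \<subseteq> cyclic_classes K A"
      unfolding cap_kernel_def by blast
    have "ideal_gen L (ideal_pow K A n) = pideal L (\<theta> ^ n)" for n
    proof (induction n)
      case (Suc n)
      then show ?case using ext_mult_principal[OF A(1) extA _ Suc \<theta>(1) L.OK_power[OF \<theta>(1)]] A(1) by simp
    qed (simp add: ext_OK)
    then have "principal L (ideal_gen L (ideal_pow K A n))" for n
      using L.OK_power[OF \<theta>(1)] principal_def by blast
    then show "cyclic_classes K A \<subseteq> cap_kernel K L"
      unfolding cyclic_classes_def cap_kernel_def using K.nz_ideal_pow[OF nzA] by blast
  qed
qed

end

section \<open>Roots of unity in a CM-field\<close>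

context cm_ctx
begin

text \<open>Lagrange's argument: multiplication by \<open>x\<close> permutes \<open>W\<close>, and
  comparing the products over \<open>W\<close> gives \<open>x ^ card W = 1\<close>. Equality follows
  because there are only \<open>card W\<close> such roots of unity.\<close>

lemma W_eq_roots:
  assumes fin: "finite W"
  shows "card W > 0" "W = {z. z ^ card W = 1}"
proof -
  show pos: "card W > 0" using fin W_1 card_gt_0_iff by blast
  have "x ^ card W = 1" if x: "x \<in> W" for x
  proof -
    have bij: "bij_betw (\<lambda>y. x * y) W W"
      by (rule bij_betwI[of _ _ _ "\<lambda>y. inverse x * y"])
         (use x W_mult W_inverse W_nonzero[OF x] in \<open>auto simp flip: mult.assoc\<close>)
    have "(\<Prod>y\<in>W. y) = (\<Prod>y\<in>W. x * y)" by (rule prod.reindex_bij_betw[OF bij, symmetric])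
    also have "\<dots> = x ^ card W * (\<Prod>y\<in>W. y)" by (simp add: prod.distrib)
    finally show ?thesis using fin W_nonzero by (simp add: prod_zero_iff)
  qed
  then have "W \<subseteq> {z. z ^ card W = 1}" by blast
  moreover have "finite {z::complex. z ^ card W = 1}" "card {z::complex. z ^ card W = 1} = card W"
    using pos by (simp_all add: finite_roots_unity card_roots_unity_eq)
  ultimately show "W = {z. z ^ card W = 1}" by (metis card_subset_eq)
qed

text \<open>\<open>\<eta>\<close> is g^r for a generator g of the cyclic group \<open>W\<close>. As
  r is odd and the order is even, the even powers of g are the squares and the odd powers are \<eta>
  times squares.\<close>

lemma W_squares_cis:
  assumes r: "card W = 2 ^ m * r" "odd r" "m \<ge> 1"
  defines "\<eta> \<equiv> cis (2 * pi / 2 ^ m)"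
  shows "\<eta> \<in> W" "\<And>\<rho>. \<rho> \<in> W \<Longrightarrow> \<exists>s\<in>W. \<rho> = s\<^sup>2 \<or> \<rho> = \<eta> * s\<^sup>2" "\<And>s. s \<in> W \<Longrightarrow> \<eta> \<noteq> s\<^sup>2"
proof -
  define w where "w = card W"
  have "w > 0" using r by (simp add: w_def odd_pos)
  \<comment> \<open>An infinite set would have cardinality 0.\<close>
  then have fin: "finite W" unfolding w_def using card_gt_0_iff by blast
  have W: "x \<in> W \<longleftrightarrow> x ^ w = 1" for x using W_eq_roots(2)[OF fin] by (auto simp: w_def)
  have "even w" using r by (simp add: w_def)
  define g where "g = cis (2 * pi / w)"
  have gpow: "g ^ k = cis (2 * pi * k / w)" for k
    by (simp add: g_def DeMoivre algebra_simps)
  have gw: "g ^ w = 1" using \<open>w > 0\<close> by (simp add: gpow)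
  have gW: "g ^ k \<in> W" for k by (metis W gw mult.commute power_mult power_one)
  have ex: "\<exists>k. x = g ^ k" if "x \<in> W" for x
  proof -
    have "x \<in> (\<lambda>k. cis (2 * pi * real k / real w)) ` {..<w}"
      using bij_betw_roots_unity[OF \<open>w > 0\<close>] that W[of x] unfolding bij_betw_def by blast
    then show ?thesis using gpow by auto
  qed
  have \<eta>: "\<eta> = g ^ r"
    unfolding gpow \<eta>_def using r \<open>w > 0\<close> by (simp add: w_def field_simps)
  show "\<eta> \<in> W" unfolding \<eta> by (rule gW)
  have "r \<le> w" using r by (simp add: w_def)
  show "\<exists>s\<in>W. \<rho> = s\<^sup>2 \<or> \<rho> = \<eta> * s\<^sup>2" if \<rho>: "\<rho> \<in> W" for \<rho>
  proof -
    obtain k where k: "\<rho> = g ^ k" using ex[OF \<rho>] by blast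
    show ?thesis
    proof (cases "even k")
      case True
      then have "\<rho> = (g ^ (k div 2))\<^sup>2" unfolding k by (simp flip: power_mult)
      then show ?thesis using gW by blast
    next
      case False
      \<comment> \<open>Adding w keeps the difference nonnegative and changes neither its parity, w
        being even, nor the power of g.\<close>
      define n where "n = (k + w - r) div 2"
      have "even (k + w - r)" using False \<open>even w\<close> r(2) \<open>r \<le> w\<close> by simp
      then have n: "r + n * 2 = k + w" using \<open>r \<le> w\<close> unfolding n_def by auto
      have "\<eta> * (g ^ n)\<^sup>2 = g ^ (r + n * 2)" by (simp add: \<eta> power_add power_mult)
      also have "\<dots> = \<rho>" unfolding n by (simp add: power_add gw k)
      finally show ?thesis using gW by metis
    qed
  qed
  show "\<eta> \<noteq> s\<^sup>2" if "s \<in> W" for s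
  proof
    assume eq: "\<eta> = s\<^sup>2"
    \<comment> \<open>Raising to the power w / 2 separates the classes: squares give 1, odd powers
      of g give -1.\<close>
    have "\<eta> ^ (w div 2) = s ^ w" unfolding eq using \<open>even w\<close> by (simp flip: power_mult)
    also have "\<dots> = 1" using that W by blast
    finally have one: "\<eta> ^ (w div 2) = 1" .
    have "\<eta> ^ (w div 2) = (g ^ (w div 2)) ^ r" unfolding \<eta> by (simp add: mult.commute flip: power_mult)
    also have "g ^ (w div 2) = cis pi"
      unfolding gpow using \<open>even w\<close> \<open>w > 0\<close> by (simp add: real_of_nat_div)
    also have "cis pi ^ r = -1" using r(2) by simp
    finally show False using one by simp
  qed
qed

text \<open>Conjugation negates both \<open>b\<close> and \<open>\<i>\<close>, so b / \<i> lies in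
  \<open>K\<close> and a = - (b / \<i>)^2 is a unit times a square.\<close>

lemma generator_square_even:
  assumes i: "\<i> \<in> L" and a: "a \<in> K" "a \<noteq> 0" "b \<in> L" "b\<^sup>2 = a" "L = adjoin K b" and P: "prime_ideal K P"
  shows "even (vP K P a)"
proof -
  have b: "cnj b = - b" using generator_imaginary(1) a by blast
  have t: "b / \<i> \<in> K" using K_I[OF L.divide_in[OF a(3) i]] b by simp
  have "a = (-1) * (b / \<i>)\<^sup>2" using a by (simp add: power_mult_distrib)
  moreover have "pideal K (-1) = OK K"
    using K.ideal_eq_OK[OF K.is_ideal_pideal] K.OK_minus[OF K.OK_1] by (simp add: pideal_divide_iff)
  then have "even (vP K P (-1))"
    using K.vP_even_if_square[OF P, of "-1" "OK K"] K.OK_minus[OF K.OK_1] by simp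
  ultimately show ?thesis
    using K.vP_mult_square_even_iff[OF P, of "-1" "b / \<i>"] t a K.minus_in[OF K.one_in] by auto
qed

text \<open>\<open>ess_ramified\<close> allows fractional radicands, while \<delta> must be
  integral. Multiplying \<open>b\<close> by a denominator changes \<open>a\<close> by a square,
  which preserves all parities.\<close>

lemma integral_generator:
  assumes a: "a \<in> K" "a \<noteq> 0" "b \<in> L" "b\<^sup>2 = a" "L = adjoin K b"
  shows "\<exists>a'\<in>OK K. \<exists>b'\<in>OK L. a' \<noteq> 0 \<and> b'\<^sup>2 = a' \<and> L = adjoin K b' \<and>
    (\<forall>P. prime_ideal K P \<longrightarrow> even (vP K P a') \<longleftrightarrow> even (vP K P a))"
proof -
  obtain N :: nat where N: "N > 0" "of_nat N * b \<in> OK L" using L.int_multiple_in_OK[OF a(3)] by blast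
  let ?b = "of_nat N * b" and ?a = "a * (of_nat N)\<^sup>2"
  have sq: "?b\<^sup>2 = ?a" using a by (simp add: power_mult_distrib)
  have cnj_b: "cnj ?b = - ?b" "?b \<noteq> 0" using generator_imaginary[OF a(3) _ a(5)] a N by auto
  have "?a \<in> OK L" using L.OK_power[OF N(2), of 2] sq by simp
  moreover have "?a \<in> K" using a K.mult_in K.power_in by simp
  ultimately have "?a \<in> OK K" by (rule OK_K_I)
  moreover have "L = adjoin K ?b" using imaginary_quadratic(2)[OF L.OK_in[OF N(2)] cnj_b(2,1)] .
  moreover have "\<forall>P. prime_ideal K P \<longrightarrow> even (vP K P ?a) \<longleftrightarrow> even (vP K P a)"
    using K.vP_mult_square_even_iff a N by simp
  ultimately show ?thesis using N(2) sq a N(1) by (intro bexI[of _ ?a] bexI[of _ ?b]) auto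
qed

lemma theta_sqrt:
  assumes w: "card W mod 4 = 2" and a: "a \<in> OK K" "a \<noteq> 0" "b \<in> L" "b\<^sup>2 = a" "L = adjoin K b"
  shows "cm_theta_ctx L K b (-1) a 1"
proof -
  have "card W = 2 * (card W div 2)" "odd (card W div 2)" using w by presburger+
  then have W: "card W = 2 ^ 1 * (card W div 2)" "odd (card W div 2)" by simp_all
  \<comment> \<open>This is \<open>W_squares_cis\<close> for m = 1, where the root of unity is
    -1.\<close>
  have cis: "cis (2 * pi / 2 ^ 1) = -1" by simp
  note * = W_squares_cis[OF W order_refl, unfolded cis]
  have b: "cnj b = - b" "b \<noteq> 0" using generator_imaginary[OF a(3) _ a(5)] a K.OK_in by auto
  have bO: "b \<in> OK L" using alg_int_of_power[of b 2] a by (simp add: OK_def)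
  have eta: "b = -1 * cnj b" and sq: "b\<^sup>2 = 1 * a" using b a by simp_all
  show ?thesis
    by (intro cm_theta_ctx.intro cm_theta_ctx_axioms.intro cm_ctx_axioms bO b(2) *(1) eta a(1) W_1 sq *(2) *(3))
qed

lemma i_in_L:
  assumes "card W mod 2 ^ (m + 1) = 2 ^ m" "m \<ge> 2"
  shows "\<i> \<in> L" "\<i> \<in> W"
proof -
  have "2 ^ m dvd card W" using assms(1) by (metis dvd_mod_imp_dvd dvd_refl le_add1 le_imp_power_dvd)
  moreover have "(2::nat) ^ 2 dvd 2 ^ m" using assms(2) by (rule le_imp_power_dvd)
  ultimately obtain k where k: "card W = 4 * k" by (auto elim!: dvdE)
  have "card W > 0" using assms by (cases "card W = 0") auto
  then have fin: "finite W" using card_gt_0_iff by blast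
  have "\<i> ^ card W = (\<i> ^ 4) ^ k" unfolding k by (simp add: power_mult)
  then have "\<i> ^ card W = 1" by simp
  then show "\<i> \<in> W" using W_eq_roots(2)[OF fin] by blast
  then show "\<i> \<in> L" using W_OK L.OK_in by blast
qed

text \<open>The two identities behind this instance are (1 + \<zeta>) / (1 + 1/\<zeta>) = \<zeta>
  and (1 + \<zeta>)^2 = \<zeta> (2 + \<zeta> + 1/\<zeta>).\<close>

lemma theta_one_plus_zeta:
  assumes m: "card W mod 2 ^ (m + 1) = 2 ^ m" "m \<ge> 2"
  defines "\<zeta> \<equiv> cis (2 * pi / 2 ^ m)"
  shows "cm_theta_ctx L K (1 + \<zeta>) \<zeta> (cm_pi m) \<zeta>"
proof -
  define q where "q = card W div 2 ^ (m + 1)"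
  have "card W = 2 ^ m * (2 * q + 1)"
    using div_mult_mod_eq[of "card W" "2 ^ (m + 1)"] m(1) by (simp add: q_def algebra_simps)
  then have *: "\<zeta> \<in> W" "\<And>\<rho>. \<rho> \<in> W \<Longrightarrow> \<exists>s\<in>W. \<rho> = s\<^sup>2 \<or> \<rho> = \<zeta> * s\<^sup>2" "\<And>s. s \<in> W \<Longrightarrow> \<zeta> \<noteq> s\<^sup>2"
    using W_squares_cis[of m "2 * q + 1"] m(2) by (simp_all add: \<zeta>_def)
  have \<zeta>0: "\<zeta> \<noteq> 0" using W_nonzero *(1) by blast
  have cnj: "cnj \<zeta> = inverse \<zeta>" by (rule W_cnj[OF *(1)])
  have pi: "cm_pi m = 2 + \<zeta> + inverse \<zeta>"
    unfolding cm_pi_def \<zeta>_def by (simp add: cis_inverse)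
  \<comment> \<open>-1 is the square of \<open>\<i>\<close>, which lies in \<open>W\<close>, whereas
    \<zeta> is not a square there.\<close>
  have "\<zeta> \<noteq> -1" using *(3)[OF i_in_L(2)[OF m]] by simp
  then have nz: "1 + \<zeta> \<noteq> 0" by (metis add.commute add_eq_0_iff)
  have OK: "1 + \<zeta> \<in> OK L" using W_OK *(1) L.OK_add L.OK_1 by blast
  have "cm_pi m = 1 + 1 + \<zeta> + inverse \<zeta>" by (simp add: pi)
  also have "\<dots> \<in> OK L" using W_OK W_inverse *(1) by (intro L.OK_add) auto
  finally have "cm_pi m \<in> OK L" .
  moreover have "cnj (cm_pi m) = cm_pi m" by (simp add: pi cnj)
  ultimately have pi_OK: "cm_pi m \<in> OK K" using OK_K_I K_I L.OK_in by blast
  have eta: "1 + \<zeta> = \<zeta> * cnj (1 + \<zeta>)" using \<zeta>0 by (simp add: cnj distrib_left)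
  have sq: "(1 + \<zeta>)\<^sup>2 = \<zeta> * cm_pi m" using \<zeta>0 by (simp add: pi power2_eq_square algebra_simps)
  show ?thesis
    by (intro cm_theta_ctx.intro cm_theta_ctx_axioms.intro cm_ctx_axioms OK nz *(1) eta pi_OK sq *(2) *(3))
qed

end

theorem theorem1:
  fixes L K :: "complex set"
  assumes "CM_field L" and "K = max_real_subfield L"
  defines "w \<equiv> card (roots_of_unity L)"
  shows
   "(w mod 4 = 2 \<longrightarrow>
      (ess_ramified K L \<longrightarrow> hasse_Q K L = 1 \<and> cap_kernel K L = trivial_classes K) \<and>
      (\<not> ess_ramified K L \<longrightarrow>
         (\<exists>a A. a \<in> OK K \<and> a \<noteq> 0 \<and> (\<exists>b\<in>L. b^2 = a \<and> L = adjoin K b) \<and>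
                is_ideal K A \<and> pideal K a = ideal_mult K A A) \<and>
         (\<forall>a A. a \<in> OK K \<and> a \<noteq> 0 \<and> (\<exists>b\<in>L. b^2 = a \<and> L = adjoin K b) \<and>
                is_ideal K A \<and> pideal K a = ideal_mult K A A \<longrightarrow>
            (principal K A \<longrightarrow> hasse_Q K L = 2) \<and>
            (\<not> principal K A \<longrightarrow> hasse_Q K L = 1 \<and> cap_kernel K L = cyclic_classes K A))))
    \<and>
    (\<forall>m::nat. m \<ge> 2 \<and> w mod 2^(m+1) = 2^m \<longrightarrow>
      \<not> ess_ramified K L \<and>
      ((\<not> (\<exists>B. is_ideal K B \<and> pideal K (cm_pi m) = ideal_mult K B B)) \<longrightarrow>
           hasse_Q K L = 1 \<and> cap_kernel K L = trivial_classes K) \<and>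
      (\<forall>B. is_ideal K B \<and> pideal K (cm_pi m) = ideal_mult K B B \<longrightarrow>
           (principal K B \<longrightarrow> hasse_Q K L = 2) \<and>
           (\<not> principal K B \<longrightarrow> hasse_Q K L = 1 \<and> cap_kernel K L = cyclic_classes K B)))"
proof (intro conjI impI allI)
  interpret cm_ctx L K using CM_field_cm_ctx[OF assms(1)] assms(2) by simp
  obtain b0 where b0: "b0 \<in> L" "b0 \<noteq> 0" "cnj b0 = - b0" using ex_imaginary by blast
  {
    assume w: "w mod 4 = 2"
    note theta = theta_sqrt[OF w[unfolded w_def]]
    {
      assume "ess_ramified K L"
      then obtain a b P where *: "a \<in> K" "a \<noteq> 0" "b \<in> L" "b\<^sup>2 = a" "L = adjoin K b" "prime_ideal K P" "odd (vP K P a)"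
        unfolding ess_ramified_def by blast
      \<comment> \<open>The witness of ramification is replaced by an integral radicand with the
        same parity at P, which can serve as \<delta>.\<close>
      obtain a' b' where ab: "a' \<in> OK K" "b' \<in> OK L" "a' \<noteq> 0" "b'\<^sup>2 = a'" "L = adjoin K b'" "odd (vP K P a')"
        using integral_generator[OF *(1-5)] *(6,7) by blast
      interpret cm_theta_ctx L K b' "-1" a' 1 using theta ab L.OK_in by blast
      have "\<nexists>B. is_ideal K B \<and> pideal K a' = ideal_mult K B B"
        using K.vP_even_if_square[OF *(6) ab(1,3)] ab(6) by blast
      from no_sqrt_ideal[OF this] show "hasse_Q K L = 1" "cap_kernel K L = trivial_classes K" .
    next
      assume nram: "\<not> ess_ramified K L"
      \<comment> \<open>Any nonzero imaginary element generates L; its multiple by a denominator has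
        an integral square.\<close>
      obtain a b where ab: "a \<in> OK K" "b \<in> OK L" "a \<noteq> 0" "b\<^sup>2 = a" "L = adjoin K b"
        using integral_generator[OF imaginary_quadratic(1)[OF b0] _ b0(1) refl imaginary_quadratic(2)[OF b0]] b0(2)
        by auto
      have "even (vP K P a)" if "prime_ideal K P" for P
        using nram that ab K.OK_in L.OK_in unfolding ess_ramified_def by blast
      then obtain A where "is_ideal K A" "pideal K a = ideal_mult K A A"
        using K.square_if_vP_even[OF ab(1,3)] by blast
      then show "\<exists>a A. a \<in> OK K \<and> a \<noteq> 0 \<and> (\<exists>b\<in>L. b^2 = a \<and> L = adjoin K b) \<and>
          is_ideal K A \<and> pideal K a = ideal_mult K A A"
        using ab L.OK_in by blast
    next
      fix a A
      assume *: "a \<in> OK K \<and> a \<noteq> 0 \<and> (\<exists>b\<in>L. b^2 = a \<and> L = adjoin K b) \<and>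
          is_ideal K A \<and> pideal K a = ideal_mult K A A"
      then obtain b where b: "b \<in> L" "b\<^sup>2 = a" "L = adjoin K b" by blast
      \<comment> \<open>Each admissible pair gets its own instance, with its own radicand as
        \<delta>.\<close>
      interpret cm_theta_ctx L K b "-1" a 1 using theta * b by blast
      show "principal K A \<Longrightarrow> hasse_Q K L = 2"
        and "\<not> principal K A \<Longrightarrow> hasse_Q K L = 1"
        and "\<not> principal K A \<Longrightarrow> cap_kernel K L = cyclic_classes K A"
        using * sqrt_ideal_principal sqrt_ideal_nonprincipal by blast+
    }
  }
  fix m :: nat
  assume "m \<ge> 2 \<and> w mod 2 ^ (m + 1) = 2 ^ m"
  then have m: "card W mod 2 ^ (m + 1) = 2 ^ m" "m \<ge> 2" by (simp_all add: w_def)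
  show "\<not> ess_ramified K L"
    using generator_square_even[OF i_in_L(1)[OF m]] unfolding ess_ramified_def by blast
  interpret cm_theta_ctx L K "1 + cis (2 * pi / 2 ^ m)" "cis (2 * pi / 2 ^ m)" "cm_pi m" "cis (2 * pi / 2 ^ m)"
    by (rule theta_one_plus_zeta[OF m])
  show "hasse_Q K L = 1" "cap_kernel K L = trivial_classes K"
    if "\<not> (\<exists>B. is_ideal K B \<and> pideal K (cm_pi m) = ideal_mult K B B)"
    using no_sqrt_ideal[OF that] by blast+
  fix B
  assume *: "is_ideal K B \<and> pideal K (cm_pi m) = ideal_mult K B B"
  show "principal K B \<Longrightarrow> hasse_Q K L = 2"
    and "\<not> principal K B \<Longrightarrow> hasse_Q K L = 1"
    and "\<not> principal K B \<Longrightarrow> cap_kernel K L = cyclic_classes K B"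
    using * sqrt_ideal_principal sqrt_ideal_nonprincipal by blast+
qed

end
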